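(* Assume the Riemann Hypothesis. Let $m\ge 2$ be a fixed integer and let $\epsilon>0$. Then for $x$ sufficiently large $$S_m(x)=\frac{1}{m+1}x^{m+1}-\frac12x^m\left(\log x-H_m+\gamma_E+\log 2\pi\right)+O(x^{m-\frac34+\epsilon}),$$ and therefore $$E_m(x)\ll x^{m-\frac34+\epsilon},$$ where the implied constants depend only on $m$ and $\epsilon$.
   Context: Throughout $p$ denotes a prime and $\gamma_E=0.5772\ldots$ is the Euler–Mascheroni constant. Let $C_2=\prod_{p>2}\left(1-\frac{1}{(p-1)^2}\right)$. For integers $k\ge 1$ define $\mathfrak{S}(k)=2C_2\prod_{p\mid k,\ p>2}\frac{p-1}{p-2}$ if $k$ is even and $\mathfrak{S}(k)=0$ if $k$ is odd. For an integer $m\ge1$ let $$S_m(x)=\sum_{k\le x}(x-k)^m\mathfrak{S}(k),\qquad H_m=\sum_{n=1}^m\frac1n,$$ and define $E_m(x)$ by $$S_m(x)=\frac{1}{m+1}x^{m+1}-\frac12x^m\left(\log x-H_m+\gamma_E+\log 2\pi\right)+E_m(x).$$ *)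

theory Defs
  imports
    "HOL-Complex_Analysis.Complex_Analysis"
    "HOL-Library.Landau_Symbols"
    "HOL-Computational_Algebra.Primes"
begin

definition zeta_continuation :: "(complex \<Rightarrow> complex) \<Rightarrow> bool" where
  "zeta_continuation f \<longleftrightarrow>
     f holomorphic_on (- {1}) \<and>
     (\<forall>s. Re s > 1 \<longrightarrow> (\<lambda>n. 1 / of_nat (Suc n) powr s) sums f s)"

text \<open>The value of \<open>riemann_zeta\<close> at the pole \<open>s = 1\<close> is unspecified; by
  \<open>zeta_continuation_exists\<close> and \<open>zeta_continuation_unique\<close> below, all other values are those of the
  analytic continuation of the Dirichlet series.\<close>

definition riemann_zeta :: "complex \<Rightarrow> complex" where
  "riemann_zeta = (SOME f. zeta_continuation f)"

definition riemann_hypothesis :: bool where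
  "riemann_hypothesis \<longleftrightarrow>
     (\<forall>s. 0 < Re s \<and> Re s < 1 \<and> riemann_zeta s = 0 \<longrightarrow> Re s = 1 / 2)"

definition twin_prime_const :: real where
  "twin_prime_const = (\<Prod>p. if prime p \<and> p > 2 then 1 - 1 / (real p - 1)\<^sup>2 else 1)"

definition singular_series :: "nat \<Rightarrow> real" where
  "singular_series k =
     (if even k
      then 2 * twin_prime_const * (\<Prod>p | prime p \<and> p dvd k \<and> p > 2. (real p - 1) / (real p - 2))
      else 0)"

definition S_sum :: "nat \<Rightarrow> real \<Rightarrow> real" where
  "S_sum m x = (\<Sum>k | 1 \<le> k \<and> real k \<le> x. (x - real k) ^ m * singular_series k)"

definition E_err :: "nat \<Rightarrow> real \<Rightarrow> real" where
  "E_err m x = S_sum m x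
     - (1 / (real m + 1) * x ^ (m + 1)
        - 1 / 2 * x ^ m * (ln x - harm m + euler_mascheroni + ln (2 * pi)))"

text \<open>The infinite product defining \<open>twin_prime_const\<close> converges, and the zeta function exists.
  For the latter, Taylor expansion of \<open>(n + 1) powr (1 - s)\<close> around \<open>n\<close>, summed over \<open>n\<close>, expresses
  \<open>(s - 1) \<zeta>(s)\<close> through \<open>\<zeta>(s + 1), \<zeta>(s + 2), \<dots>\<close> and a remainder holomorphic further to the left.\<close>

lemma twin_prime_const_convergent:
  "convergent_prod (\<lambda>p. if prime p \<and> p > 2 then 1 - 1 / (real p - 1)\<^sup>2 else 1)"
proof (intro abs_convergent_prod_imp_convergent_prod summable_imp_abs_convergent_prod)
  let ?f = "\<lambda>p. if prime p \<and> p > 2 then 1 - 1 / (real p - 1)\<^sup>2 else 1"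
  have "summable (\<lambda>n. 1 / (real n)\<^sup>2)"
    using inverse_power_summable[of 2, where ?'a = real] by (simp add: field_simps)
  hence "summable (\<lambda>n. 1 / (real (Suc n) - 1)\<^sup>2)" by simp
  hence "summable (\<lambda>n. 1 / (real n - 1)\<^sup>2)" by (subst (asm) summable_Suc_iff)
  thus "summable (\<lambda>p. norm (?f p - 1))"
    by (rule summable_comparison_test') auto
qed

lemma holomorphic_suminf:
  fixes f :: "nat \<Rightarrow> complex \<Rightarrow> complex"
  assumes "open A" and hol: "\<And>n. f n holomorphic_on A"
    and loc: "\<And>z. z \<in> A \<Longrightarrow> \<exists>d>0. cball z d \<subseteq> A \<and>
                (\<exists>M. summable M \<and> (\<forall>n. \<forall>w\<in>cball z d. norm (f n w) \<le> M n))"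
  shows "(\<lambda>z. \<Sum>n. f n z) holomorphic_on A" and "z \<in> A \<Longrightarrow> summable (\<lambda>n. f n z)"
proof -
  show "(\<lambda>z. \<Sum>n. f n z) holomorphic_on A"
  proof (rule holomorphic_uniform_sequence[OF \<open>open A\<close>])
    show "(\<lambda>z. \<Sum>i<n. f i z) holomorphic_on A" for n
      by (intro holomorphic_intros hol)
    fix x assume "x \<in> A"
    from loc[OF this] obtain d M where dM: "d > 0" "cball x d \<subseteq> A" "summable M"
      "\<forall>n. \<forall>w\<in>cball x d. norm (f n w) \<le> M n" by blast
    have "uniform_limit (cball x d) (\<lambda>n z. \<Sum>i<n. f i z) (\<lambda>z. \<Sum>n. f n z) sequentially"
      using dM by (intro Weierstrass_m_test) auto
    with dM show "\<exists>d>0. cball x d \<subseteq> A \<and>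
        uniform_limit (cball x d) (\<lambda>n z. \<Sum>i<n. f i z) (\<lambda>z. \<Sum>n. f n z) sequentially"
      by blast
  qed
  show "summable (\<lambda>n. f n z)" if z: "z \<in> A"
  proof -
    from loc[OF z] obtain d M where dM: "d > 0" "summable M"
      "\<forall>n. \<forall>w\<in>cball z d. norm (f n w) \<le> M n" by blast
    show ?thesis
      using dM by (intro summable_comparison_test'[OF dM(2), of 0]) auto
  qed
qed

lemma norm_of_nat_powr:
  "norm (of_nat (Suc n) powr s :: complex) = real (Suc n) powr Re s"
  by (subst norm_powr_real_powr) (auto simp del: of_nat_Suc)

lemma summable_Suc_powr: "q < -1 \<Longrightarrow> summable (\<lambda>n. real (Suc n) powr q)"
  using summable_real_powr_iff[of q] by (subst summable_Suc_iff) auto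

lemma zeta_series_half_plane:
  shows "(\<lambda>s. \<Sum>n. of_nat (Suc n) powr (-s) :: complex) holomorphic_on {s. Re s > 1}"
    and "Re s > 1 \<Longrightarrow> summable (\<lambda>n. of_nat (Suc n) powr (-s) :: complex)"
proof -
  have op: "open {s. Re s > 1}" by (rule open_halfspace_Re_gt)
  have hol: "(\<lambda>s. of_nat (Suc n) powr (-s) :: complex) holomorphic_on {s. Re s > 1}" for n
    by (intro holomorphic_intros) (auto simp del: of_nat_Suc)
  have loc: "\<exists>d>0. cball z d \<subseteq> {s. Re s > 1} \<and> (\<exists>M. summable M \<and>
        (\<forall>n. \<forall>w\<in>cball z d. norm (of_nat (Suc n) powr (-w) :: complex) \<le> M n))"
    if "z \<in> {s. Re s > 1}" for z
  proof -
    define d where "d = (Re z - 1) / 2"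
    have d: "d > 0" using that by (simp add: d_def)
    have re: "Re w \<ge> 1 + d" if "w \<in> cball z d" for w
      using that abs_Re_le_cmod[of "z - w"] by (auto simp: dist_norm d_def field_simps)
    have "norm (of_nat (Suc n) powr (-w) :: complex) \<le> real (Suc n) powr (-(1 + d))"
      if "w \<in> cball z d" for n w
      using re[OF that] unfolding norm_of_nat_powr by (intro powr_mono) auto
    moreover have "summable (\<lambda>n. real (Suc n) powr (-(1 + d)))"
      using d by (intro summable_Suc_powr) auto
    moreover have "cball z d \<subseteq> {s. Re s > 1}" using re d by force
    ultimately show ?thesis using d by blast
  qed
  show "(\<lambda>s. \<Sum>n. of_nat (Suc n) powr (-s) :: complex) holomorphic_on {s. Re s > 1}"
    by (rule holomorphic_suminf(1)[OF op hol loc])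
  show "Re s > 1 \<Longrightarrow> summable (\<lambda>n. of_nat (Suc n) powr (-s) :: complex)"
    using holomorphic_suminf(2)[OF op hol loc, of s] by simp
qed

definition falling_prod :: "complex \<Rightarrow> nat \<Rightarrow> complex" where
  "falling_prod a k = (\<Prod>j<k. a - of_nat j)"

lemma powr_Taylor_bound:
  fixes a :: complex
  assumes "Re a < real (Suc N)"
  shows "norm (of_nat (Suc (Suc n)) powr a
            - (\<Sum>i\<le>N. falling_prod a i / fact i * of_nat (Suc n) powr (a - of_nat i)))
         \<le> norm (falling_prod a (Suc N)) * real (Suc n) powr (Re a - real (Suc N))"
proof -
  define S :: "complex set" where "S = closed_segment (of_nat (Suc n)) (of_nat (Suc (Suc n)))"
  define f where "f = (\<lambda>i t :: complex. falling_prod a i * t powr (a - of_nat i))"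
  have S: "Im t = 0 \<and> Re t \<ge> real (Suc n)" if "t \<in> S" for t
  proof -
    from that obtain u where u: "0 \<le> u" "u \<le> 1"
      "t = (1 - u) *\<^sub>R of_nat (Suc n) + u *\<^sub>R of_nat (Suc (Suc n))"
      unfolding S_def closed_segment_def by blast
    from u(3) have "t = of_real (real (Suc n) + u)"
      by (simp add: scaleR_conv_of_real algebra_simps)
    hence "Re t = real (Suc n) + u" "Im t = 0" by (simp_all only: Re_complex_of_real Im_complex_of_real)
    with u(1) show ?thesis by simp
  qed
  have nz: "t \<notin> \<real>\<^sub>\<le>\<^sub>0" "t \<noteq> 0" if "t \<in> S" for t
    using S[OF that] by (auto simp: complex_nonpos_Reals_iff)
  have "norm (f 0 (of_nat (Suc (Suc n)))
        - (\<Sum>i\<le>N. f i (of_nat (Suc n)) * (of_nat (Suc (Suc n)) - of_nat (Suc n)) ^ i / fact i))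
      \<le> (norm (falling_prod a (Suc N)) * real (Suc n) powr (Re a - real (Suc N)))
          * norm (of_nat (Suc (Suc n)) - of_nat (Suc n) :: complex) ^ Suc N / fact N"
  proof (rule complex_Taylor[of S])
    show "convex S" by (simp add: S_def)
    show "of_nat (Suc n) \<in> S" "of_nat (Suc (Suc n)) \<in> S" by (auto simp: S_def)
    fix x assume x: "x \<in> S"
    show "(f i has_field_derivative f (Suc i) x) (at x within S)" for i
    proof -
      have "((\<lambda>t. falling_prod a i * t powr (a - of_nat i)) has_field_derivative
              falling_prod a i * ((a - of_nat i) * x powr (a - of_nat i - 1))) (at x)"
        using nz[OF x] by (intro DERIV_cmult has_field_derivative_powr) auto
      hence "(f i has_field_derivative f (Suc i) x) (at x)"
        by (simp add: f_def falling_prod_def algebra_simps)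
      thus ?thesis by (rule has_field_derivative_at_within)
    qed
    have "norm (x powr (a - of_nat (Suc N))) = Re x powr (Re a - real (Suc N))"
      using S[OF x] by (subst norm_powr_real_powr) (auto simp: complex_is_Real_iff)
    also have "\<dots> \<le> real (Suc n) powr (Re a - real (Suc N))"
      using S[OF x] assms by (intro powr_mono2') auto
    finally show "norm (f (Suc N) x) \<le> norm (falling_prod a (Suc N)) * real (Suc n) powr (Re a - real (Suc N))"
      unfolding f_def norm_mult by (rule mult_left_mono) auto
  qed
  also have "norm (of_nat (Suc (Suc n)) - of_nat (Suc n) :: complex) = 1" by simp
  also have "(norm (falling_prod a (Suc N)) * real (Suc n) powr (Re a - real (Suc N))) * 1 ^ Suc N / fact N
     \<le> (norm (falling_prod a (Suc N)) * real (Suc n) powr (Re a - real (Suc N))) / 1"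
    unfolding power_one mult_1_right by (intro divide_left_mono) auto
  finally show ?thesis by (simp add: f_def falling_prod_def mult_ac)
qed

definition zeta_rem_term :: "nat \<Rightarrow> nat \<Rightarrow> complex \<Rightarrow> complex" where
  "zeta_rem_term N n s = of_nat (Suc (Suc n)) powr (1 - s)
     - (\<Sum>i\<le>N. falling_prod (1 - s) i / fact i * of_nat (Suc n) powr (1 - s - of_nat i))"

lemma falling_prod_holomorphic: "(\<lambda>s. falling_prod (1 - s) k) holomorphic_on A"
  unfolding falling_prod_def by (intro holomorphic_intros)

lemma zeta_rem_term_suminf:
  shows "(\<lambda>s. \<Sum>n. zeta_rem_term N n s) holomorphic_on {s. Re s > 1 - real N}"
    and "Re s > 1 - real N \<Longrightarrow> summable (\<lambda>n. zeta_rem_term N n s)"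
proof -
  let ?A = "{s. Re s > 1 - real N}"
  have op: "open ?A" by (rule open_halfspace_Re_gt)
  have hol: "zeta_rem_term N n holomorphic_on ?A" for n
    unfolding zeta_rem_term_def by (intro holomorphic_intros falling_prod_holomorphic) (auto simp del: of_nat_Suc)
  have loc: "\<exists>d>0. cball z d \<subseteq> ?A \<and> (\<exists>M. summable M \<and>
        (\<forall>n. \<forall>w\<in>cball z d. norm (zeta_rem_term N n w) \<le> M n))" if "z \<in> ?A" for z
  proof -
    define d where "d = (Re z - (1 - real N)) / 2"
    have d: "d > 0" using that by (simp add: d_def)
    have re: "Re w \<ge> 1 - real N + d" if "w \<in> cball z d" for w
      using that abs_Re_le_cmod[of "z - w"] by (auto simp: dist_norm d_def field_simps)
    have "compact ((\<lambda>s. falling_prod (1 - s) (Suc N)) ` cball z d)"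
      by (intro compact_continuous_image holomorphic_on_imp_continuous_on falling_prod_holomorphic) auto
    from compact_imp_bounded[OF this] obtain K
      where K: "\<And>w. w \<in> cball z d \<Longrightarrow> norm (falling_prod (1 - w) (Suc N)) \<le> K"
      unfolding bounded_iff by blast
    have "norm (zeta_rem_term N n w) \<le> K * real (Suc n) powr (-(1 + d))"
      if w: "w \<in> cball z d" for n w
    proof -
      have "norm (zeta_rem_term N n w)
          \<le> norm (falling_prod (1 - w) (Suc N)) * real (Suc n) powr (Re (1 - w) - real (Suc N))"
        unfolding zeta_rem_term_def using re[OF w] d by (intro powr_Taylor_bound) auto
      also have "\<dots> \<le> K * real (Suc n) powr (-(1 + d))"
        using re[OF w] d K[OF w] order.trans[OF norm_ge_zero K[OF w]]
        by (intro mult_mono powr_mono) auto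
      finally show ?thesis .
    qed
    moreover have "summable (\<lambda>n. K * real (Suc n) powr (-(1 + d)))"
      using d by (intro summable_mult summable_Suc_powr) auto
    moreover have "cball z d \<subseteq> ?A" using re d by force
    ultimately show ?thesis using d by blast
  qed
  show "(\<lambda>s. \<Sum>n. zeta_rem_term N n s) holomorphic_on ?A"
    by (rule holomorphic_suminf(1)[OF op hol loc])
  show "Re s > 1 - real N \<Longrightarrow> summable (\<lambda>n. zeta_rem_term N n s)"
    using holomorphic_suminf(2)[OF op hol loc, of s] by simp
qed

lemma zeta_recurrence:
  assumes s: "Re s > 1"
  shows "(\<Sum>n. zeta_rem_term N n s) =
    -1 - (\<Sum>i=1..N. falling_prod (1 - s) i / fact i * (\<Sum>n. of_nat (Suc n) powr (-(s - 1 + of_nat i))))"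
proof -
  have lim: "(\<lambda>n. of_nat (Suc n) powr (1 - s) :: complex) \<longlonglongrightarrow> 0"
  proof (rule tendsto_norm_zero_cancel)
    have "(\<lambda>n. real (Suc n) powr (1 - Re s)) \<longlonglongrightarrow> 0"
      using s by real_asymp
    thus "(\<lambda>n. norm (of_nat (Suc n) powr (1 - s) :: complex)) \<longlonglongrightarrow> 0"
      unfolding norm_of_nat_powr by simp
  qed
  have "(\<lambda>n. of_nat (Suc (Suc n)) powr (1 - s) - of_nat (Suc n) powr (1 - s) :: complex)
          sums (0 - of_nat (Suc 0) powr (1 - s))"
    by (rule telescope_sums[OF lim])
  hence tel: "(\<lambda>n. of_nat (Suc (Suc n)) powr (1 - s) - of_nat (Suc n) powr (1 - s) :: complex)
          sums (-1)" by simp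
  have "(\<lambda>n. of_nat (Suc n) powr (-(s - 1 + of_nat i)) :: complex) sums
           (\<Sum>n. of_nat (Suc n) powr (-(s - 1 + of_nat i)))" if "i \<ge> 1" for i
    using s that by (intro summable_sums zeta_series_half_plane) auto
  hence "(\<lambda>n. \<Sum>i=1..N. falling_prod (1 - s) i / fact i * of_nat (Suc n) powr (-(s - 1 + of_nat i))) sums
     (\<Sum>i=1..N. falling_prod (1 - s) i / fact i * (\<Sum>n. of_nat (Suc n) powr (-(s - 1 + of_nat i))))"
    by (intro sums_sum sums_mult) auto
  from sums_diff[OF tel this]
  have "(\<lambda>n. zeta_rem_term N n s) sums (-1 - (\<Sum>i=1..N. falling_prod (1 - s) i / fact i *
          (\<Sum>n. of_nat (Suc n) powr (-(s - 1 + of_nat i)))))"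
  proof (rule sums_cong[THEN iffD1, rotated])
    fix n
    have "{..N} = insert 0 {1..N}" by auto
    thus "of_nat (Suc (Suc n)) powr (1 - s) - of_nat (Suc n) powr (1 - s)
       - (\<Sum>i=1..N. falling_prod (1 - s) i / fact i * of_nat (Suc n) powr (-(s - 1 + of_nat i)))
       = zeta_rem_term N n s"
      by (simp add: zeta_rem_term_def falling_prod_def algebra_simps)
  qed
  thus ?thesis by (rule sums_unique[symmetric])
qed

lemma zeta_half_plane_continuation:
  "\<exists>Z. Z holomorphic_on {s. Re s > 1 - real N} \<and>
     (\<forall>s. Re s > 1 \<longrightarrow> Z s = (s - 1) * (\<Sum>n. of_nat (Suc n) powr (-s)))"
proof (induction N)
  case 0
  show ?case
    by (intro exI[of _ "\<lambda>s. (s - 1) * (\<Sum>n. of_nat (Suc n) powr (-s))"] conjI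
          holomorphic_intros) (use zeta_series_half_plane(1) in auto)
next
  case (Suc N)
  then obtain Z where Z: "Z holomorphic_on {s. Re s > 1 - real N}"
    "\<And>s. Re s > 1 \<Longrightarrow> Z s = (s - 1) * (\<Sum>n. of_nat (Suc n) powr (-s))" by blast
  define W where "W = (\<lambda>s. 1 - (\<Sum>i=2..Suc N. falling_prod (1 - s) (i - 1) / fact i * Z (s - 1 + of_nat i))
       + (\<Sum>n. zeta_rem_term (Suc N) n s))"
  have "W holomorphic_on {s. Re s > 1 - real (Suc N)}"
    unfolding W_def
  proof (intro holomorphic_intros falling_prod_holomorphic zeta_rem_term_suminf)
    fix i assume "i \<in> {2..Suc N}"
    hence "(\<lambda>s. s - 1 + of_nat i) ` {s. Re s > 1 - real (Suc N)} \<subseteq> {s. Re s > 1 - real N}"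
      by auto
    moreover have "(\<lambda>s. s - 1 + of_nat i) holomorphic_on {s. Re s > 1 - real (Suc N)}"
      by (intro holomorphic_intros)
    ultimately have "(Z \<circ> (\<lambda>s. s - 1 + of_nat i)) holomorphic_on {s. Re s > 1 - real (Suc N)}"
      using holomorphic_on_compose_gen Z(1) by blast
    thus "(\<lambda>s. Z (s - 1 + of_nat i)) holomorphic_on {s. Re s > 1 - real (Suc N)}"
      by (simp add: o_def)
  qed auto
  moreover have "W s = (s - 1) * (\<Sum>n. of_nat (Suc n) powr (-s))" if s: "Re s > 1" for s
  proof -
    let ?z = "\<lambda>i::nat. (\<Sum>n. of_nat (Suc n) powr (-(s - 1 + of_nat i))) :: complex"
    have eq: "falling_prod (1 - s) i / fact i * ?z i = - (falling_prod (1 - s) (i - 1) / fact i * Z (s - 1 + of_nat i))"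
      if "i \<ge> 2" for i
    proof -
      have "falling_prod (1 - s) i = falling_prod (1 - s) (i - 1) * (1 - s - of_nat (i - 1))"
        using that by (cases i) (auto simp: falling_prod_def)
      also have "1 - s - of_nat (i - 1) = -(s - 1 + of_nat i - 1)"
        using that by (simp add: of_nat_diff)
      finally have "falling_prod (1 - s) i = - (falling_prod (1 - s) (i - 1) * (s - 1 + of_nat i - 1))"
        by (simp only: mult_minus_right)
      moreover have "Z (s - 1 + of_nat i) = (s - 1 + of_nat i - 1) * ?z i"
        using s that by (intro Z(2)) auto
      ultimately show ?thesis by simp
    qed
    have "{1..Suc N} = insert 1 {2..Suc N}" by auto
    hence "(\<Sum>i=1..Suc N. falling_prod (1 - s) i / fact i * ?z i)
         = (1 - s) * ?z 1 + (\<Sum>i=2..Suc N. falling_prod (1 - s) i / fact i * ?z i)"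
      by (simp add: falling_prod_def)
    also have "(\<Sum>i=2..Suc N. falling_prod (1 - s) i / fact i * ?z i)
       = - (\<Sum>i=2..Suc N. falling_prod (1 - s) (i - 1) / fact i * Z (s - 1 + of_nat i))"
      unfolding sum_negf[symmetric] by (rule sum.cong[OF refl]) (rule eq, auto)
    finally show ?thesis
      unfolding W_def zeta_recurrence[OF s] by (simp add: algebra_simps)
  qed
  ultimately show ?case by blast
qed

lemma zeta_continuation_unique:
  assumes "zeta_continuation f" "zeta_continuation g" "s \<noteq> 1"
  shows "f s = g s"
proof (rule analytic_continuation_open[of "{s. Re s > 1}" "- {1}" f g])
  show "open {s. Re s > 1}" by (rule open_halfspace_Re_gt)
  show "{s. Re s > 1} \<noteq> {}" by (auto intro!: exI[of _ 2])
  show "connected (- {1 :: complex})" by (rule connected_punctured_universe) simp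
  show "f z = g z" if "z \<in> {s. Re s > 1}" for z
    using that assms sums_unique2 unfolding zeta_continuation_def by blast
  show "f holomorphic_on - {1}" "g holomorphic_on - {1}"
    using assms by (auto simp only: zeta_continuation_def)
  show "s \<in> - {1}" using assms(3) by simp
qed auto

lemma zeta_continuation_exists: "\<exists>f. zeta_continuation f"
proof -
  let ?D = "\<lambda>s. (\<Sum>n. of_nat (Suc n) powr (-s)) :: complex"
  have "\<exists>Z. \<forall>N. Z N holomorphic_on {s. Re s > 1 - real N} \<and>
          (\<forall>s. Re s > 1 \<longrightarrow> Z N s = (s - 1) * ?D s)"
    by (intro choice allI zeta_half_plane_continuation)
  then obtain Z where
    Z: "\<And>N. Z N holomorphic_on {s. Re s > 1 - real N}"
       "\<And>N s. Re s > 1 \<Longrightarrow> Z N s = (s - 1) * ?D s"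
    by blast
  have ag: "Z M s = Z N s" if "M \<le> N" "Re s > 1 - real M" for M N s
  proof (rule analytic_continuation_open[of "{s. Re s > 1}" "{s. Re s > 1 - real M}" "Z M" "Z N"])
    show "open {s. Re s > 1}" by (rule open_halfspace_Re_gt)
    show "open {s. Re s > 1 - real M}" by (rule open_halfspace_Re_gt)
    show "{s. Re s > 1} \<noteq> {}" by (auto intro!: exI[of _ 2])
    show "connected {s. Re s > 1 - real M}"
      by (intro convex_connected convex_halfspace_Re_gt)
    show "Z N holomorphic_on {s. Re s > 1 - real M}"
      by (rule holomorphic_on_subset[OF Z(1)]) (use that in auto)
    show "Z M holomorphic_on {s. Re s > 1 - real M}" by (rule Z(1))
    show "s \<in> {s. Re s > 1 - real M}" using that by simp
    show "Z M z = Z N z" if "z \<in> {s. Re s > 1}" for z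
      using that Z(2) by simp
  qed auto
  define k where "k = (\<lambda>s. nat \<lceil>2 - Re s\<rceil>)"
  define F where "F = (\<lambda>s. Z (k s) s)"
  have k: "Re s > 1 - real (k s)" for s
    unfolding k_def by linarith
  have F: "F s = Z N s" if "Re s > 1 - real N" for N s
  proof (cases "N \<le> k s")
    case True
    from ag[OF this that] show ?thesis by (simp add: F_def)
  next
    case False
    hence "k s \<le> N" by simp
    from ag[OF this k] show ?thesis by (simp add: F_def)
  qed
  have "F holomorphic_on UNIV"
    unfolding holomorphic_on_def
  proof
    fix s :: complex
    have op: "open {w. Re w > 1 - real (k s)}" by (rule open_halfspace_Re_gt)
    have "F holomorphic_on {w. Re w > 1 - real (k s)}"
      using Z(1)[of "k s"] by (rule holomorphic_transform) (simp add: F)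
    hence "F field_differentiable (at s)"
      by (rule holomorphic_on_imp_differentiable_at[OF _ op]) (use k[of s] in simp)
    thus "F field_differentiable (at s within UNIV)" by simp
  qed
  hence "F holomorphic_on (- {1})" by (rule holomorphic_on_subset) simp
  hence "(\<lambda>s. F s / (s - 1)) holomorphic_on (- {1})"
    by (intro holomorphic_intros) auto
  moreover have "(\<lambda>n. 1 / of_nat (Suc n) powr s) sums (F s / (s - 1))" if s: "Re s > 1" for s
  proof -
    have "F s = (s - 1) * ?D s" using F[of 0 s] Z(2)[OF s] s by simp
    moreover have "s \<noteq> 1" using s by auto
    ultimately have "F s / (s - 1) = ?D s" by simp
    moreover have "(\<lambda>n. of_nat (Suc n) powr (-s)) sums ?D s"
      by (intro summable_sums zeta_series_half_plane s)
    ultimately show ?thesis by (simp add: powr_minus_divide)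
  qed
  ultimately show ?thesis unfolding zeta_continuation_def by blast
qed

lemma zeta_continuation_riemann_zeta: "zeta_continuation riemann_zeta"
  unfolding riemann_zeta_def by (rule someI_ex[OF zeta_continuation_exists])

end

theory Submission
  imports Defs
begin

text \<open>
  The singular series is multiplicative up to a constant, and its Dirichlet series factors for
  \<open>Re s > 1\<close> as
  \<open>F(s) = \<zeta>(s) \<zeta>(s + 1) G(s) / \<zeta>(2 s + 2)\<close>, where \<open>G\<close> is an Euler product that converges
  absolutely and is bounded for \<open>Re s > -3/4\<close> (\<open>has_sum_singular_series\<close>,
  \<open>sing_product_bounded\<close>). Perron's formula with weight \<open>(x - k)\<^sup>2\<close> (\<open>perron_formula\<close>) turns \<open>S_sum 2 x\<close>
  into the integral of \<open>F(s) x\<^sup>s \<cdot> 2 / (s (s + 1) (s + 2))\<close> over the line \<open>Re s = 2\<close>, up to the factor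
  \<open>x\<^sup>2 / 2\<pi>\<close>. The line is moved to \<open>Re s = -3/4 + \<delta>\<close>, just to the right of where the zeros of
  \<open>\<zeta>(2 s + 2)\<close> lie under the Riemann Hypothesis. The simple pole at \<open>1\<close> and the double pole at \<open>0\<close>
  produce the two main terms, and the remaining integral is \<open>O(x\<^sup>\<delta>\<^sup>-\<^sup>3\<^sup>/\<^sup>4)\<close> provided that it converges
  absolutely.

  Convergence needs \<open>|\<zeta>(s) \<zeta>(s + 1) / \<zeta>(2 s + 2)|\<close> to grow more slowly than \<open>|Im s|\<^sup>2\<close> on the
  new line. Under the Riemann Hypothesis \<open>\<zeta>\<close> has a logarithm to the right of \<open>1/2\<close>. By
  Borel-Caratheodory it is \<open>O(log t)\<close> there, it is bounded to the right of \<open>1\<close>, and the three circles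
  theorem interpolates to \<open>o(log t)\<close>; hence \<open>\<zeta>\<close> and \<open>1/\<zeta>\<close> are both \<open>O(t\<^sup>\<epsilon>)\<close> (\<open>rh_zeta_bound\<close>).
  To the left of \<open>1/2\<close>, Taylor expansion of the terms gives
  \<open>\<zeta>(s) = O(t\<^sup>N)\<close> for \<open>Re s \<ge> 2 - N\<close>, which exceeds the true order by a bounded power of \<open>t\<close>, and
  interpolating by three circles between this bound with \<open>N\<close> large and the bound \<open>O(t\<^sup>\<epsilon>)\<close> near \<open>1/2\<close> makes
  that loss negligible. The result is every exponent above \<open>1/2 - \<sigma>\<close> (\<open>rh_zeta_convexity_bound\<close>), so the total
  exponent on the new line is just above \<open>5/4 + 1/4 = 3/2\<close>.

  The constants come from two facts. First, \<open>\<zeta>(s) \<zeta>(s + 1)\<close> has the expansion at \<open>0\<close> dictated by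
  \<open>\<zeta>(0) = -1/2\<close>, \<open>\<zeta>'(0) = - ln (2\<pi>) / 2\<close> and the constant \<open>\<gamma>\<close> at the pole of \<open>\<zeta>\<close>. Second,
  \<open>G(s) / \<zeta>(2 s + 2)\<close> is a product of factors that all have value \<open>1\<close> and derivative \<open>0\<close> at
  \<open>s = 0\<close>, so it does not affect the first two coefficients there (\<open>sing_product_0\<close>).

  Larger exponents follow by integration, since the error terms satisfy
  \<open>E\<^sub>m\<^sub>+\<^sub>1' = (m + 1) E\<^sub>m\<close> (\<open>DERIV_E_err\<close>).
\<close>

section \<open>The entire function \<open>(s - 1) \<zeta>(s)\<close>\<close>

text \<open>The pole of \<open>\<zeta>\<close> at \<open>1\<close> is removed by the factor \<open>s - 1\<close>; the value \<open>1\<close> there is the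
  residue, which makes this function continuous.\<close>

definition zeta_entire :: "complex \<Rightarrow> complex" where
  "zeta_entire s = (if s = 1 then 1 else (s - 1) * riemann_zeta s)"

lemma riemann_zeta_holomorphic: "1 \<notin> A \<Longrightarrow> riemann_zeta holomorphic_on A"
  using zeta_continuation_riemann_zeta unfolding zeta_continuation_def
  by (rule conjE) (erule holomorphic_on_subset, auto)

lemma riemann_zeta_sums:
  assumes "Re s > 1" shows "(\<lambda>n. of_nat (Suc n) powr (-s)) sums riemann_zeta s"
  using zeta_continuation_riemann_zeta assms unfolding zeta_continuation_def
  by (auto simp: powr_minus_divide)

lemma riemann_zeta_suminf:
  assumes "Re s > 1" shows "(\<Sum>n. of_nat (Suc n) powr (-s)) = riemann_zeta s"
  using riemann_zeta_sums[OF assms] by (rule sums_unique[symmetric])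

lemma riemann_zeta_conv_zeta_entire: "s \<noteq> 1 \<Longrightarrow> riemann_zeta s = zeta_entire s / (s - 1)"
  by (simp add: zeta_entire_def)

text \<open>The first-order Taylor expansions of the successive values of \<open>n powr (1 - s)\<close> telescope when they are summed
  over \<open>n\<close>, and their linear terms add up to the zeta series. The right-hand side is
  holomorphic at \<open>s = 1\<close>, so this is what shows that the singularity is removable.\<close>

lemma zeta_entire_eq_near_1:
  assumes "Re s > 0"
  shows "zeta_entire s = 1 + (\<Sum>n. zeta_rem_term 1 n s)"
proof (cases "s = 1")
  case True
  have "zeta_rem_term 1 n 1 = 0" for n
    using of_nat_neq_0[of n, where 'a = complex] of_nat_neq_0[of "Suc n", where 'a = complex]
    by (simp add: zeta_rem_term_def falling_prod_def del: of_nat_Suc)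
  thus ?thesis using True by (simp add: zeta_entire_def)
next
  case False
  have "(s - 1) * riemann_zeta s = 1 + (\<Sum>n. zeta_rem_term 1 n s)"
  proof (rule analytic_continuation_open[of "{s. Re s > 1}" "{s. Re s > 0} - {1}"
          "\<lambda>s. (s - 1) * riemann_zeta s" "\<lambda>s. 1 + (\<Sum>n. zeta_rem_term 1 n s)"])
    show "open {s. Re s > 1}" "open ({s. Re s > 0} - {1})"
      by (auto intro!: open_Diff open_halfspace_Re_gt)
    show "{s. Re s > 1} \<noteq> {}" by (auto intro!: exI[of _ 2])
    show "connected ({s. Re s > 0} - {1 :: complex})"
      by (rule connected_open_delete) (auto intro: open_halfspace_Re_gt convex_connected convex_halfspace_Re_gt)
    show "(\<lambda>s. (s - 1) * riemann_zeta s) holomorphic_on {s. Re s > 0} - {1}"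
      by (intro holomorphic_intros riemann_zeta_holomorphic) auto
    show "(\<lambda>s. 1 + (\<Sum>n. zeta_rem_term 1 n s)) holomorphic_on {s. Re s > 0} - {1}"
      by (intro holomorphic_intros holomorphic_on_subset[OF zeta_rem_term_suminf(1)[of 1]]) auto
    show "s \<in> {s. Re s > 0} - {1}" using assms False by auto
    fix z assume "z \<in> {s. Re s > 1}"
    hence z: "Re z > 1" by simp
    have "(\<Sum>n. zeta_rem_term 1 n z) = -1 - falling_prod (1 - z) 1 * riemann_zeta z"
      using zeta_recurrence[OF z, of 1] riemann_zeta_suminf[OF z] by simp
    thus "(z - 1) * riemann_zeta z = 1 + (\<Sum>n. zeta_rem_term 1 n z)"
      by (simp add: falling_prod_def algebra_simps)
  qed auto
  thus ?thesis using False by (simp add: zeta_entire_def)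
qed

lemma zeta_entire_holomorphic: "zeta_entire holomorphic_on A"
proof -
  have 1: "zeta_entire holomorphic_on {s. Re s > 0}"
  proof -
    have "(\<lambda>s. 1 + (\<Sum>n. zeta_rem_term 1 n s)) holomorphic_on {s. Re s > 0}"
      by (intro holomorphic_intros holomorphic_on_subset[OF zeta_rem_term_suminf(1)[of 1]]) auto
    thus ?thesis by (rule holomorphic_transform) (simp add: zeta_entire_eq_near_1)
  qed
  have "(\<lambda>s. (s - 1) * riemann_zeta s) holomorphic_on - {1}"
    by (intro holomorphic_intros riemann_zeta_holomorphic) auto
  hence 2: "zeta_entire holomorphic_on - {1}"
    by (rule holomorphic_transform) (simp add: zeta_entire_def)
  have "zeta_entire holomorphic_on ({s. Re s > 0} \<union> - {1})"
    by (rule holomorphic_on_Un[OF 1 2]) (auto intro: open_halfspace_Re_gt)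
  also have "{s. Re s > 0} \<union> - {1} = (UNIV :: complex set)" by auto
  finally show ?thesis by (rule holomorphic_on_subset) simp
qed

lemma zeta_entire_1 [simp]: "zeta_entire 1 = 1"
  by (simp add: zeta_entire_def)

text \<open>Both sides are holomorphic for \<open>Re s > 1 - N\<close> and agree where the Dirichlet series converges. It
  expresses the function through its values further to the right, and so carries growth bounds to the
  left.\<close>

lemma zeta_entire_recurrence:
  assumes N: "N \<ge> 1" and s: "Re s > 1 - real N"
  shows "zeta_entire s = 1 - (\<Sum>i=2..N. falling_prod (1 - s) (i - 1) / fact i * zeta_entire (s - 1 + of_nat i))
             + (\<Sum>n. zeta_rem_term N n s)"
proof -
  define W where "W = (\<lambda>s. 1 - (\<Sum>i=2..N. falling_prod (1 - s) (i - 1) / fact i * zeta_entire (s - 1 + of_nat i))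
       + (\<Sum>n. zeta_rem_term N n s))"
  have "zeta_entire s = W s"
  proof (rule analytic_continuation_open[of "{s. Re s > 1}" "{s. Re s > 1 - real N}" zeta_entire W])
    show "open {s. Re s > 1}" "open {s. Re s > 1 - real N}"
      by (auto intro!: open_halfspace_Re_gt)
    show "{s. Re s > 1} \<noteq> {}" by (auto intro!: exI[of _ 2])
    show "connected {s. Re s > 1 - real N}"
      by (auto intro: convex_connected convex_halfspace_Re_gt)
    show "W holomorphic_on {s. Re s > 1 - real N}"
      unfolding W_def
    proof (intro holomorphic_intros falling_prod_holomorphic zeta_rem_term_suminf)
      fix i
      have "(\<lambda>s. s - 1 + of_nat i) holomorphic_on {s. Re s > 1 - real N}"
        by (intro holomorphic_intros)
      from holomorphic_on_compose_gen[OF this zeta_entire_holomorphic[of UNIV]]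
      show "(\<lambda>s. zeta_entire (s - 1 + of_nat i)) holomorphic_on {s. Re s > 1 - real N}"
        by (simp add: o_def)
    qed auto
    fix z assume "z \<in> {s. Re s > 1}"
    hence z: "Re z > 1" by simp
    let ?z = "\<lambda>i::nat. (\<Sum>n. of_nat (Suc n) powr (-(z - 1 + of_nat i))) :: complex"
    have eq: "falling_prod (1 - z) i / fact i * ?z i = - (falling_prod (1 - z) (i - 1) / fact i * zeta_entire (z - 1 + of_nat i))"
      if "i \<ge> 2" for i
    proof -
      have "falling_prod (1 - z) i = falling_prod (1 - z) (i - 1) * (1 - z - of_nat (i - 1))"
        using that by (cases i) (auto simp: falling_prod_def)
      also have "1 - z - of_nat (i - 1) = -(z - 1 + of_nat i - 1)"
        using that by (simp add: of_nat_diff)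
      finally have "falling_prod (1 - z) i = - (falling_prod (1 - z) (i - 1) * (z - 1 + of_nat i - 1))"
        by (simp only: mult_minus_right)
      moreover have "zeta_entire (z - 1 + of_nat i) = (z - 1 + of_nat i - 1) * ?z i"
      proof -
        have re: "Re (z - 1 + of_nat i) > 1" using z that by simp
        hence "z - 1 + of_nat i \<noteq> 1" by (metis less_irrefl one_complex.sel(1))
        thus ?thesis unfolding zeta_entire_def riemann_zeta_suminf[OF re] by simp
      qed
      ultimately show ?thesis by simp
    qed
    have "{1..N} = insert 1 {2..N}" using N by auto
    hence "(\<Sum>i=1..N. falling_prod (1 - z) i / fact i * ?z i)
         = (1 - z) * ?z 1 + (\<Sum>i=2..N. falling_prod (1 - z) i / fact i * ?z i)"
      by (simp add: falling_prod_def)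
    also have "(\<Sum>i=2..N. falling_prod (1 - z) i / fact i * ?z i)
       = - (\<Sum>i=2..N. falling_prod (1 - z) (i - 1) / fact i * zeta_entire (z - 1 + of_nat i))"
      unfolding sum_negf[symmetric] by (rule sum.cong[OF refl]) (rule eq, auto)
    also have "?z 1 = riemann_zeta z" using riemann_zeta_suminf[OF z] by simp
    finally show "zeta_entire z = W z"
      using z unfolding W_def zeta_recurrence[OF z] zeta_entire_def by (auto simp: algebra_simps)
  qed (use s zeta_entire_holomorphic in auto)
  thus ?thesis by (simp add: W_def)
qed

lemma norm_falling_prod_le: "norm (falling_prod a k) \<le> (norm a + real k) ^ k"
proof -
  have "norm (falling_prod a k) = (\<Prod>j<k. norm (a - of_nat j))"
    by (simp add: falling_prod_def prod_norm)
  also have "\<dots> \<le> (\<Prod>j<k. norm a + real k)"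
  proof (intro prod_mono conjI)
    fix j assume "j \<in> {..<k}"
    have "norm (a - of_nat j) \<le> norm a + norm (of_nat j :: complex)" by (rule norm_triangle_ineq4)
    with \<open>j \<in> {..<k}\<close> show "norm (a - of_nat j) \<le> norm a + real k" by simp
  qed auto
  finally show ?thesis by simp
qed

lemma norm_falling_prod_le':
  "norm (falling_prod (1 - s) k) \<le> real (k + 1) ^ k * (1 + norm s) ^ k"
proof -
  have "norm (1 - s) + real k \<le> (1 + norm s) + real k" using norm_triangle_ineq4[of 1 s] by simp
  also have "\<dots> \<le> real (k + 1) * (1 + norm s)" by (simp add: algebra_simps)
  finally have "(norm (1 - s) + real k) ^ k \<le> (real (k + 1) * (1 + norm s)) ^ k"
    by (intro power_mono) auto
  with norm_falling_prod_le[of "1 - s" k] show ?thesis by (simp add: power_mult_distrib)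
qed

text \<open>Every step of length \<open>1\<close> to the left costs one power of \<open>norm s\<close>. In the recurrence the factor
  \<open>falling_prod (1 - s) (i - 1)\<close> has size \<open>norm s ^ (i - 1)\<close>, exactly what the value \<open>i - 1\<close> steps to the right
  saves.\<close>

lemma zeta_entire_polynomial_bound:
  assumes N: "N \<ge> 1" and d: "d > 0"
  shows "\<exists>C>0. \<forall>s. Re s \<ge> 1 - real N + d \<longrightarrow> norm (zeta_entire s) \<le> C * (1 + norm s) ^ (N + 1)"
  using N
proof (induction N rule: less_induct)
  case (less N)
  have "\<forall>i. \<exists>C. i \<in> {2..N} \<longrightarrow> C > 0 \<and> (\<forall>s. Re s \<ge> 1 - real (N + 1 - i) + d \<longrightarrow>
           norm (zeta_entire s) \<le> C * (1 + norm s) ^ (N + 1 - i + 1))"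
  proof
    fix i show "\<exists>C. i \<in> {2..N} \<longrightarrow> C > 0 \<and> (\<forall>s. Re s \<ge> 1 - real (N + 1 - i) + d \<longrightarrow>
           norm (zeta_entire s) \<le> C * (1 + norm s) ^ (N + 1 - i + 1))"
      using less.IH[of "N + 1 - i"] by (cases "i \<in> {2..N}") auto
  qed
  then obtain C where C: "\<And>i. i \<in> {2..N} \<Longrightarrow> C i > 0"
    "\<And>i s. i \<in> {2..N} \<Longrightarrow> Re s \<ge> 1 - real (N + 1 - i) + d \<Longrightarrow>
           norm (zeta_entire s) \<le> C i * (1 + norm s) ^ (N + 1 - i + 1)"
    by metis
  define Q where "Q = (\<Sum>n. real (Suc n) powr (-(1 + d)))"
  have sumQ: "summable (\<lambda>n. real (Suc n) powr (-(1 + d)))"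
    by (rule summable_Suc_powr) (use d in auto)
  have Q: "Q \<ge> 0" unfolding Q_def by (intro suminf_nonneg sumQ) auto
  define D where "D = 1 + (\<Sum>i=2..N. real (i - 1 + 1) ^ (i - 1) * C i * real (i + 1) ^ (N + 2 - i)) + real (Suc N + 1) ^ Suc N * Q"
  have "D > 0" unfolding D_def using Q C(1)
    by (intro add_pos_nonneg sum_nonneg mult_nonneg_nonneg) (auto intro: less_imp_le)
  moreover have "norm (zeta_entire s) \<le> D * (1 + norm s) ^ (N + 1)" if s: "Re s \<ge> 1 - real N + d" for s
  proof -
    let ?B = "(1 + norm s) ^ (N + 1)"
    have B: "?B \<ge> 1" by (intro one_le_power) auto
    have "zeta_entire s = 1 - (\<Sum>i=2..N. falling_prod (1 - s) (i - 1) / fact i * zeta_entire (s - 1 + of_nat i))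
             + (\<Sum>n. zeta_rem_term N n s)"
      by (rule zeta_entire_recurrence) (use s d less.prems in auto)
    hence "norm (zeta_entire s) \<le> norm (1::complex) + norm (\<Sum>i=2..N. falling_prod (1 - s) (i - 1) / fact i * zeta_entire (s - 1 + of_nat i))
             + norm (\<Sum>n. zeta_rem_term N n s)"
      by (auto intro!: order_trans[OF norm_triangle_ineq] add_mono order_trans[OF norm_triangle_ineq4])
    also have "norm (\<Sum>n. zeta_rem_term N n s) \<le> real (Suc N + 1) ^ Suc N * Q * ?B"
    proof -
      have b: "norm (zeta_rem_term N n s) \<le> real (Suc N + 1) ^ Suc N * ?B * real (Suc n) powr (-(1 + d))" for n
      proof -
        have "norm (zeta_rem_term N n s)
            \<le> norm (falling_prod (1 - s) (Suc N)) * real (Suc n) powr (Re (1 - s) - real (Suc N))"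
          unfolding zeta_rem_term_def using s d by (intro powr_Taylor_bound) auto
        also have "\<dots> \<le> (real (Suc N + 1) ^ Suc N * (1 + norm s) ^ Suc N) * real (Suc n) powr (-(1 + d))"
          using s by (intro mult_mono powr_mono norm_falling_prod_le') auto
        finally show ?thesis by (simp add: mult_ac)
      qed
      have sm: "summable (\<lambda>n. real (Suc N + 1) ^ Suc N * ?B * real (Suc n) powr (-(1 + d)))"
        by (intro summable_mult sumQ)
      have "norm (\<Sum>n. zeta_rem_term N n s) \<le> (\<Sum>n. real (Suc N + 1) ^ Suc N * ?B * real (Suc n) powr (-(1 + d)))"
        by (rule norm_suminf_le[OF b sm])
      also have "\<dots> = real (Suc N + 1) ^ Suc N * ?B * Q"
        unfolding Q_def by (rule suminf_mult[OF sumQ])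
      finally show ?thesis by (simp add: mult_ac)
    qed
    also have "norm (\<Sum>i=2..N. falling_prod (1 - s) (i - 1) / fact i * zeta_entire (s - 1 + of_nat i))
        \<le> (\<Sum>i=2..N. real (i - 1 + 1) ^ (i - 1) * C i * real (i + 1) ^ (N + 2 - i) * ?B)"
    proof (rule sum_norm_le)
      fix i assume i: "i \<in> {2..N}"
      have "norm (falling_prod (1 - s) (i - 1) / fact i) \<le> norm (falling_prod (1 - s) (i - 1)) / 1"
        unfolding norm_divide norm_fact by (intro divide_left_mono) auto
      also have "\<dots> \<le> real (i - 1 + 1) ^ (i - 1) * (1 + norm s) ^ (i - 1)"
        using norm_falling_prod_le'[of s "i - 1"] by simp
      finally have 1: "norm (falling_prod (1 - s) (i - 1) / fact i) \<le> real (i - 1 + 1) ^ (i - 1) * (1 + norm s) ^ (i - 1)" .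
      have "norm (zeta_entire (s - 1 + of_nat i)) \<le> C i * (1 + norm (s - 1 + of_nat i)) ^ (N + 1 - i + 1)"
        using i s by (intro C(2)) auto
      also have "1 + norm (s - 1 + of_nat i) \<le> real (i + 1) * (1 + norm s)"
      proof -
        have "s - 1 + of_nat i = s + of_nat (i - 1)" using i by (simp add: of_nat_diff)
        hence "norm (s - 1 + of_nat i) \<le> norm s + real (i - 1)"
          by (metis norm_of_nat norm_triangle_ineq)
        moreover have "real (i - 1) \<le> real i" by simp
        moreover have "real (i + 1) * (1 + norm s) = real i * norm s + real i + 1 + norm s"
          by (simp add: algebra_simps)
        moreover have "0 \<le> real i * norm s" by (intro mult_nonneg_nonneg) auto
        ultimately show ?thesis by linarith
      qed
      have e: "N + 1 - i + 1 = N + 2 - i" using i by auto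
      from \<open>1 + norm (s - 1 + of_nat i) \<le> _\<close>
      have "C i * (1 + norm (s - 1 + of_nat i)) ^ (N + 1 - i + 1) \<le> C i * (real (i + 1) * (1 + norm s)) ^ (N + 2 - i)"
        using C(1)[OF i] i unfolding e by (intro mult_left_mono power_mono) auto
      finally have 2: "norm (zeta_entire (s - 1 + of_nat i)) \<le> C i * (real (i + 1) * (1 + norm s)) ^ (N + 2 - i)" .
      have "norm (falling_prod (1 - s) (i - 1) / fact i * zeta_entire (s - 1 + of_nat i))
         \<le> (real (i - 1 + 1) ^ (i - 1) * (1 + norm s) ^ (i - 1)) * (C i * (real (i + 1) * (1 + norm s)) ^ (N + 2 - i))"
        unfolding norm_mult[of "falling_prod (1 - s) (i - 1) / fact i"] by (intro mult_mono 1 2) auto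
      also have "\<dots> = real (i - 1 + 1) ^ (i - 1) * C i * real (i + 1) ^ (N + 2 - i) * ((1 + norm s) ^ (i - 1) * (1 + norm s) ^ (N + 2 - i))"
        by (simp add: power_mult_distrib mult_ac)
      also have "(1 + norm s) ^ (i - 1) * (1 + norm s) ^ (N + 2 - i) = ?B"
        using i unfolding power_add[symmetric] by (intro arg_cong2[where f = power]) auto
      finally show "norm (falling_prod (1 - s) (i - 1) / fact i * zeta_entire (s - 1 + of_nat i))
         \<le> real (i - 1 + 1) ^ (i - 1) * C i * real (i + 1) ^ (N + 2 - i) * ?B" .
    qed
    finally have "norm (zeta_entire s) \<le> 1 + (\<Sum>i=2..N. real (i - 1 + 1) ^ (i - 1) * C i * real (i + 1) ^ (N + 2 - i)) * ?B
        + real (Suc N + 1) ^ Suc N * Q * ?B" by (simp add: sum_distrib_right)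
    also have "\<dots> \<le> D * ?B" using B unfolding D_def by (simp add: algebra_simps del: of_nat_Suc)
    finally show ?thesis .
  qed
  ultimately show ?case by blast
qed


section \<open>Values and derivatives at \<open>0\<close> and \<open>1\<close>\<close>

text \<open>The series of remainders converges locally uniformly, so it may be differentiated term by term.\<close>

lemma zeta_rem_term_deriv_sums:
  assumes z: "Re z > 1 - real N"
  shows "(\<lambda>n. deriv (zeta_rem_term N n) z) sums deriv (\<lambda>s. \<Sum>n. zeta_rem_term N n s) z"
proof -
  define d where "d = (Re z - (1 - real N)) / 2"
  have d: "d > 0" using z by (simp add: d_def)
  have re: "Re w \<ge> 1 - real N + d" if "w \<in> cball z d" for w
    using that abs_Re_le_cmod[of "z - w"] by (auto simp: dist_norm d_def field_simps)
  have "compact ((\<lambda>s. falling_prod (1 - s) (Suc N)) ` cball z d)"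
    by (intro compact_continuous_image holomorphic_on_imp_continuous_on falling_prod_holomorphic) auto
  from compact_imp_bounded[OF this] obtain K
    where K: "\<And>w. w \<in> cball z d \<Longrightarrow> norm (falling_prod (1 - w) (Suc N)) \<le> K"
    unfolding bounded_iff by blast
  have bd: "norm (zeta_rem_term N n w) \<le> K * real (Suc n) powr (-(1 + d))"
    if w: "w \<in> ball z d" for n w
  proof -
    have w': "w \<in> cball z d" using w by auto
    have "norm (zeta_rem_term N n w)
        \<le> norm (falling_prod (1 - w) (Suc N)) * real (Suc n) powr (Re (1 - w) - real (Suc N))"
      unfolding zeta_rem_term_def using re[OF w'] d by (intro powr_Taylor_bound) auto
    also have "\<dots> \<le> K * real (Suc n) powr (-(1 + d))"
      using re[OF w'] d K[OF w'] order.trans[OF norm_ge_zero K[OF w']]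
      by (intro mult_mono powr_mono) auto
    finally show ?thesis .
  qed
  have hol: "zeta_rem_term N n holomorphic_on A" for n A
    unfolding zeta_rem_term_def by (intro holomorphic_intros falling_prod_holomorphic) (auto simp del: of_nat_Suc)
  have "summable (\<lambda>n. K * real (Suc n) powr (-(1 + d)))"
    using d by (intro summable_mult summable_Suc_powr) auto
  from Weierstrass_m_test[OF bd this]
  have ul: "uniform_limit (ball z d) (\<lambda>m s. \<Sum>n<m. zeta_rem_term N n s) (\<lambda>s. \<Sum>n. zeta_rem_term N n s) sequentially" .
  have "(\<lambda>m. deriv (\<lambda>s. \<Sum>n<m. zeta_rem_term N n s) z) \<longlonglongrightarrow> deriv (\<lambda>s. \<Sum>n. zeta_rem_term N n s) z"
    by (rule deriv_complex_uniform_limit[OF ul]) (use d in \<open>auto intro!: always_eventually holomorphic_on_sum hol\<close>)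
  moreover have "deriv (\<lambda>s. \<Sum>n<m. zeta_rem_term N n s) z = (\<Sum>n<m. deriv (zeta_rem_term N n) z)" for m
    by (intro DERIV_imp_deriv DERIV_sum holomorphic_derivI[OF hol[of _ UNIV]]) auto
  ultimately show ?thesis by (simp add: sums_def)
qed

lemma DERIV_const_powr:
  fixes c s :: complex
  assumes "(g has_field_derivative g') (at s)" "c \<noteq> 0"
  shows "((\<lambda>s. c powr g s) has_field_derivative Ln c * c powr g s * g') (at s)"
  by (rule DERIV_chain2[OF has_field_derivative_powr_right[OF assms(2)] assms(1)])

lemma DERIV_powr_one_minus:
  fixes c s :: complex
  assumes "c \<noteq> 0"
  shows "((\<lambda>s. c powr (1 - s)) has_field_derivative - Ln c * c powr (1 - s)) (at s)"
proof -
  have "((\<lambda>s. 1 - s) has_field_derivative - 1) (at s)" by (auto intro!: derivative_eq_intros)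
  from DERIV_const_powr[OF this assms] show ?thesis by simp
qed

lemma DERIV_powr_uminus:
  fixes c s d :: complex
  assumes "c \<noteq> 0"
  shows "((\<lambda>s. c powr (- s - d)) has_field_derivative - Ln c * c powr (- s - d)) (at s)"
proof -
  have "((\<lambda>s. - s - d) has_field_derivative - 1) (at s)" by (auto intro!: derivative_eq_intros)
  from DERIV_const_powr[OF this assms] show ?thesis by simp
qed

text \<open>The derivatives of the remainders at \<open>1\<close> are the terms of the series that defines the
  Euler-Mascheroni constant. This is the constant term of \<open>\<zeta>\<close> at its pole.\<close>

lemma deriv_zeta_entire_1: "deriv zeta_entire 1 = of_real euler_mascheroni"
proof -
  have D: "deriv (zeta_rem_term 1 n) 1 = inverse (of_nat (n+1)) + of_real (ln (of_nat (n+1))) - of_real (ln (of_nat (n+2)))" for n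
  proof -
    have pd: "((\<lambda>s. of_nat (Suc k) powr (1 - s)) has_field_derivative - Ln (of_nat (Suc k))) (at (1::complex))" for k
      using DERIV_powr_one_minus[of "of_nat (Suc k)" 1, OF of_nat_neq_0] of_nat_neq_0[of k, where 'a = complex]
      by (simp only: diff_self powr_zero_eq_one if_False mult_1_right split: if_split)
    have "((\<lambda>s. of_nat (Suc (Suc n)) powr (1 - s) - (of_nat (Suc n) powr (1 - s) + (1 - s) * of_nat (Suc n) powr (- s)))
       has_field_derivative - Ln (of_nat (Suc (Suc n))) - (- Ln (of_nat (Suc n)) - inverse (of_nat (Suc n)))) (at 1)"
    proof (intro DERIV_diff DERIV_add pd)
      have "((\<lambda>s. (1 - s) * of_nat (Suc n) powr (- s)) has_field_derivative - inverse (of_nat (Suc n))) (at (1::complex))"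
        using of_nat_neq_0[of n, where 'a = complex]
        by (auto intro!: derivative_eq_intros simp: powr_minus simp del: of_nat_Suc)
      from DERIV_add[OF pd this]
      show "((\<lambda>s. of_nat (Suc n) powr (1 - s) + (1 - s) * of_nat (Suc n) powr (- s))
         has_field_derivative - Ln (of_nat (Suc n)) - inverse (of_nat (Suc n))) (at (1::complex))" by simp
    qed
    moreover have "zeta_rem_term 1 n = (\<lambda>s. of_nat (Suc (Suc n)) powr (1 - s) - (of_nat (Suc n) powr (1 - s) + (1 - s) * of_nat (Suc n) powr (- s)))"
      by (auto simp: zeta_rem_term_def falling_prod_def fun_eq_iff)
    ultimately have "deriv (zeta_rem_term 1 n) 1 = - Ln (of_nat (Suc (Suc n))) - (- Ln (of_nat (Suc n)) - inverse (of_nat (Suc n)))"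
      by (simp only: DERIV_imp_deriv)
    thus ?thesis by (simp add: Ln_of_nat del: of_nat_Suc)
  qed
  have "(\<lambda>n. deriv (zeta_rem_term 1 n) 1) sums deriv (\<lambda>s. \<Sum>n. zeta_rem_term 1 n s) 1"
    by (rule zeta_rem_term_deriv_sums) simp
  from sums_unique2[OF this[unfolded D] euler_mascheroni_sum]
  have *: "deriv (\<lambda>s. \<Sum>n. zeta_rem_term 1 n s) 1 = euler_mascheroni" .
  have "deriv zeta_entire 1 = deriv (\<lambda>s. 1 + (\<Sum>n. zeta_rem_term 1 n s)) 1"
  proof (rule deriv_cong_ev)
    have "eventually (\<lambda>s. s \<in> {s. Re s > 0}) (nhds (1::complex))"
      by (rule eventually_nhds_in_open) (auto intro: open_halfspace_Re_gt)
    thus "\<forall>\<^sub>F s in nhds 1. zeta_entire s = 1 + (\<Sum>n. zeta_rem_term 1 n s)"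
      by eventually_elim (rule zeta_entire_eq_near_1, simp)
  qed simp
  also have "\<dots> = deriv (\<lambda>s. \<Sum>n. zeta_rem_term 1 n s) 1"
  proof -
    have "(\<lambda>s. \<Sum>n. zeta_rem_term 1 n s) field_differentiable at 1"
      by (rule holomorphic_on_imp_differentiable_at[OF zeta_rem_term_suminf(1)[of 1]])
         (auto intro: open_halfspace_Re_gt)
    thus ?thesis by simp
  qed
  finally show ?thesis using * by simp
qed

text \<open>By Stirling's formula this converges to \<open>ln (2\<pi>) / 2\<close>.\<close>

definition stirling_defect :: "nat \<Rightarrow> real" where
  "stirling_defect n = ln (fact n) - (real n + 1 / 2) * ln (real n) + real n"

lemma wallis_prod_eq:
  "(\<Prod>k=1..n. (4 * real k ^ 2) / (4 * real k ^ 2 - 1)) = (4 ^ n * fact n ^ 2) ^ 2 / (fact (2 * n) ^ 2 * (2 * real n + 1))"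
proof (induction n)
  case (Suc n)
  have f: "fact (2 * Suc n) = (2 * real n + 2) * (2 * real n + 1) * fact (2 * n)"
    by (simp add: algebra_simps)
  have g: "4 * real (Suc n) ^ 2 - 1 = (2 * real n + 1) * (2 * real n + 3)"
    by (simp add: power2_eq_square algebra_simps)
  have "(\<Prod>k=1..Suc n. (4 * real k ^ 2) / (4 * real k ^ 2 - 1)) =
     (4 ^ n * fact n ^ 2) ^ 2 / (fact (2 * n) ^ 2 * (2 * real n + 1)) * ((2 * real n + 2) ^ 2 / ((2 * real n + 1) * (2 * real n + 3)))"
    unfolding prod.nat_ivl_Suc'[of 1 n, simplified] using Suc.IH
    by (simp add: g[unfolded of_nat_Suc] power2_eq_square algebra_simps)
  also have "\<dots> = (4 ^ Suc n * fact (Suc n) ^ 2) ^ 2 / (fact (2 * Suc n) ^ 2 * (2 * real (Suc n) + 1))"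
  proof -
    define F G a where "F = (fact (2 * n) :: real)" and "G = (fact n :: real)" and "a = 2 * real n + 1"
    have nz: "F \<noteq> 0" "a > 0" by (auto simp: F_def a_def)
    have e: "2 * real n + 2 = a + 1" "2 * real n + 3 = a + 2" "2 * real (Suc n) + 1 = a + 2" "fact (Suc n) = (a + 1) / 2 * G"
      by (auto simp: a_def G_def field_simps)
    have "(4 ^ n * G ^ 2) ^ 2 / (F ^ 2 * a) * ((a + 1) ^ 2 / (a * (a + 2))) = (4 ^ Suc n * ((a + 1) / 2 * G) ^ 2) ^ 2 / (((a + 1) * a * F) ^ 2 * (a + 2))"
      using nz by (simp add: divide_simps) (simp add: power2_eq_square algebra_simps)
    thus ?thesis unfolding f e by (simp only: F_def[symmetric] G_def[symmetric] a_def[symmetric])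
  qed
  finally show ?case .
qed simp

text \<open>If the limit \<open>a\<close> exists, then \<open>2 stirling_defect n - stirling_defect (2 n)\<close> also tends to \<open>a\<close>. Up to elementary
  terms this combination is half the logarithm of Wallis' product, whose limit is \<open>\<pi> / 2\<close>. Existence of the
  limit is supplied by the convergence of the series in \<open>zeta_rem_deriv_0\<close>.\<close>

lemma stirling_defect_limit:
  assumes "stirling_defect \<longlonglongrightarrow> a" shows "a = ln (2 * pi) / 2"
proof -
  let ?W = "\<lambda>n. (\<Prod>k=1..n. (4 * real k ^ 2) / (4 * real k ^ 2 - 1))"
  have eq: "ln (?W n) = 2 * (2 * stirling_defect n - stirling_defect (2 * n)) + (ln (real n) - ln 2 - ln (2 * real n + 1))" if "n > 0" for n
  proof -
    have "ln (?W n) = 2 * (real n * ln 4 + 2 * ln (fact n)) - (2 * ln (fact (2 * n)) + ln (2 * real n + 1))"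
      unfolding wallis_prod_eq by (simp add: ln_div ln_mult ln_realpow)
    moreover have "ln (4::real) = 2 * ln 2" using ln_realpow[of 2 2] by simp
    moreover have "ln (2 * real n) = ln 2 + ln (real n)" using that by (simp add: ln_mult)
    ultimately show ?thesis by (simp add: stirling_defect_def algebra_simps)
  qed
  have sub: "(\<lambda>n. stirling_defect (2 * n)) \<longlonglongrightarrow> a"
    using LIMSEQ_subseq_LIMSEQ[OF assms, of "\<lambda>n. 2 * n"] by (simp add: strict_mono_def o_def)
  have "(\<lambda>n. 2 * (2 * stirling_defect n - stirling_defect (2 * n)) + (ln (real n) - ln 2 - ln (2 * real n + 1)))
        \<longlonglongrightarrow> 2 * (2 * a - a) + (- 2 * ln 2)"
  proof (intro tendsto_intros assms sub)
    have "(\<lambda>n::nat. ln (real n) - ln 2 - ln (2 * real n + 1)) \<longlonglongrightarrow> - ln 2 - ln 2" by real_asymp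
    thus "(\<lambda>n::nat. ln (real n) - ln 2 - ln (2 * real n + 1)) \<longlonglongrightarrow> - 2 * ln 2" by simp
  qed
  hence "(\<lambda>n. ln (?W n)) \<longlonglongrightarrow> 2 * (2 * a - a) + (- 2 * ln 2)"
    by (rule Lim_transform_eventually) (use eventually_gt_at_top[of 0] in eventually_elim, simp only: eq)
  moreover have "(\<lambda>n. ln (?W n)) \<longlonglongrightarrow> ln (pi / 2)"
    by (rule tendsto_ln[OF wallis]) simp
  ultimately have "2 * (2 * a - a) + (- 2 * ln 2) = ln (pi / 2)"
    by (rule LIMSEQ_unique)
  thus ?thesis by (simp add: ln_div ln_mult)
qed

lemma zeta_entire_eq_near_0:
  assumes "Re s > -1"
  shows "zeta_entire s = 1 - (1 - s) / 2 * zeta_entire (s + 1) + (\<Sum>n. zeta_rem_term 2 n s)"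
  using zeta_entire_recurrence[of 2 s] assms by (simp add: falling_prod_def algebra_simps)

lemma zeta_rem_term_2:
  "zeta_rem_term 2 n s = of_nat (Suc (Suc n)) powr (1 - s) - (of_nat (Suc n) powr (1 - s)
     + (1 - s) * of_nat (Suc n) powr (- s) + (1 - s) * (- s) / 2 * of_nat (Suc n) powr (- s - 1))"
proof -
  have e: "{..2::nat} = {0,1,2}" "{..<2::nat} = {0,1}" "1 - s - 1 = - s" "1 - s - 2 = - s - 1"
    "complex_of_nat (Suc 0) = 1" "complex_of_nat 2 = 2" "complex_of_nat 0 = 0" by auto
  show ?thesis
    unfolding zeta_rem_term_def e by (simp add: falling_prod_def e del: of_nat_Suc) (simp add: algebra_simps)?
qed

lemma zeta_entire_0: "zeta_entire 0 = 1 / 2"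
proof -
  have "zeta_rem_term 2 n 0 = 0" for n
    using of_nat_neq_0[of n, where 'a = complex] of_nat_neq_0[of "Suc n", where 'a = complex]
    unfolding zeta_rem_term_2 by (simp del: of_nat_Suc) simp
  thus ?thesis using zeta_entire_eq_near_0[of 0] by simp
qed

text \<open>The partial sums of the differentiated remainders telescope to \<open>- (M + 1) ln (M + 1) + M + ln M! + H / 2\<close>
  with the harmonic number \<open>H\<close> of \<open>M\<close>. Stirling's formula and the definition of the Euler-Mascheroni constant
  then give the limit; this is where \<open>ln (2\<pi>)\<close> enters the theorem.\<close>

lemma zeta_rem_deriv_0:
  "deriv (\<lambda>s. \<Sum>n. zeta_rem_term 2 n s) 0 = of_real (-1 + ln (2 * pi) / 2 + euler_mascheroni / 2)"
proof -
  define V where "V = deriv (\<lambda>s. \<Sum>n. zeta_rem_term 2 n s) 0"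
  define t where "t = (\<lambda>n. - (real n + 2) * ln (real n + 2) + (real n + 1) * ln (real n + 1) + 1 + ln (real n + 1) + inverse (real n + 1) / 2)"
  have D: "deriv (zeta_rem_term 2 n) 0 = of_real (t n)" for n
  proof -
    let ?a = "of_nat (Suc (Suc n)) :: complex" and ?b = "of_nat (Suc n) :: complex"
    have nz: "?a \<noteq> 0" "?b \<noteq> 0" by (rule of_nat_neq_0)+
    have "((\<lambda>s. ?a powr (1 - s) - (?b powr (1 - s) + (1 - s) * ?b powr (- s) + (1 - s) * (- s) / 2 * ?b powr (- s - 1)))
       has_field_derivative - ?a * Ln ?a - (- ?b * Ln ?b - 1 - Ln ?b - inverse ?b / 2)) (at 0)"
    proof (intro DERIV_diff)
      show "((\<lambda>s. ?a powr (1 - s)) has_field_derivative - ?a * Ln ?a) (at 0)"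
        using DERIV_powr_one_minus[OF nz(1), of 0] nz by (simp add: mult.commute del: of_nat_Suc Ln_of_nat)
      let ?D = "- Ln ?b * ?b powr (1 - 0) + (-1 * ?b powr (- 0 - 0) + - Ln ?b * ?b powr (- 0 - 0) * (1 - 0))
           + ((-1) / 2 * ?b powr (- 0 - 1) + - Ln ?b * ?b powr (- 0 - 1) * ((1 - 0) * (- 0) / 2))"
      have "((\<lambda>s. ?b powr (1 - s) + (1 - s) * ?b powr (- s - 0) + (1 - s) * (- s) / 2 * ?b powr (- s - 1))
         has_field_derivative ?D) (at 0)"
        by (intro DERIV_add DERIV_mult DERIV_powr_one_minus DERIV_powr_uminus nz) (auto intro!: derivative_eq_intros)
      moreover have "?D = - ?b * Ln ?b - 1 - Ln ?b - inverse ?b / 2"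
        using nz by (simp add: powr_minus algebra_simps del: of_nat_Suc Ln_of_nat)
      ultimately show "((\<lambda>s. ?b powr (1 - s) + (1 - s) * ?b powr (- s) + (1 - s) * (- s) / 2 * ?b powr (- s - 1))
         has_field_derivative (- ?b * Ln ?b - 1 - Ln ?b - inverse ?b / 2)) (at 0)"
        by (simp only: diff_0_right)
    qed
    moreover have "zeta_rem_term 2 n = (\<lambda>s. ?a powr (1 - s) - (?b powr (1 - s) + (1 - s) * ?b powr (- s) + (1 - s) * (- s) / 2 * ?b powr (- s - 1)))"
      by (intro ext zeta_rem_term_2)
    ultimately have "deriv (zeta_rem_term 2 n) 0 = - ?a * Ln ?a - (- ?b * Ln ?b - 1 - Ln ?b - inverse ?b / 2)"
      by (simp only: DERIV_imp_deriv)
    also have "\<dots> = of_real (- real (Suc (Suc n)) * ln (real (Suc (Suc n))) - (- real (Suc n) * ln (real (Suc n)) - 1 - ln (real (Suc n)) - inverse (real (Suc n)) / 2))"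
      by (simp add: Ln_of_nat del: of_nat_Suc)
    finally show ?thesis by (simp add: t_def algebra_simps)
  qed
  have "(\<lambda>n. deriv (zeta_rem_term 2 n) 0) sums V"
    unfolding V_def by (rule zeta_rem_term_deriv_sums) simp
  hence sV: "(\<lambda>n. complex_of_real (t n)) sums V" by (simp only: D)
  hence "(\<lambda>n. Re (complex_of_real (t n))) sums Re V" "(\<lambda>n. Im (complex_of_real (t n))) sums Im V"
    by (simp_all only: sums_complex_iff)
  hence st: "t sums Re V" and "Im V = 0" by (auto simp: sums_0 dest: sums_unique)
  hence VR: "V = of_real (Re V)" by (simp add: complex_eq_iff)
  have part: "(\<Sum>n<M. t n) = - (real M + 1) * ln (real M + 1) + real M + ln (fact M) + harm M / 2" for M
  proof (induction M)
    case (Suc M)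
    have lf: "ln (fact (Suc M) :: real) = ln (real M + 1) + ln (fact M)"
      by (simp add: ln_mult add.commute)
    have a: "real (Suc M) = real M + 1" "real M + 1 + 1 = real M + 2" by auto
    show ?case unfolding sum.lessThan_Suc Suc.IH lf harm_Suc a by (simp add: t_def a algebra_simps add_divide_distrib)
  qed (simp add: harm_def)
  have "(\<lambda>M. \<Sum>n<M. t n) \<longlonglongrightarrow> Re V" using st by (simp add: sums_def)
  moreover have "(\<lambda>M. (real M + 1) * (ln (real M + 1) - ln (real M))) \<longlonglongrightarrow> 1" by real_asymp
  ultimately have "(\<lambda>M. (\<Sum>n<M. t n) + (real M + 1) * (ln (real M + 1) - ln (real M)) - (harm M - ln (real M)) / 2)
      \<longlonglongrightarrow> Re V + 1 - euler_mascheroni / 2"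
    by (intro tendsto_intros euler_mascheroni_LIMSEQ) auto
  moreover have "(\<Sum>n<M. t n) + (real M + 1) * (ln (real M + 1) - ln (real M)) - (harm M - ln (real M)) / 2 = stirling_defect M" for M
    unfolding part stirling_defect_def by (simp add: algebra_simps diff_divide_distrib)
  ultimately have "stirling_defect \<longlonglongrightarrow> Re V + 1 - euler_mascheroni / 2" by simp
  from stirling_defect_limit[OF this] have "Re V = -1 + ln (2 * pi) / 2 + euler_mascheroni / 2" by simp
  thus ?thesis using VR unfolding V_def by simp
qed

text \<open>Equivalent to \<open>\<zeta>'(0) = - ln (2\<pi>) / 2\<close>, because \<open>\<zeta>(0) = -1/2\<close>.\<close>

lemma deriv_zeta_entire_0: "deriv zeta_entire 0 = of_real (ln (2 * pi) / 2 - 1 / 2)"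
proof -
  have D: "(zeta_entire has_field_derivative deriv zeta_entire s) (at s)" for s
    by (rule holomorphic_derivI[OF zeta_entire_holomorphic[of UNIV]]) auto
  have "((\<lambda>s. \<Sum>n. zeta_rem_term 2 n s) has_field_derivative deriv (\<lambda>s. \<Sum>n. zeta_rem_term 2 n s) 0) (at 0)"
    by (rule holomorphic_derivI[OF zeta_rem_term_suminf(1)[of 2]]) (auto intro: open_halfspace_Re_gt)
  moreover have "((\<lambda>s. zeta_entire (s + 1)) has_field_derivative deriv zeta_entire 1) (at 0)"
    using D[of "0 + 1"] by (subst (asm) DERIV_shift) simp
  ultimately have "((\<lambda>s. 1 - (1 - s) / 2 * zeta_entire (s + 1) + (\<Sum>n. zeta_rem_term 2 n s))
     has_field_derivative 1 / 2 - deriv zeta_entire 1 / 2 + deriv (\<lambda>s. \<Sum>n. zeta_rem_term 2 n s) 0) (at 0)"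
    by (auto intro!: derivative_eq_intros simp: field_simps)
  hence "deriv (\<lambda>s. 1 - (1 - s) / 2 * zeta_entire (s + 1) + (\<Sum>n. zeta_rem_term 2 n s)) 0
      = 1 / 2 - deriv zeta_entire 1 / 2 + deriv (\<lambda>s. \<Sum>n. zeta_rem_term 2 n s) 0"
    by (rule DERIV_imp_deriv)
  also have "deriv (\<lambda>s. 1 - (1 - s) / 2 * zeta_entire (s + 1) + (\<Sum>n. zeta_rem_term 2 n s)) 0 = deriv zeta_entire 0"
  proof (rule deriv_cong_ev)
    have "eventually (\<lambda>s. s \<in> {s. Re s > -1}) (nhds (0::complex))"
      by (rule eventually_nhds_in_open) (auto intro: open_halfspace_Re_gt)
    thus "\<forall>\<^sub>F s in nhds 0. 1 - (1 - s) / 2 * zeta_entire (s + 1) + (\<Sum>n. zeta_rem_term 2 n s) = zeta_entire s"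
      by eventually_elim (rule zeta_entire_eq_near_0[symmetric], simp)
  qed simp
  finally show ?thesis unfolding zeta_rem_deriv_0 deriv_zeta_entire_1 by simp
qed

section \<open>Finite Euler products\<close>

lemma has_sum_riemann_zeta:
  assumes "Re s > 1"
  shows "((\<lambda>k. of_nat k powr (-s)) has_sum riemann_zeta s) {1..}"
proof -
  have "summable (\<lambda>n. real (Suc n) powr - Re s)" using assms by (intro summable_Suc_powr) auto
  hence "summable (\<lambda>n. norm (of_nat (Suc n) powr (-s) :: complex))"
    by (simp only: norm_of_nat_powr uminus_complex.sel)
  from norm_summable_imp_has_sum[OF this riemann_zeta_sums[OF assms]]
  have "((\<lambda>n. of_nat (Suc n) powr (-s)) has_sum riemann_zeta s) UNIV" .
  moreover have "bij_betw Suc UNIV {1..}"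
    by (rule bij_betwI[where g = "\<lambda>n. n - 1"]) auto
  ultimately show ?thesis using has_sum_reindex_bij_betw[of Suc UNIV "{1..}" "\<lambda>k. of_nat k powr (-s)"] by simp
qed

lemma of_nat_powr_mult:
  assumes "a > 0" "b > 0"
  shows "of_nat (a * b) powr s = of_nat a powr s * (of_nat b powr s :: complex)"
  using assms powr_times_real[of "of_nat a" "of_nat b" s] by simp

lemma norm_nat_powr: "k > 0 \<Longrightarrow> norm (of_nat k powr s :: complex) = real k powr Re s"
  using norm_of_nat_powr[of "k - 1" s] by simp

text \<open>The coefficient at \<open>k\<close> depends only on which primes of \<open>P\<close> divide \<open>k\<close>. Adjoining a prime \<open>q\<close> to \<open>P\<close>
  therefore adds \<open>\<theta> q\<close> times the old sum over the multiples of \<open>q\<close>, and that is the full sum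
  scaled by \<open>q powr (- s)\<close>. Taking \<open>\<theta> = -1\<close> gives the product for
  \<open>1 / \<zeta>\<close>; taking \<open>\<theta> p = 1 / (p - 2)\<close> gives the one for the singular series.\<close>

lemma has_sum_finite_euler_product:
  fixes \<theta> :: "nat \<Rightarrow> complex"
  assumes s: "Re s > 1" and "finite P" "\<And>p. p \<in> P \<Longrightarrow> prime p"
  shows "((\<lambda>k. (\<Prod>p\<in>{p\<in>P. p dvd k}. 1 + \<theta> p) * of_nat k powr (-s))
           has_sum riemann_zeta s * (\<Prod>p\<in>P. 1 + \<theta> p * of_nat p powr (-s))) {1..}"
  using assms(2,3)
proof (induction P rule: finite_induct)
  case empty
  thus ?case using has_sum_riemann_zeta[OF s] by simp
next
  case (insert q P)
  define a where "a = (\<lambda>k. (\<Prod>p\<in>{p\<in>P. p dvd k}. 1 + \<theta> p) * of_nat k powr (-s))"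
  define S where "S = riemann_zeta s * (\<Prod>p\<in>P. 1 + \<theta> p * of_nat p powr (-s))"
  have q: "prime q" "q > 0" using insert.prems prime_gt_0_nat by auto
  have a: "(a has_sum S) {1..}" unfolding a_def S_def by (rule insert.IH) (use insert.prems in auto)
  have aq: "a (q * j) = of_nat q powr (-s) * a j" if "j \<in> {1..}" for j
  proof -
    have "{p\<in>P. p dvd q * j} = {p\<in>P. p dvd j}"
    proof (intro Collect_cong conj_cong refl)
      fix p assume p: "p \<in> P"
      hence "prime p" "p \<noteq> q" using insert by auto
      thus "p dvd q * j \<longleftrightarrow> p dvd j"
        using q prime_dvd_mult_iff[of p q j] primes_dvd_imp_eq[of p q] by blast
    qed
    moreover have "of_nat (q * j) powr (-s) = of_nat q powr (-s) * (of_nat j powr (-s) :: complex)"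
      using that q by (intro of_nat_powr_mult) auto
    ultimately show ?thesis unfolding a_def by (simp only: mult_ac)
  qed
  have "((\<lambda>j. of_nat q powr (-s) * a j) has_sum (of_nat q powr (-s) * S)) {1..}"
    by (rule has_sum_cmult_right[OF a])
  hence "((\<lambda>j. a (q * j)) has_sum (of_nat q powr (-s) * S)) {1..}"
    by (rule has_sum_cong[THEN iffD1, rotated]) (simp add: aq)
  moreover have "bij_betw (\<lambda>j. q * j) {1..} {k\<in>{1..}. q dvd k}"
    by (rule bij_betwI[where g = "\<lambda>k. k div q"]) (use q in \<open>auto simp: Suc_le_eq elim!: dvdE\<close>)
  ultimately have "(a has_sum (of_nat q powr (-s) * S)) {k\<in>{1..}. q dvd k}"
    using has_sum_reindex_bij_betw by blast
  hence "((\<lambda>k. \<theta> q * a k) has_sum (\<theta> q * (of_nat q powr (-s) * S))) {k\<in>{1..}. q dvd k}"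
    by (rule has_sum_cmult_right)
  hence "((\<lambda>k. if q dvd k then \<theta> q * a k else 0) has_sum (\<theta> q * (of_nat q powr (-s) * S))) {1..}"
    by (rule has_sum_cong_neutral[THEN iffD1, rotated -1]) auto
  from has_sum_add[OF a this]
  have "((\<lambda>k. a k + (if q dvd k then \<theta> q * a k else 0)) has_sum (S + \<theta> q * (of_nat q powr (-s) * S))) {1..}" .
  moreover have "a k + (if q dvd k then \<theta> q * a k else 0)
      = (\<Prod>p\<in>{p\<in>insert q P. p dvd k}. 1 + \<theta> p) * of_nat k powr (-s)" for k
  proof -
    have "{p\<in>insert q P. p dvd k} = (if q dvd k then insert q {p\<in>P. p dvd k} else {p\<in>P. p dvd k})" by auto
    thus ?thesis using insert.hyps by (simp add: a_def algebra_simps)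
  qed
  moreover have "S + \<theta> q * (of_nat q powr (-s) * S) = riemann_zeta s * (\<Prod>p\<in>insert q P. 1 + \<theta> p * of_nat p powr (-s))"
    using insert.hyps by (simp add: S_def algebra_simps)
  ultimately show ?case by simp
qed

text \<open>Used for two families of coefficients that stabilise: those of the truncated Euler products agree
  with their limits up to the truncation point.\<close>

lemma infsum_tail_bound:
  fixes f g :: "nat \<Rightarrow> complex"
  assumes c: "c summable_on {1..}"
    and fg: "\<And>k. 1 \<le> k \<Longrightarrow> k \<le> n \<Longrightarrow> f k = g k"
    and f: "\<And>k. k \<ge> 1 \<Longrightarrow> norm (f k) \<le> c k" and g: "\<And>k. k \<ge> 1 \<Longrightarrow> norm (g k) \<le> c k"
  shows "norm (infsum f {1..} - infsum g {1..}) \<le> 2 * infsum c {n<..}"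
proof -
  have "(\<lambda>k. norm (f k)) summable_on {1..}" "(\<lambda>k. norm (g k)) summable_on {1..}"
    by (rule Infinite_Sum.abs_summable_on_comparison_test'[OF c f], simp,
        rule Infinite_Sum.abs_summable_on_comparison_test'[OF c g], simp)
  hence fs: "f summable_on {1..}" "g summable_on {1..}" by (blast intro: abs_summable_summable)+
  have sub: "{n<..} \<subseteq> {1::nat..}" by auto
  have split: "infsum h {1..} = infsum h {1..n} + infsum h {n<..}" if "h summable_on {1..}" for h :: "nat \<Rightarrow> complex"
  proof -
    have "{1..} = {1..n} \<union> {n<..}" by auto
    thus ?thesis using infsum_Un_disjoint[of h "{1..n}" "{n<..}"] summable_on_subset[OF that sub]
      by (simp add: disjoint_iff)
  qed
  have cs: "(c has_sum infsum c {n<..}) {n<..}"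
    using summable_on_subset[OF c sub] by (rule has_sum_infsum)
  have "infsum f {1..n} = infsum g {1..n}" using fg by (intro infsum_cong) auto
  hence "infsum f {1..} - infsum g {1..} = infsum f {n<..} - infsum g {n<..}"
    using split fs by simp
  also have "norm \<dots> \<le> norm (infsum f {n<..}) + norm (infsum g {n<..})" by (rule norm_triangle_ineq4)
  also have "norm (infsum f {n<..}) \<le> infsum c {n<..}"
    by (rule norm_infsum_le[OF has_sum_infsum[OF summable_on_subset[OF fs(1) sub]] cs]) (use f in auto)
  also have "norm (infsum g {n<..}) \<le> infsum c {n<..}"
    by (rule norm_infsum_le[OF has_sum_infsum[OF summable_on_subset[OF fs(2) sub]] cs]) (use g in auto)
  finally show ?thesis by simp
qed

lemma infsum_tail_tendsto_0:
  fixes c :: "nat \<Rightarrow> real"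
  assumes c: "c summable_on {1..}"
  shows "(\<lambda>n. infsum c {n<..}) \<longlonglongrightarrow> 0"
proof -
  have eq: "infsum c {n<..} = infsum c {1..} - (\<Sum>k\<in>{1..n}. c k)" for n
  proof -
    have "{1..} = {1..n} \<union> {n<..}" by auto
    thus ?thesis using infsum_Un_disjoint[of c "{1..n}" "{n<..}"] summable_on_subset[OF c, of "{n<..}"]
      by (simp add: disjoint_iff subset_eq)
  qed
  have "filterlim (\<lambda>n. {1..n}) (finite_subsets_at_top {1::nat..}) sequentially"
    unfolding filterlim_finite_subsets_at_top
  proof (intro allI impI)
    fix X :: "nat set" assume X: "finite X \<and> X \<subseteq> {1..}"
    show "\<forall>\<^sub>F n in sequentially. finite {1..n} \<and> X \<subseteq> {1..n} \<and> {1..n} \<subseteq> {1..}"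
      using eventually_ge_at_top[of "Max (insert 0 X)"]
    proof eventually_elim
      case (elim n)
      thus ?case using X by (auto simp: Max_ge_iff)
    qed
  qed
  from filterlim_compose[OF infsum_tendsto[OF c] this]
  have "(\<lambda>n. \<Sum>k\<in>{1..n}. c k) \<longlonglongrightarrow> infsum c {1..}" .
  from tendsto_diff[OF tendsto_const this, of "infsum c {1..}"] show ?thesis by (simp add: eq)
qed

definition primes_upto :: "nat \<Rightarrow> nat set" where
  "primes_upto n = {p. prime p \<and> p \<le> n}"

lemma finite_primes_upto [simp]: "finite (primes_upto n)"
  unfolding primes_upto_def by (rule finite_subset[of _ "{..n}"]) auto

definition euler_prod :: "nat \<Rightarrow> complex \<Rightarrow> complex" where
  "euler_prod n s = (\<Prod>p\<in>primes_upto n. 1 - of_nat p powr (-s))"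

lemma summable_on_powr:
  assumes "c > 1" shows "(\<lambda>k. real k powr (-c)) summable_on {1..}"
proof -
  have "(\<lambda>k. of_nat k powr (- of_real c) :: complex) summable_on {1..}"
    using has_sum_riemann_zeta[of "of_real c"] assms by (auto simp: summable_on_def)
  hence "(\<lambda>k. norm (of_nat k powr (- of_real c) :: complex)) summable_on {1..}"
    by (rule summable_on_iff_abs_summable_on_complex[THEN iffD1])
  thus ?thesis by (rule summable_on_cong[THEN iffD1, rotated]) (auto simp: norm_nat_powr)
qed

text \<open>The product cancels all terms of the Dirichlet series that have a prime factor at most \<open>n\<close>. What remains is
  \<open>k = 1\<close> and some \<open>k > n\<close>.\<close>

lemma euler_prod_bound:
  assumes c: "c > 1" and s: "Re s \<ge> c"
  shows "norm (riemann_zeta s * euler_prod n s - 1) \<le> 2 * infsum (\<lambda>k. real k powr (-c)) {n<..}"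
proof -
  define f where "f = (\<lambda>k. (if \<exists>p\<in>primes_upto n. p dvd k then 0 else 1) * of_nat k powr (-s) :: complex)"
  define g where "g = (\<lambda>k::nat. if k = 1 then 1 else 0 :: complex)"
  have coeff: "(\<Prod>p\<in>{p\<in>primes_upto n. p dvd k}. 1 + (-1)) = (if \<exists>p\<in>primes_upto n. p dvd k then 0 else 1 :: complex)" for k
  proof (cases "\<exists>p\<in>primes_upto n. p dvd k")
    case True
    hence "{p\<in>primes_upto n. p dvd k} \<noteq> {}" by blast
    hence "card {p\<in>primes_upto n. p dvd k} > 0" by (subst card_gt_0_iff) auto
    thus ?thesis using True by simp
  next
    case False
    hence "{p\<in>primes_upto n. p dvd k} = {}" by blast
    thus ?thesis using False by (simp only: prod.empty if_False)
  qed
  have "((\<lambda>k. (\<Prod>p\<in>{p\<in>primes_upto n. p dvd k}. 1 + (-1)) * of_nat k powr (-s))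
          has_sum riemann_zeta s * (\<Prod>p\<in>primes_upto n. 1 + (-1) * of_nat p powr (-s))) {1..}"
    using s c by (intro has_sum_finite_euler_product) (auto simp: primes_upto_def)
  also have "(\<Prod>p\<in>primes_upto n. 1 + (-1) * of_nat p powr (-s)) = euler_prod n s"
    by (simp add: euler_prod_def)
  finally have "(f has_sum riemann_zeta s * euler_prod n s) {1..}"
    unfolding coeff f_def .
  hence f: "infsum f {1..} = riemann_zeta s * euler_prod n s" by (rule infsumI)
  have g: "infsum g {1..} = 1"
  proof -
    have "infsum g {1..} = infsum g {1}" by (rule infsum_cong_neutral) (auto simp: g_def)
    thus ?thesis by (simp add: g_def)
  qed
  have "norm (infsum f {1..} - infsum g {1..}) \<le> 2 * infsum (\<lambda>k. real k powr (-c)) {n<..}"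
  proof (rule infsum_tail_bound[OF summable_on_powr[OF c]])
    fix k :: nat assume k: "k \<ge> 1"
    have "norm (f k) \<le> 1 * real k powr (-Re s)"
      unfolding f_def norm_mult by (rule mult_mono) (use k in \<open>auto simp: norm_nat_powr\<close>)
    also have "\<dots> \<le> real k powr (-c)" using s k by (auto intro: powr_mono)
    finally show "norm (f k) \<le> real k powr (-c)" .
    show "norm (g k) \<le> real k powr (-c)" by (auto simp: g_def)
    assume kn: "k \<le> n"
    show "f k = g k"
    proof (cases "k = 1")
      case True
      hence "\<not> (\<exists>p\<in>primes_upto n. p dvd k)" by (auto simp: primes_upto_def)
      thus ?thesis using True by (simp add: f_def g_def)
    next
      case False
      then obtain p where p: "prime p" "p dvd k" using prime_factor_nat by blast
      hence "p \<le> n" using dvd_imp_le[of p k] k kn by simp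
      hence "\<exists>p\<in>primes_upto n. p dvd k" using p by (auto simp: primes_upto_def)
      thus ?thesis using False by (simp add: f_def g_def)
    qed
  qed
  thus ?thesis by (simp only: f g)
qed

lemma euler_prod_uniform_limit:
  assumes c: "c > 1"
  shows "uniform_limit {s. Re s \<ge> c} (\<lambda>n s. riemann_zeta s * euler_prod n s) (\<lambda>_. 1) sequentially"
proof (rule uniform_limitI)
  fix e :: real assume e: "e > 0"
  have "(\<lambda>n. 2 * infsum (\<lambda>k. real k powr (-c)) {n<..}) \<longlonglongrightarrow> 2 * 0"
    by (intro tendsto_intros infsum_tail_tendsto_0 summable_on_powr c)
  hence "\<forall>\<^sub>F n in sequentially. 2 * infsum (\<lambda>k. real k powr (-c)) {n<..} < e"
    using e by (intro order_tendstoD) auto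
  thus "\<forall>\<^sub>F n in sequentially. \<forall>s\<in>{s. Re s \<ge> c}. dist (riemann_zeta s * euler_prod n s) 1 < e"
  proof eventually_elim
    case (elim n)
    show ?case
      unfolding dist_norm using euler_prod_bound[OF c, of _ n] elim by (auto intro: le_less_trans)
  qed
qed

lemma euler_prod_tendsto:
  assumes "Re s > 1"
  shows "riemann_zeta s \<noteq> 0" "(\<lambda>n. euler_prod n s) \<longlonglongrightarrow> 1 / riemann_zeta s"
proof -
  have lim: "(\<lambda>n. riemann_zeta s * euler_prod n s) \<longlonglongrightarrow> 1"
    by (rule tendsto_uniform_limitI[OF euler_prod_uniform_limit[OF assms]]) simp
  show nz: "riemann_zeta s \<noteq> 0"
  proof
    assume "riemann_zeta s = 0"
    with lim have "(\<lambda>n::nat. 0::complex) \<longlonglongrightarrow> 1" by simp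
    hence "(0::complex) = 1" by (rule LIMSEQ_unique[OF tendsto_const])
    thus False by simp
  qed
  from tendsto_divide[OF lim tendsto_const nz] show "(\<lambda>n. euler_prod n s) \<longlonglongrightarrow> 1 / riemann_zeta s"
    using nz by simp
qed

lemma norm_riemann_zeta_le:
  assumes "c > 1" "Re s \<ge> c"
  shows "norm (riemann_zeta s) \<le> norm (riemann_zeta (of_real c))"
proof -
  have 1: "((\<lambda>k. of_nat k powr (-s)) has_sum riemann_zeta s) {1..}"
    using assms by (intro has_sum_riemann_zeta) auto
  have 2: "((\<lambda>k. of_nat k powr (-of_real c)) has_sum riemann_zeta (of_real c)) {1..}"
    using assms by (intro has_sum_riemann_zeta) auto
  hence "((\<lambda>k. Re (of_nat k powr (-of_real c))) has_sum Re (riemann_zeta (of_real c))) {1..}"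
    by (rule has_sum_Re)
  moreover have "Re (of_nat k powr (-of_real c)) = real k powr (-c)" for k :: nat
    by (simp add: powr_of_real[of "real k" "-c", simplified])
  ultimately have "((\<lambda>k. real k powr (-c)) has_sum Re (riemann_zeta (of_real c))) {1..}" by simp
  note 3 = this
  have "norm (riemann_zeta s) \<le> Re (riemann_zeta (of_real c))"
  proof (rule norm_infsum_le[OF 1 3])
    fix k :: nat assume "k \<in> {1..}"
    thus "norm (of_nat k powr (-s) :: complex) \<le> real k powr (-c)"
      using assms powr_mono[of "- Re s" "-c" "real k"] by (simp add: norm_nat_powr)
  qed
  thus ?thesis using complex_Re_le_cmod order_trans by blast
qed

lemma le_of_mult_inverse_le_one:
  fixes a b :: real
  assumes "0 < b" "a * (1 / b) \<le> 1" shows "a \<le> b"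
  using assms by (simp add: pos_divide_le_eq)

text \<open>For \<open>r = p powr (- Re s)\<close> the factors satisfy \<open>norm (1 - p powr (- s)) * (1 - r) \<le> (1 + r) * (1 - r) \<le> 1\<close>; hence
  \<open>1 / \<zeta>(s)\<close> is dominated by \<open>\<zeta>(Re s)\<close>.\<close>

lemma norm_inverse_riemann_zeta_le:
  assumes "c > 1" "Re s \<ge> c"
  shows "norm (1 / riemann_zeta s) \<le> norm (riemann_zeta (of_real c))"
proof -
  let ?u = "\<lambda>p. norm (1 - of_nat p powr (-s) :: complex)" and ?v = "\<lambda>p. norm (1 - of_nat p powr (- of_real (Re s)) :: complex)"
  have "norm (euler_prod n s) * norm (euler_prod n (of_real (Re s))) \<le> 1" for n
  proof -
    have "norm (euler_prod n s) * norm (euler_prod n (of_real (Re s)))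
        = (\<Prod>p\<in>primes_upto n. ?u p * ?v p)"
      by (simp add: euler_prod_def prod_norm prod.distrib)
    also have "\<dots> \<le> 1"
    proof (rule prod_le_1, intro conjI)
      fix p assume "p \<in> primes_upto n"
      hence p: "p > 1" by (auto simp: primes_upto_def prime_gt_Suc_0_nat)
      define r where "r = real p powr (-Re s)"
      have r: "0 < r" "r < 1" using p assms by (auto simp: r_def powr_less_one)
      have "?u p \<le> 1 + r"
        using norm_triangle_ineq4[of 1 "of_nat p powr (-s) :: complex"] p by (simp add: norm_nat_powr r_def)
      moreover have "?v p = 1 - r"
      proof -
        have "of_nat p powr (- of_real (Re s)) = complex_of_real r"
          unfolding r_def by (simp add: powr_of_real[of "real p" "- Re s", simplified])
        hence "1 - of_nat p powr (- of_real (Re s)) = complex_of_real (1 - r)" by simp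
        thus ?thesis using r by (simp only: norm_of_real)
      qed
      ultimately have "?u p * ?v p \<le> (1 + r) * (1 - r)"
        using r by (simp add: mult_right_mono)
      also have "\<dots> \<le> 1" using r by (simp add: algebra_simps)
      finally show "?u p * ?v p \<le> 1" .
    qed auto
    finally show ?thesis .
  qed
  moreover have "(\<lambda>n. norm (euler_prod n s) * norm (euler_prod n (of_real (Re s))))
      \<longlonglongrightarrow> norm (1 / riemann_zeta s) * norm (1 / riemann_zeta (of_real (Re s)))"
    using assms by (intro tendsto_intros euler_prod_tendsto) auto
  ultimately have "norm (1 / riemann_zeta s) * norm (1 / riemann_zeta (of_real (Re s))) \<le> 1"
    by (intro LIMSEQ_le_const2) auto
  moreover have "riemann_zeta (of_real (Re s)) \<noteq> 0" using assms by (intro euler_prod_tendsto) auto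
  hence "norm (riemann_zeta (of_real (Re s))) > 0" by (rule zero_less_norm_iff[THEN iffD2])
  ultimately have "norm (1 / riemann_zeta s) \<le> norm (riemann_zeta (of_real (Re s)))"
    unfolding norm_divide[of 1 "riemann_zeta (of_real (Re s))"] norm_one
    by - (rule le_of_mult_inverse_le_one)
  also have "\<dots> \<le> norm (riemann_zeta (of_real c))" using assms by (intro norm_riemann_zeta_le) auto
  finally show ?thesis .
qed

section \<open>Non-vanishing on the line \<open>Re s = 1\<close>\<close>

text \<open>Expanding the logarithms, the \<open>n\<close>-th coefficient is \<open>- r ^ n / n\<close> times
  \<open>3 + 4 cos \<phi> + cos (2 \<phi>) = 2 (1 + cos \<phi>)\<^sup>2 \<ge> 0\<close>, where \<open>\<phi>\<close> is the argument of \<open>z ^ n\<close>.\<close>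

lemma three_four_one_factor:
  fixes r :: real and z :: complex
  assumes r: "0 < r" "r < 1" and z: "norm z = 1"
  shows "norm (1 - of_real r :: complex) ^ 3 * norm (1 - of_real r * z) ^ 4 * norm (1 - of_real r * z ^ 2) \<le> 1"
proof -
  have ser: "(\<lambda>n. - (r ^ n / real n * Re (u ^ n))) sums ln (norm (1 - of_real r * u))" if u: "norm u = 1" for u :: complex
  proof -
    have nw: "norm (- (of_real r * u)) < 1" using u r by (simp add: norm_mult)
    have nz: "1 - of_real r * u \<noteq> 0"
    proof
      assume "1 - of_real r * u = 0"
      hence "of_real r * u = 1" by simp
      hence "norm (of_real r * u) = 1" by simp
      thus False using nw by simp
    qed
    have "(\<lambda>n. - ((- (- (of_real r * u))) ^ n) / of_nat n) sums ln (1 + - (of_real r * u))"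
      by (rule Ln_series'[OF nw])
    hence A: "(\<lambda>n. Re (- ((of_real r * u) ^ n) / of_nat n)) sums Re (ln (1 - of_real r * u))"
      unfolding sums_complex_iff by (simp only: minus_minus diff_conv_add_uminus)
    have B: "Re (- ((of_real r * u) ^ n) / of_nat n) = - (r ^ n / real n * Re (u ^ n))" for n
    proof -
      have re: "Re (of_real c * w) = c * Re w" for c w by simp
      have "- ((of_real r * u) ^ n) / of_nat n = of_real (- (r ^ n / real n)) * u ^ n"
        by (simp add: power_mult_distrib)
      hence "Re (- ((of_real r * u) ^ n) / of_nat n) = - (r ^ n / real n) * Re (u ^ n)"
        by (simp only: re)
      thus ?thesis by (simp only: mult_minus_left)
    qed
    show ?thesis using A unfolding B Re_Ln[OF nz] .
  qed
  define A B C where "A = norm (1 - of_real r * 1 :: complex)" and "B = norm (1 - of_real r * z)" and "C = norm (1 - of_real r * z ^ 2)"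
  have pos: "A > 0" "B > 0" "C > 0"
  proof -
    have nz: "norm (1 - of_real r * u) > 0" if "norm u = 1" for u :: complex
    proof -
      have "1 - of_real r * u \<noteq> 0"
      proof
        assume "1 - of_real r * u = 0"
        hence "of_real r * u = 1" by simp
        hence "norm (of_real r * u) = 1" by simp
        thus False using that r by (simp add: norm_mult)
      qed
      thus ?thesis by (rule zero_less_norm_iff[THEN iffD2])
    qed
    have "norm (z ^ 2) = 1" using z by (simp add: norm_power)
    thus "A > 0" "B > 0" "C > 0" unfolding A_def B_def C_def using z by (blast intro: nz norm_one)+
  qed
  have s1: "(\<lambda>n. 3 * - (r ^ n / real n * Re (1 ^ n)) + 4 * - (r ^ n / real n * Re (z ^ n)) + - (r ^ n / real n * Re ((z\<^sup>2) ^ n)))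
      sums (3 * ln A + 4 * ln B + ln C)"
    unfolding A_def B_def C_def
    by (intro sums_add sums_mult ser) (use z in \<open>auto simp: norm_power\<close>)
  have l1: "3 * - (r ^ n / real n * Re (1 ^ n)) + 4 * - (r ^ n / real n * Re (z ^ n)) + - (r ^ n / real n * Re ((z\<^sup>2) ^ n)) \<le> 0" for n
  proof -
    define u where "u = z ^ n"
    have "norm u = 1" using z by (simp add: u_def norm_power)
    hence "(Re u)\<^sup>2 + (Im u)\<^sup>2 = 1" by (metis cmod_power2 one_power2)
    hence "3 + 4 * Re u + Re (u\<^sup>2) = 2 * (1 + Re u)\<^sup>2"
      by (simp add: power2_eq_square algebra_simps)
    hence ge: "3 + 4 * Re u + Re (u\<^sup>2) \<ge> 0" by simp
    have "3 * - (r ^ n / real n * Re (1 ^ n)) + 4 * - (r ^ n / real n * Re (z ^ n)) + - (r ^ n / real n * Re ((z\<^sup>2) ^ n))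
       = - (r ^ n / real n * (3 + 4 * Re u + Re (u\<^sup>2)))"
      by (simp add: u_def algebra_simps flip: power_mult)
    also have "\<dots> \<le> 0" using ge r by simp
    finally show ?thesis .
  qed
  have "3 * ln A + 4 * ln B + ln C \<le> 0" by (rule sums_le[OF l1 s1 sums_zero])
  hence "ln (A ^ 3 * B ^ 4 * C) \<le> 0" using pos by (simp add: ln_mult ln_realpow)
  hence "A ^ 3 * B ^ 4 * C \<le> 1" using pos by (simp add: ln_le_zero_iff)
  thus ?thesis by (simp add: A_def B_def C_def)
qed

lemma three_four_one:
  assumes "\<sigma> > 1"
  shows "norm (riemann_zeta (of_real \<sigma>)) ^ 3 * norm (riemann_zeta (Complex \<sigma> t)) ^ 4 * norm (riemann_zeta (Complex \<sigma> (2 * t))) \<ge> 1"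
proof -
  let ?E = "\<lambda>n t. euler_prod n (Complex \<sigma> t)"
  let ?P = "norm (riemann_zeta (of_real \<sigma>)) ^ 3 * norm (riemann_zeta (Complex \<sigma> t)) ^ 4 * norm (riemann_zeta (Complex \<sigma> (2 * t)))"
  define f where "f = (\<lambda>(s1::complex) (s2::complex) (s3::complex). norm s1 ^ 3 * norm s2 ^ 4 * norm s3)"
  have le: "f (euler_prod n (of_real \<sigma>)) (?E n t) (?E n (2 * t)) \<le> 1" for n
  proof -
    let ?F = "\<lambda>s p. norm (1 - of_nat p powr (-s) :: complex)"
    have "f (euler_prod n (of_real \<sigma>)) (?E n t) (?E n (2 * t))
        = (\<Prod>p\<in>primes_upto n. ?F (of_real \<sigma>) p ^ 3 * ?F (Complex \<sigma> t) p ^ 4 * ?F (Complex \<sigma> (2 * t)) p)"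
      by (simp add: f_def euler_prod_def prod.distrib prod_power_distrib flip: prod_norm)
    also have "\<dots> \<le> 1"
    proof (rule prod_le_1, intro conjI)
      fix p assume "p \<in> primes_upto n"
      hence p: "p > 1" by (auto simp: primes_upto_def prime_gt_Suc_0_nat)
      define r where "r = real p powr (-\<sigma>)"
      define z where "z = of_nat p powr (- (\<i> * of_real t))"
      have r: "0 < r" "r < 1" using p assms by (auto simp: r_def powr_less_one)
      have z: "norm z = 1" using p by (simp add: z_def norm_nat_powr)
      have pr: "of_nat p powr (- of_real \<sigma>) = complex_of_real r"
        unfolding r_def by (simp add: powr_of_real[of "real p" "- \<sigma>", simplified])
      have e1: "of_nat p powr (- Complex \<sigma> t) = of_real r * z"
        unfolding pr[symmetric] z_def powr_add[symmetric] by (simp add: Complex_eq)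
      have e2: "of_nat p powr (- Complex \<sigma> (2 * t)) = of_real r * z ^ 2"
        unfolding pr[symmetric] z_def power2_eq_square powr_add[symmetric] by (simp add: Complex_eq mult_ac)
      show "?F (of_real \<sigma>) p ^ 3 * ?F (Complex \<sigma> t) p ^ 4 * ?F (Complex \<sigma> (2 * t)) p \<le> 1"
        unfolding pr e1 e2 by (rule three_four_one_factor[OF r z])
    qed auto
    finally show ?thesis .
  qed
  have "(\<lambda>n. f (euler_prod n (of_real \<sigma>)) (?E n t) (?E n (2 * t)))
     \<longlonglongrightarrow> f (1 / riemann_zeta (of_real \<sigma>)) (1 / riemann_zeta (Complex \<sigma> t)) (1 / riemann_zeta (Complex \<sigma> (2 * t)))"
    unfolding f_def using assms by (intro tendsto_intros euler_prod_tendsto) auto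
  hence "f (1 / riemann_zeta (of_real \<sigma>)) (1 / riemann_zeta (Complex \<sigma> t)) (1 / riemann_zeta (Complex \<sigma> (2 * t))) \<le> 1"
    by (rule LIMSEQ_le_const2) (use le in auto)
  moreover have "riemann_zeta (of_real \<sigma>) \<noteq> 0" "riemann_zeta (Complex \<sigma> t) \<noteq> 0" "riemann_zeta (Complex \<sigma> (2 * t)) \<noteq> 0"
    using assms by (auto intro!: euler_prod_tendsto(1))
  hence "?P > 0"
    by (intro mult_pos_pos zero_less_power) auto
  moreover from calculation(1) have "1 * (1 / (?P)) \<le> 1"
    by (simp add: f_def norm_divide power_divide mult_ac)
  ultimately show ?thesis by - (rule le_of_mult_inverse_le_one)
qed

text \<open>The hypothesis called \<open>riemann_hypothesis\<close> only speaks of the open strip \<open>0 < Re s < 1\<close>, so the line \<open>Re s = 1\<close> needs the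
  classical argument of Mertens: near a zero at \<open>1 + i t\<close> the product in \<open>three_four_one\<close>, which is at
  least \<open>1\<close>, would have a triple pole against a zero of order at least four.\<close>

lemma zeta_entire_nonzero_Re_1:
  assumes "Re s = 1" shows "zeta_entire s \<noteq> 0"
proof
  assume zero: "zeta_entire s = 0"
  define t where "t = Im s"
  have s: "s = Complex 1 t" using assms by (simp add: t_def complex_eq_iff)
  have t: "t \<noteq> 0" using zero s by (auto simp: Complex_eq)
  have der: "(zeta_entire has_field_derivative deriv zeta_entire w) (at w)" for w
    by (rule holomorphic_derivI[OF zeta_entire_holomorphic[of UNIV]]) auto
  have cont: "isCont zeta_entire w" for w using der DERIV_isCont by blast
  have lim: "((\<lambda>\<sigma>::real. Complex \<sigma> y) \<longlongrightarrow> Complex 1 y) (at_right 1)" for y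
    by (intro tendsto_Complex tendsto_intros)
  have limZ: "((\<lambda>\<sigma>::real. zeta_entire (Complex \<sigma> y)) \<longlongrightarrow> zeta_entire (Complex 1 y)) (at_right 1)" for y
    by (rule isCont_tendsto_compose[OF cont lim])
  have limQ: "((\<lambda>\<sigma>::real. zeta_entire (Complex \<sigma> t) / of_real (\<sigma> - 1)) \<longlongrightarrow> deriv zeta_entire s) (at_right 1)"
  proof -
    have "((\<lambda>w. (zeta_entire w - zeta_entire s) / (w - s)) \<longlongrightarrow> deriv zeta_entire s) (at s)"
      using der[of s] by (simp add: has_field_derivative_iff)
    moreover have "filterlim (\<lambda>\<sigma>::real. Complex \<sigma> t) (at s) (at_right 1)"
      unfolding filterlim_at using lim[of t]
      by (auto simp: s complex_eq_iff eventually_at_filter intro!: always_eventually)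
    ultimately have "((\<lambda>\<sigma>::real. (zeta_entire (Complex \<sigma> t) - zeta_entire s) / (Complex \<sigma> t - s)) \<longlongrightarrow> deriv zeta_entire s) (at_right 1)"
      by (rule filterlim_compose)
    moreover have "Complex \<sigma> t - s = of_real (\<sigma> - 1)" for \<sigma> by (simp add: s complex_eq_iff)
    ultimately show ?thesis by (simp add: zero)
  qed
  \<comment> \<open>The product of \<open>three_four_one\<close>, with the powers of \<open>\<sigma> - 1\<close> collected into one factor that tends to \<open>0\<close>.\<close>
  define F where "F = (\<lambda>\<sigma>::real. (\<sigma> - 1) * norm (zeta_entire (Complex \<sigma> 0)) ^ 3
     * (norm (zeta_entire (Complex \<sigma> t) / of_real (\<sigma> - 1)) / norm (Complex \<sigma> t - 1)) ^ 4
     * (norm (zeta_entire (Complex \<sigma> (2 * t))) / norm (Complex \<sigma> (2 * t) - 1)))"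
  have "(F \<longlongrightarrow> (1 - 1) * norm (zeta_entire (Complex 1 0)) ^ 3
     * (norm (deriv zeta_entire s) / norm (Complex 1 t - 1)) ^ 4
     * (norm (zeta_entire (Complex 1 (2 * t))) / norm (Complex 1 (2 * t) - 1))) (at_right 1)"
    unfolding F_def using t by (intro tendsto_intros limQ limZ lim) (auto simp: complex_eq_iff)
  hence "(F \<longlongrightarrow> 0) (at_right 1)" by simp
  moreover have "\<forall>\<^sub>F \<sigma> in at_right 1. F \<sigma> \<ge> 1"
  proof -
    have "F \<sigma> \<ge> 1" if \<sigma>: "\<sigma> > 1" for \<sigma>
    proof -
      have z: "norm (riemann_zeta (Complex \<sigma> y)) = norm (zeta_entire (Complex \<sigma> y)) / norm (Complex \<sigma> y - 1)" for y
        using \<sigma> by (subst riemann_zeta_conv_zeta_entire) (auto simp: complex_eq_iff norm_divide)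
      have "Complex \<sigma> 0 - 1 = of_real (\<sigma> - 1)" by (simp add: complex_eq_iff)
      hence n0: "norm (Complex \<sigma> 0 - 1) = \<sigma> - 1" using \<sigma> by (simp only: norm_of_real)
      have "1 \<le> norm (riemann_zeta (Complex \<sigma> 0)) ^ 3 * norm (riemann_zeta (Complex \<sigma> t)) ^ 4 * norm (riemann_zeta (Complex \<sigma> (2 * t)))"
        using three_four_one[OF \<sigma>, of t] by (simp add: Complex_eq)
      also have "\<dots> = F \<sigma>"
      proof -
        have n1: "norm (w / of_real (\<sigma> - 1) :: complex) = norm w / (\<sigma> - 1)" for w
          unfolding norm_divide norm_of_real using \<sigma> by simp
        show ?thesis
          unfolding z n0 F_def n1 using \<sigma> by (simp add: power_divide power3_eq_cube power4_eq_xxxx mult_ac)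
      qed
      finally show ?thesis .
    qed
    thus ?thesis by (auto simp: eventually_at_filter)
  qed
  ultimately have "0 \<ge> (1::real)"
    by (intro tendsto_lowerbound[of F 0 "at_right 1" 1]) auto
  thus False by simp
qed

lemma zeta_entire_nonzero:
  assumes rh: riemann_hypothesis and s: "Re s > 1 / 2"
  shows "zeta_entire s \<noteq> 0"
proof (cases "Re s" "1 :: real" rule: linorder_cases)
  case less
  have "riemann_zeta s \<noteq> 0"
  proof
    assume "riemann_zeta s = 0"
    moreover have "0 < Re s" using s by simp
    ultimately have "Re s = 1 / 2" using rh less unfolding riemann_hypothesis_def by blast
    with s show False by simp
  qed
  thus ?thesis using less by (auto simp: zeta_entire_def)
next
  case equal thus ?thesis by (rule zeta_entire_nonzero_Re_1)
next
  case greater thus ?thesis using euler_prod_tendsto(1)[of s] by (auto simp: zeta_entire_def)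
qed

section \<open>Integrals over vertical lines\<close>

lemma integrable_powr_decay:
  fixes q :: real assumes "q > 1"
  shows "integrable lborel (\<lambda>t::real. (1 + \<bar>t\<bar>) powr (-q))"
proof -
  define f where "f = (\<lambda>x::real. indicator {1..} x *\<^sub>R x powr (-q))"
  have "(\<lambda>x. x powr (-q)) integrable_on {1::real..}"
    using has_integral_powr_to_inf[of "-q" 1] assms by (auto simp: integrable_on_def)
  hence "(\<lambda>x. x powr (-q)) absolutely_integrable_on {1::real..}"
    by (intro nonnegative_absolutely_integrable_1) auto
  hence "integrable lebesgue f" by (simp add: set_integrable_def f_def)
  hence f: "integrable lborel f"
    by (subst (asm) integrable_completion) (auto simp: f_def)
  have "integrable lborel (\<lambda>t. f (1 + 1 * t) + f (1 + (-1) * t))"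
    by (intro Bochner_Integration.integrable_add lborel_integrable_real_affine f) auto
  thus ?thesis
  proof (rule Bochner_Integration.integrable_bound)
    show "AE t in lborel. norm ((1 + \<bar>t\<bar>) powr (-q)) \<le> norm (f (1 + 1 * t) + f (1 + (-1) * t))"
      by (intro AE_I2) (auto simp: f_def indicator_def abs_if)
  qed measurable
qed

lemma integrable_of_powr_decay:
  fixes g :: "real \<Rightarrow> complex"
  assumes "continuous_on UNIV g" "q > 1" "\<And>t. norm (g t) \<le> C * (1 + \<bar>t\<bar>) powr (-q)"
  shows "integrable lborel g"
proof -
  have "integrable lborel (\<lambda>t. C * (1 + \<bar>t\<bar>) powr (-q))"
    using integrable_powr_decay[OF assms(2)] by simp
  thus ?thesis
  proof (rule Bochner_Integration.integrable_bound)
    show "g \<in> borel_measurable lborel"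
      using borel_measurable_continuous_onI[OF assms(1)] by simp
    show "AE t in lborel. norm (g t) \<le> norm (C * (1 + \<bar>t\<bar>) powr (-q))"
      using assms(3) by (intro AE_I2) (metis abs_ge_self order_trans real_norm_def)
  qed
qed

lemma tendsto_symmetric_integral:
  fixes g :: "real \<Rightarrow> complex"
  assumes g: "integrable lborel g"
  shows "((\<lambda>T. integral {-T..T} g) \<longlongrightarrow> (LINT t|lborel. g t)) at_top"
proof -
  have "((\<lambda>T. LINT t|lborel. indicator {-T..T} t *\<^sub>R g t) \<longlongrightarrow> (LINT t|lborel. g t)) at_top"
  proof (rule integral_dominated_convergence_at_top[where w = "\<lambda>t. norm (g t)"])
    show "AE t in lborel. ((\<lambda>T. indicator {-T..T} t *\<^sub>R g t) \<longlongrightarrow> g t) at_top"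
    proof (intro AE_I2 tendsto_eventually)
      fix t :: real
      show "\<forall>\<^sub>F T in at_top. indicator {-T..T} t *\<^sub>R g t = g t"
        using eventually_ge_at_top[of "\<bar>t\<bar>"] by eventually_elim (auto simp: indicator_def)
    qed
    show "\<forall>\<^sub>F T in at_top. AE t in lborel. norm (indicator {-T..T} t *\<^sub>R g t) \<le> norm (g t)"
      by (intro always_eventually allI AE_I2) (auto simp: indicator_def)
  qed (use g in auto)
  moreover have "(LINT t|lborel. indicator {-T..T} t *\<^sub>R g t) = integral {-T..T} g" for T
  proof -
    have "set_integrable lborel {-T..T} g"
      unfolding set_integrable_def
      by (rule Bochner_Integration.integrable_bound[OF g]) (use g in \<open>auto simp: indicator_def\<close>)
    from set_borel_integral_eq_integral(2)[OF this] show ?thesis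
      by (simp add: set_lebesgue_integral_def)
  qed
  ultimately show ?thesis by simp
qed

lemma integrable_vertical_line:
  fixes f :: "complex \<Rightarrow> complex"
  assumes cont: "continuous_on {s. Re s = c} f" and q: "q > 1"
    and decay: "\<And>t. \<bar>t\<bar> \<ge> T0 \<Longrightarrow> norm (f (Complex c t)) \<le> C * (1 + \<bar>t\<bar>) powr (-q)"
  shows "integrable lborel (\<lambda>t. f (Complex c t))"
proof -
  have cont': "continuous_on A (\<lambda>t. f (Complex c t))" for A
    by (rule continuous_on_compose2[OF cont]) (auto simp: Complex_eq intro!: continuous_intros)
  have "compact ((\<lambda>t. f (Complex c t)) ` {-T0..T0})"
    by (intro compact_continuous_image cont') auto
  from compact_imp_bounded[OF this] obtain K where
    K': "\<forall>t\<in>{-T0..T0}. norm (f (Complex c t)) \<le> K"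
    unfolding bounded_iff by auto
  have K: "norm (f (Complex c t)) \<le> K" if "\<bar>t\<bar> \<le> T0" for t
    using K' that by (auto simp: abs_le_iff)
  have "norm (f (Complex c t)) \<le> (\<bar>K\<bar> * (1 + \<bar>T0\<bar>) powr q + \<bar>C\<bar>) * (1 + \<bar>t\<bar>) powr (-q)" for t
  proof (cases "\<bar>t\<bar> \<ge> T0")
    case True
    have "norm (f (Complex c t)) \<le> C * (1 + \<bar>t\<bar>) powr (-q)" by (rule decay[OF True])
    also have "\<dots> \<le> (\<bar>K\<bar> * (1 + \<bar>T0\<bar>) powr q + \<bar>C\<bar>) * (1 + \<bar>t\<bar>) powr (-q)"
      using abs_ge_self[of C] by (intro mult_right_mono) (auto intro: add_increasing)
    finally show ?thesis .
  next
    case False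
    have "(1 + \<bar>T0\<bar>) powr q * (1 + \<bar>t\<bar>) powr (-q) \<ge> 1"
    proof -
      have "(1 + \<bar>t\<bar>) powr q \<le> (1 + \<bar>T0\<bar>) powr q" using False q by (intro powr_mono2) auto
      thus ?thesis by (simp add: powr_minus field_simps)
    qed
    hence "\<bar>K\<bar> * 1 \<le> \<bar>K\<bar> * ((1 + \<bar>T0\<bar>) powr q * (1 + \<bar>t\<bar>) powr (-q))"
      by (intro mult_left_mono) auto
    moreover have "norm (f (Complex c t)) \<le> \<bar>K\<bar>" using K[of t] False by auto
    ultimately have "norm (f (Complex c t)) \<le> \<bar>K\<bar> * ((1 + \<bar>T0\<bar>) powr q * (1 + \<bar>t\<bar>) powr (-q))" by simp
    also have "\<dots> \<le> (\<bar>K\<bar> * (1 + \<bar>T0\<bar>) powr q + \<bar>C\<bar>) * (1 + \<bar>t\<bar>) powr (-q)"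
      by (simp add: algebra_simps)
    finally show ?thesis .
  qed
  from integrable_of_powr_decay[OF cont' q this] show ?thesis .
qed

text \<open>The residue theorem on the rectangle with vertical sides on the two lines and horizontal sides at
  height \<open>T\<close> and \<open>- T\<close>; the decay of \<open>f\<close> kills the horizontal sides as \<open>T\<close> grows.\<close>

lemma vertical_line_shift:
  fixes f :: "complex \<Rightarrow> complex"
  assumes ab: "a' < a" "a < b" "b < b'" and P: "finite P" "\<And>p. p \<in> P \<Longrightarrow> a < Re p \<and> Re p < b"
    and hol: "f holomorphic_on ({s. a' < Re s \<and> Re s < b'} - P)"
    and q: "q > 1"
    and decay: "\<And>s. a \<le> Re s \<Longrightarrow> Re s \<le> b \<Longrightarrow> \<bar>Im s\<bar> \<ge> T0 \<Longrightarrow> norm (f s) \<le> C * (1 + \<bar>Im s\<bar>) powr (-q)"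
  shows "integrable lborel (\<lambda>t. f (Complex a t))" "integrable lborel (\<lambda>t. f (Complex b t))"
    and "(LINT t|lborel. f (Complex b t)) = (LINT t|lborel. f (Complex a t)) + 2 * pi * (\<Sum>p\<in>P. residue f p)"
proof -
  let ?I = "\<lambda>c T. integral {-T..T} (\<lambda>t. f (Complex c t))" and ?J = "\<lambda>c. LINT t|lborel. f (Complex c t)"
    and ?R = "\<Sum>p\<in>P. residue f p" and ?e = "\<lambda>T. \<bar>C\<bar> * (1 + T) powr (-q)"
  have cont: "continuous_on {s. Re s = c} f" if "c \<in> {a, b}" for c
    by (rule continuous_on_subset[OF holomorphic_on_imp_continuous_on[OF hol]])
       (use that ab P in force)
  have decay': "norm (f (Complex c t)) \<le> C * (1 + \<bar>t\<bar>) powr (-q)" if "\<bar>t\<bar> \<ge> T0" "c \<in> {a, b}" for c t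
    using decay[of "Complex c t"] that ab by auto
  show ia: "integrable lborel (\<lambda>t. f (Complex a t))"
    by (rule integrable_vertical_line[OF cont q decay']) (use decay' in auto)
  show ib: "integrable lborel (\<lambda>t. f (Complex b t))"
    by (rule integrable_vertical_line[OF cont q decay']) (use decay' in auto)
  define S where "S = {s. a' < Re s \<and> Re s < b'}"
  have S: "open S" "connected S"
  proof -
    have "S = {s. a' < Re s} \<inter> {s. Re s < b'}" by (auto simp: S_def)
    thus "open S" "connected S"
      by (auto intro!: open_Int open_halfspace_Re_gt open_halfspace_Re_lt convex_connected
            convex_Int convex_halfspace_Re_gt convex_halfspace_Re_lt)
  qed
  \<comment> \<open>The rectangle has to be so high that it contains all poles.\<close>
  define M where "M = Max (insert 0 ((\<lambda>p. \<bar>Im p\<bar>) ` P))"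
  have M: "\<bar>Im p\<bar> \<le> M" if "p \<in> P" for p
    unfolding M_def using P(1) that by (intro Max_ge) auto
  have main: "norm (\<i> * ?I b T - \<i> * ?I a T - 2 * pi * \<i> * ?R) \<le> 2 * (?e T * (b - a))"
    if T: "T > M" "T \<ge> T0" "T > 0" for T
  proof -
    define a1 a2 a3 a4 where "a1 = Complex a (-T)" and "a2 = Complex b (-T)"
      and "a3 = Complex b T" and "a4 = Complex a T"
    note d = a1_def a2_def a3_def a4_def
    have box: "P \<subseteq> box a1 a3"
    proof
      fix p assume p: "p \<in> P"
      from M[OF p] P(2)[OF p] T show "p \<in> box a1 a3"
        unfolding in_box_complex_iff d by (auto simp: abs_le_iff)
    qed
    have cbox: "cbox a1 a3 \<subseteq> S"
      using ab by (auto simp: S_def in_cbox_complex_iff d)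
    have pim: "path_image (rectpath a1 a3) = cbox a1 a3 - box a1 a3"
      by (rule path_image_rectpath_cbox_minus_box) (use ab T in \<open>auto simp: d\<close>)
    have "contour_integral (rectpath a1 a3) f = 2 * pi * \<i> * (\<Sum>p\<in>P. winding_number (rectpath a1 a3) p * residue f p)"
    proof (rule Residue_theorem[OF S P(1)])
      show "f holomorphic_on S - P" using hol by (simp add: S_def)
      show "path_image (rectpath a1 a3) \<subseteq> S - P" using pim box cbox by auto
      show "\<forall>z. z \<notin> S \<longrightarrow> winding_number (rectpath a1 a3) z = 0"
        using cbox by (intro allI impI winding_number_rectpath_outside) (use ab T in \<open>auto simp: d\<close>)
    qed auto
    also have "(\<Sum>p\<in>P. winding_number (rectpath a1 a3) p * residue f p) = ?R"
      using box by (intro sum.cong) (auto simp: winding_number_rectpath)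
    finally have res: "contour_integral (rectpath a1 a3) f = 2 * pi * \<i> * ?R" .
    have fc: "continuous_on (cbox a1 a3 - box a1 a3) f"
      by (rule continuous_on_subset[OF holomorphic_on_imp_continuous_on[OF hol]])
         (use box cbox in \<open>auto simp: S_def\<close>)
    have seg: "closed_segment a1 a2 \<subseteq> cbox a1 a3 - box a1 a3"
       "closed_segment a2 a3 \<subseteq> cbox a1 a3 - box a1 a3"
       "closed_segment a3 a4 \<subseteq> cbox a1 a3 - box a1 a3"
       "closed_segment a4 a1 \<subseteq> cbox a1 a3 - box a1 a3"
      unfolding pim[symmetric] rectpath_def
      by (auto simp: Let_def path_image_join d)
    note ci = contour_integrable_continuous_linepath[OF continuous_on_subset[OF fc]]
    have "contour_integral (rectpath a1 a3) f = contour_integral (linepath a1 a2) f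
        + (contour_integral (linepath a2 a3) f + (contour_integral (linepath a3 a4) f + contour_integral (linepath a4 a1) f))"
    proof -
      have "rectpath a1 a3 = linepath a1 a2 +++ linepath a2 a3 +++ linepath a3 a4 +++ linepath a4 a1"
        by (simp add: rectpath_def Let_def d)
      thus ?thesis using ci[OF seg(1)] ci[OF seg(2)] ci[OF seg(3)] ci[OF seg(4)]
        by (simp add: valid_path_join contour_integrable_joinI)
    qed
    moreover have "contour_integral (linepath a2 a3) f = \<i> * ?I b T"
      by (rule contour_integral_linepath_same_Re) (use T in \<open>auto simp: d\<close>)
    moreover have "contour_integral (linepath a4 a1) f = - (\<i> * ?I a T)"
    proof -
      have "contour_integral (linepath a1 a4) f = \<i> * ?I a T"
        by (rule contour_integral_linepath_same_Re) (use T in \<open>auto simp: d\<close>)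
      thus ?thesis using contour_integral_reverse_linepath[of a1 a4 f] continuous_on_subset[OF fc] seg(4)
        by (simp add: closed_segment_commute)
    qed
    moreover have "norm (contour_integral (linepath a1 a2) f) \<le> ?e T * norm (a2 - a1)"
    proof (rule contour_integral_bound_linepath[OF ci[OF seg(1)]])
      fix x assume "x \<in> closed_segment a1 a2"
      hence x: "Im x = -T" "a \<le> Re x" "Re x \<le> b"
        using ab by (auto simp: d closed_segment_same_Im closed_segment_eq_real_ivl)
      hence "norm (f x) \<le> C * (1 + T) powr (-q)" using decay[of x] T by auto
      also have "\<dots> \<le> ?e T" by (intro mult_right_mono) auto
      finally show "norm (f x) \<le> ?e T" .
    qed auto
    moreover have "norm (contour_integral (linepath a3 a4) f) \<le> ?e T * norm (a4 - a3)"
    proof (rule contour_integral_bound_linepath[OF ci[OF seg(3)]])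
      fix x assume "x \<in> closed_segment a3 a4"
      hence x: "Im x = T" "a \<le> Re x" "Re x \<le> b"
        using ab by (auto simp: d closed_segment_same_Im closed_segment_eq_real_ivl)
      hence "norm (f x) \<le> C * (1 + T) powr (-q)" using decay[of x] T by auto
      also have "\<dots> \<le> ?e T" by (intro mult_right_mono) auto
      finally show "norm (f x) \<le> ?e T" .
    qed auto
    moreover have "norm (a2 - a1) = b - a" "norm (a4 - a3) = b - a"
      using ab by (auto simp: d cmod_def)
    ultimately have "\<i> * ?I b T - \<i> * ?I a T - 2 * pi * \<i> * ?R
          = - (contour_integral (linepath a1 a2) f + contour_integral (linepath a3 a4) f)"
      using res by (simp add: algebra_simps)
    also have "norm \<dots> \<le> norm (contour_integral (linepath a1 a2) f) + norm (contour_integral (linepath a3 a4) f)"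
      unfolding norm_minus_cancel by (rule norm_triangle_ineq)
    also have "\<dots> \<le> 2 * (?e T * (b - a))"
      using \<open>norm (contour_integral (linepath a1 a2) f) \<le> _\<close> \<open>norm (contour_integral (linepath a3 a4) f) \<le> _\<close>
        \<open>norm (a2 - a1) = b - a\<close> \<open>norm (a4 - a3) = b - a\<close> by simp
    finally show ?thesis .
  qed
  have lim0: "((\<lambda>T. 2 * (?e T * (b - a))) \<longlongrightarrow> 0) at_top"
    using q by real_asymp
  have lim1: "((\<lambda>T. \<i> * ?I b T - \<i> * ?I a T - 2 * pi * \<i> * ?R) \<longlongrightarrow> 0) at_top"
  proof (rule Lim_null_comparison[OF _ lim0])
    show "\<forall>\<^sub>F T in at_top. norm (\<i> * ?I b T - \<i> * ?I a T - 2 * pi * \<i> * ?R) \<le> 2 * (?e T * (b - a))"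
      using eventually_gt_at_top[of M] eventually_ge_at_top[of T0] eventually_gt_at_top[of 0]
      by eventually_elim (rule main)
  qed
  have lim2: "((\<lambda>T. \<i> * ?I b T - \<i> * ?I a T - 2 * pi * \<i> * ?R) \<longlongrightarrow>
       \<i> * ?J b - \<i> * ?J a - 2 * pi * \<i> * ?R) at_top"
    by (intro tendsto_intros tendsto_symmetric_integral ia ib)
  have "\<i> * ?J b - \<i> * ?J a - 2 * pi * \<i> * ?R = 0"
    by (rule tendsto_unique[OF _ lim2 lim1]) simp
  hence "\<i> * ?J b = \<i> * (?J a + 2 * pi * ?R)"
    by (simp add: algebra_simps)
  thus "?J b = ?J a + 2 * pi * ?R"
    by simp
qed


section \<open>Borel-Caratheodory and three circles\<close>

text \<open>The Moebius map \<open>u \<mapsto> u / (2 A - u)\<close> sends the half-plane \<open>Re u < A\<close> into the unit disc and fixes \<open>0\<close>, so the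
  Schwarz lemma applies to its composition with \<open>g - g c\<close>.\<close>

lemma borel_caratheodory:
  fixes g :: "complex \<Rightarrow> complex"
  assumes hol: "g holomorphic_on ball c R" and M: "M > 0" "\<And>z. z \<in> ball c R \<Longrightarrow> Re (g z) < M"
    and r: "0 < r" "r < R" and z: "z \<in> cball c r"
  shows "norm (g z) \<le> 2 * (M + norm (g c)) * r / (R - r) + norm (g c)"
proof -
  define A where "A = M + norm (g c)"
  have A: "A > 0" using M by (simp add: A_def add_pos_nonneg)
  have R: "R > 0" using r by simp
  define u where "u = (\<lambda>w. g (c + of_real R * w) - g c)"
  have mem: "c + of_real R * w \<in> ball c R" if "w \<in> ball 0 1" for w
    using that R by (simp add: dist_norm norm_mult)
  have Reu: "Re (u w) < A" if "w \<in> ball 0 1" for w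
    using M(2)[OF mem[OF that]] abs_Re_le_cmod[of "g c"] by (simp add: u_def A_def)
  have nz: "2 * of_real A - u w \<noteq> 0" if "w \<in> ball 0 1" for w
  proof
    assume "2 * of_real A - u w = 0"
    hence "Re (u w) = 2 * A" by (simp add: complex_eq_iff)
    with Reu[OF that] A show False by simp
  qed
  have "(g \<circ> (\<lambda>w. c + of_real R * w)) holomorphic_on ball 0 1"
    by (rule holomorphic_on_compose_gen[OF _ hol]) (use mem in \<open>auto intro!: holomorphic_intros\<close>)
  hence holu: "u holomorphic_on ball 0 1"
    unfolding u_def o_def by (intro holomorphic_intros)
  define \<phi> where "\<phi> = (\<lambda>w. u w / (2 * of_real A - u w))"
  have hol\<phi>: "\<phi> holomorphic_on ball 0 1"
    unfolding \<phi>_def by (intro holomorphic_intros holu nz)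
  have \<phi>1: "norm (\<phi> w) < 1" if "norm w < 1" for w
  proof -
    have w: "w \<in> ball 0 1" using that by simp
    have "(Re (u w))\<^sup>2 < (2 * A - Re (u w))\<^sup>2"
      using Reu[OF w] A by (intro power2_strict_mono) (auto simp: abs_if)
    hence "norm (u w) < norm (2 * of_real A - u w)"
      by (simp add: cmod_def)
    thus ?thesis using nz[OF w] by (simp add: \<phi>_def norm_divide divide_less_eq)
  qed
  define w where "w = (z - c) / of_real R"
  have w: "norm w \<le> r / R" "norm w < 1"
  proof -
    show "norm w \<le> r / R" using z R by (simp add: w_def norm_divide dist_norm norm_minus_commute divide_right_mono)
    also have "r / R < 1" using r by simp
    finally show "norm w < 1" .
  qed
  have "norm (\<phi> w) \<le> norm w"
    by (rule Schwarz_Lemma(1)[OF hol\<phi> _ \<phi>1 w(2)]) (auto simp: \<phi>_def u_def)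
  hence \<phi>w: "norm (\<phi> w) \<le> r / R" using w by simp
  have rR: "r / R < 1" using r by simp
  have n1: "1 + \<phi> w \<noteq> 0" using \<phi>1[OF w(2)]
    by (metis add.commute add.right_inverse add_left_cancel less_irrefl norm_minus_cancel norm_one)
  have "u w * (1 + \<phi> w) = 2 * of_real A * \<phi> w"
    using nz[of w] w by (simp add: \<phi>_def field_simps)
  hence "norm (u w) * norm (1 + \<phi> w) = 2 * A * norm (\<phi> w)"
    using A by (metis abs_of_pos norm_mult norm_numeral norm_of_real)
  moreover have "norm (1 + \<phi> w) \<ge> 1 - r / R"
    using norm_diff_ineq[of 1 "\<phi> w"] \<phi>w by simp
  ultimately have "norm (u w) * (1 - r / R) \<le> 2 * A * (r / R)"
    using \<phi>w A by (smt (verit) mult_left_mono norm_ge_zero)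
  from mult_right_mono[OF this, of R] have "norm (u w) * (R - r) \<le> 2 * A * r"
    using R by (simp add: algebra_simps)
  hence "norm (u w) \<le> 2 * A * r / (R - r)"
    using r by (simp add: pos_le_divide_eq)
  moreover have "g z = u w + g c" using R by (simp add: u_def w_def)
  ultimately show ?thesis using norm_triangle_ineq[of "u w" "g c"] by (simp add: A_def)
qed

text \<open>The sharp bound up to the harmless factor \<open>r2 / r1\<close>: the function
  \<open>f z / (z - c) ^ p\<close> obeys the maximum principle on the annulus; \<open>p\<close> is the least natural number for which its
  bound on the outer circle does not exceed the one on the inner circle. Restricting \<open>p\<close> to natural numbers
  keeps the function single-valued, and rounding costs one factor \<open>r2 / r1\<close>.\<close>

lemma three_circles:
  fixes f :: "complex \<Rightarrow> complex"
  assumes hol: "f holomorphic_on ball c R" and r: "0 < r1" "r1 \<le> r2" "r2 \<le> r3" "r1 < r3" "r3 < R"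
    and AB: "0 < A" "A \<le> B"
    and inner: "\<And>z. z \<in> cball c r1 \<Longrightarrow> norm (f z) \<le> A"
    and outer: "\<And>z. z \<in> cball c r3 \<Longrightarrow> norm (f z) \<le> B"
    and z: "z \<in> cball c r2"
  shows "norm (f z) \<le> (r2 / r1) * A * (B / A) powr (ln (r2 / r1) / ln (r3 / r1))"
proof (cases "z \<in> ball c r1")
  case True
  have "1 * A * 1 \<le> (r2 / r1) * A * (B / A) powr (ln (r2 / r1) / ln (r3 / r1))"
    using r AB by (intro mult_mono ge_one_powr_ge_zero divide_nonneg_nonneg) auto
  with inner[of z] True show ?thesis by simp
next
  case False
  \<comment> \<open>The least \<open>p\<close> with \<open>B / r3 ^ p \<le> A / r1 ^ p\<close>.\<close>
  define p where "p = nat \<lceil>ln (B / A) / ln (r3 / r1)\<rceil>"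
  have l31: "ln (r3 / r1) > 0" using r by simp
  have lBA: "ln (B / A) \<ge> 0" using AB by simp
  have p: "ln (B / A) / ln (r3 / r1) \<le> real p" "real p \<le> ln (B / A) / ln (r3 / r1) + 1"
    using l31 lBA unfolding p_def by (auto simp: divide_nonneg_pos)
  define S where "S = cball c r3 - ball c r1"
  have Ssub: "S \<subseteq> ball c R - {c}" using r by (auto simp: S_def)
  have clS: "closed S" unfolding S_def by (intro closed_Diff) auto
  define h where "h = (\<lambda>z. f z / (z - c) ^ p)"
  have holh: "h holomorphic_on ball c R - {c}"
    unfolding h_def by (intro holomorphic_intros holomorphic_on_subset[OF hol]) auto
  have "norm (h z) \<le> A / r1 ^ p"
  proof (rule maximum_modulus_frontier[where S = S and f = h])
    show "h holomorphic_on interior S"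
      by (rule holomorphic_on_subset[OF holh]) (use Ssub interior_subset[of S] in blast)
    show "continuous_on (closure S) h"
      using clS Ssub holomorphic_on_imp_continuous_on[OF holh] by (simp add: continuous_on_subset)
    show "bounded S" unfolding S_def by (rule bounded_subset[of "cball c r3"]) auto
    show "z \<in> S" using z False r by (auto simp: S_def)
    fix y assume "y \<in> frontier S"
    moreover have "frontier S \<subseteq> sphere c r3 \<union> sphere c r1"
    proof -
      have "ball c r3 - cball c r1 \<subseteq> interior S"
        by (rule interior_maximal) (auto simp: S_def)
      hence "frontier S \<subseteq> S - (ball c r3 - cball c r1)" using clS by (auto simp: frontier_def)
      thus ?thesis by (auto simp: S_def)
    qed
    ultimately consider "norm (y - c) = r3" | "norm (y - c) = r1" by (auto simp: dist_norm norm_minus_commute)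
    thus "norm (h y) \<le> A / r1 ^ p"
    proof cases
      case 1
      have "norm (f y) \<le> B" by (rule outer) (use 1 in \<open>simp add: dist_norm norm_minus_commute\<close>)
      hence "norm (h y) \<le> B / r3 ^ p"
        using 1 r by (simp add: h_def norm_divide norm_power divide_right_mono)
      also have "B / A \<le> (r3 / r1) ^ p"
      proof -
        have "ln (B / A) \<le> real p * ln (r3 / r1)" using p(1) l31 by (simp add: field_simps)
        hence "exp (ln (B / A)) \<le> exp (real p * ln (r3 / r1))" by simp
        also have "\<dots> = (r3 / r1) ^ p" using r by (simp add: exp_of_nat_mult)
        finally show ?thesis using AB by simp
      qed
      hence "B / r3 ^ p \<le> A / r1 ^ p" using r AB by (simp add: field_simps power_divide)
      finally show ?thesis .
    next
      case 2
      have "norm (f y) \<le> A" by (rule inner) (use 2 in \<open>simp add: dist_norm norm_minus_commute\<close>)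
      thus ?thesis using 2 r by (simp add: h_def norm_divide norm_power divide_right_mono)
    qed
  qed
  moreover have zc: "norm (z - c) \<ge> r1" "norm (z - c) \<le> r2"
    using False z by (auto simp: dist_norm norm_minus_commute)
  moreover from zc r have "norm (z - c) ^ p > 0" by (intro zero_less_power) auto
  ultimately have "norm (f z) \<le> A / r1 ^ p * norm (z - c) ^ p"
    by (simp add: h_def norm_divide norm_power pos_divide_le_eq)
  also have "\<dots> \<le> A / r1 ^ p * r2 ^ p"
    using zc r AB by (intro mult_left_mono power_mono) auto
  also have "\<dots> = A * (r2 / r1) powr real p"
    using r by (simp add: powr_realpow power_divide)
  also have "\<dots> \<le> A * (r2 / r1) powr (ln (B / A) / ln (r3 / r1) + 1)"
    using p r AB by (intro mult_left_mono powr_mono) auto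
  also have "(r2 / r1) powr (ln (B / A) / ln (r3 / r1) + 1) = (r2 / r1) * (B / A) powr (ln (r2 / r1) / ln (r3 / r1))"
  proof -
    have "(r2 / r1) powr (ln (B / A) / ln (r3 / r1)) = (B / A) powr (ln (r2 / r1) / ln (r3 / r1))"
      using r AB by (simp add: powr_def mult.commute)
    thus ?thesis using r by (simp add: powr_add)
  qed
  finally show ?thesis by (simp add: mult_ac)
qed

section \<open>Growth of \<open>\<zeta>\<close> under the Riemann Hypothesis\<close>

lemma riemann_zeta_polynomial_bound:
  assumes N: "N \<ge> 2"
  shows "\<exists>C\<ge>1. \<forall>s. Re s \<ge> 2 - real N \<and> norm (s - 1) \<ge> 1 \<longrightarrow> norm (riemann_zeta s) \<le> C * (1 + norm s) ^ N"
proof -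
  obtain C where C: "C > 0" "\<And>s. Re s \<ge> 1 - real N + 1 \<Longrightarrow> norm (zeta_entire s) \<le> C * (1 + norm s) ^ (N + 1)"
    using zeta_entire_polynomial_bound[of N 1] N by auto
  have "norm (riemann_zeta s) \<le> (3 * C + 1) * (1 + norm s) ^ N" if s: "Re s \<ge> 2 - real N" "norm (s - 1) \<ge> 1" for s
  proof -
    have "s \<noteq> 1" using s by auto
    hence "norm (riemann_zeta s) = norm (zeta_entire s) / norm (s - 1)"
      by (simp add: riemann_zeta_conv_zeta_entire norm_divide)
    also have "\<dots> \<le> C * (1 + norm s) ^ (N + 1) / norm (s - 1)"
      using s by (intro divide_right_mono C) auto
    also have "\<dots> = C * (1 + norm s) ^ N * ((1 + norm s) / norm (s - 1))" by simp
    also have "(1 + norm s) / norm (s - 1) \<le> 3"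
    proof -
      have "norm s \<le> norm (s - 1) + 1" using norm_triangle_sub[of s 1] by simp
      hence "1 + norm s \<le> 3 * norm (s - 1)" using s(2) by linarith
      thus ?thesis using s(2) by (subst pos_divide_le_eq) auto
    qed
    hence "C * (1 + norm s) ^ N * ((1 + norm s) / norm (s - 1)) \<le> C * (1 + norm s) ^ N * 3"
      using C by (intro mult_left_mono) auto
    also have "\<dots> \<le> (3 * C + 1) * (1 + norm s) ^ N" by (simp add: algebra_simps)
    finally show ?thesis .
  qed
  moreover have "3 * C + 1 \<ge> 1" using C by simp
  ultimately show ?thesis by blast
qed

lemma riemann_zeta_Re_gt_1_bounds:
  assumes c: "c > 1"
  shows "\<exists>B\<ge>1. \<forall>s. Re s \<ge> c \<longrightarrow> norm (riemann_zeta s) \<le> B \<and> norm (1 / riemann_zeta s) \<le> B"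
proof (intro exI conjI allI impI)
  let ?B = "max 1 (norm (riemann_zeta (of_real c)))"
  show "?B \<ge> 1" by simp
  fix s :: complex assume s: "Re s \<ge> c"
  show "norm (riemann_zeta s) \<le> ?B" "norm (1 / riemann_zeta s) \<le> ?B"
    using norm_riemann_zeta_le[OF c s] norm_inverse_riemann_zeta_le[OF c s] by (auto simp: le_max_iff_disj)
qed

lemma norm_Ln_le:
  assumes "w \<noteq> 0" "norm w \<le> B" "norm (1 / w) \<le> B" "B \<ge> 1"
  shows "norm (Ln w) \<le> ln B + pi"
proof -
  have "\<bar>Re (Ln w)\<bar> \<le> ln B"
  proof -
    have p: "norm w > 0" using assms by simp
    have "ln (norm w) \<le> ln B" using assms p by simp
    moreover have "ln (norm (1 / w)) \<le> ln B" using assms p by (subst ln_le_cancel_iff) auto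
    hence "- ln (norm w) \<le> ln B" using p by (simp add: norm_divide ln_div)
    ultimately show ?thesis using assms by (simp add: abs_le_iff)
  qed
  moreover have "\<bar>Im (Ln w)\<bar> \<le> pi" using Im_Ln_le_pi[of w] mpi_less_Im_Ln[of w] assms by (auto simp: abs_le_iff)
  ultimately show ?thesis using cmod_le[of "Ln w"] by linarith
qed

lemma le_of_divide_less:
  fixes a b e :: real
  assumes "a / b < e" "b > 0" shows "a \<le> e * b"
  using assms by (simp add: pos_divide_less_eq)

text \<open>Littlewood's argument on discs centred at \<open>2 + i t\<close>. Under the hypothesis \<open>\<zeta>\<close> has a holomorphic logarithm \<open>g\<close> on a
  disc reaching almost to \<open>Re s = 1/2\<close>. Borel-Caratheodory bounds \<open>g\<close> by a constant \<open>A\<close> on a disc inside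
  \<open>Re s > 1\<close>, and by \<open>B t\<close>, which is linear in \<open>ln t\<close>, on a disc almost as large as the whole one. The
  three circles theorem in between gives \<open>O((ln t) powr \<theta>)\<close> with \<open>\<theta> < 1\<close>, which is below \<open>\<epsilon> ln t\<close> for
  large \<open>t\<close>. Bounds on \<open>Re g\<close> from both sides bound \<open>\<zeta>\<close> and \<open>1 / \<zeta>\<close>.\<close>

lemma rh_zeta_log_bound:
  assumes rh: riemann_hypothesis and \<delta>: "0 < \<delta>" "\<delta> \<le> 1 / 8" and \<epsilon>: "\<epsilon> > 0"
  shows "\<exists>T\<ge>10. \<forall>s. 1 / 2 + 2 * \<delta> \<le> Re s \<and> Re s \<le> 2 \<and> \<bar>Im s\<bar> \<ge> T \<longrightarrow>
           norm (riemann_zeta s) \<le> \<bar>Im s\<bar> powr \<epsilon> \<and> norm (1 / riemann_zeta s) \<le> \<bar>Im s\<bar> powr \<epsilon>"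
proof -
  obtain B1 where B1: "B1 \<ge> 1" "\<And>s. Re s \<ge> 1 + \<delta> / 2 \<Longrightarrow> norm (riemann_zeta s) \<le> B1"
    "\<And>s. Re s \<ge> 1 + \<delta> / 2 \<Longrightarrow> norm (1 / riemann_zeta s) \<le> B1"
    using riemann_zeta_Re_gt_1_bounds[of "1 + \<delta> / 2"] \<delta> by auto
  obtain C where C: "C \<ge> 1" "\<And>s. Re s \<ge> 0 \<Longrightarrow> norm (s - 1) \<ge> 1 \<Longrightarrow> norm (riemann_zeta s) \<le> C * (1 + norm s) ^ 2"
    using riemann_zeta_polynomial_bound[of 2] by auto
  define r1 r2 r3 R4 where "r1 = 1 - \<delta>" and "r2 = 3 / 2 - 2 * \<delta>" and "r3 = 3 / 2 - \<delta>" and "R4 = 3 / 2 - \<delta> / 2"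
  note rd = r1_def r2_def r3_def R4_def
  have r: "0 < r1" "r1 \<le> r2" "r2 < r3" "r1 < r3" "r3 < R4" "R4 < 2" using \<delta> by (auto simp: rd)
  define M1 G where "M1 = ln B1 + 1" and "G = ln B1 + pi"
  have M1: "M1 > 0" and G: "G > 0" using B1(1) pi_gt_zero by (auto simp: M1_def G_def add_nonneg_pos)
  define A where "A = 2 * (M1 + G) * r1 / (1 - \<delta> / 2 - r1) + G"
  have dr: "1 - \<delta> / 2 - r1 > 0" using \<delta> by (simp add: r1_def)
  have A: "A > 0" unfolding A_def using M1 G r dr by (intro add_pos_pos divide_pos_pos mult_pos_pos) auto
  \<comment> \<open>The Borel-Caratheodory bound on the large disc, enlarged by \<open>A\<close> so that it dominates the bound on the small disc.\<close>
  define k1 where "k1 = 2 * r3 / (R4 - r3)"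
  have k1: "k1 > 0" unfolding k1_def using r by (intro divide_pos_pos) auto
  define B where "B = (\<lambda>t::real. k1 * (2 * ln t + (ln (4 * C) + 1 + G)) + G + A)"
  define \<theta> where "\<theta> = ln (r2 / r1) / ln (r3 / r1)"
  have \<theta>: "\<theta> < 1" unfolding \<theta>_def using r by (subst divide_less_eq_1_pos) (auto intro: divide_strict_right_mono)
  have \<theta>0: "\<theta> \<ge> 0" unfolding \<theta>_def using r by (intro divide_nonneg_nonneg) auto
  have "((\<lambda>t. (r2 / r1) * A * (B t / A) powr \<theta> / ln t) \<longlongrightarrow> 0) at_top"
  proof -
    have "((\<lambda>t. (r2 / r1) * A * ((k1 * (2 * ln t + (ln (4 * C) + 1 + G)) + G + A) / A) powr \<theta> / ln t) \<longlongrightarrow> 0) at_top"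
      using \<theta> \<theta>0 k1 A r by real_asymp
    thus ?thesis by (simp add: B_def)
  qed
  hence "\<forall>\<^sub>F t in at_top. (r2 / r1) * A * (B t / A) powr \<theta> / ln t < \<epsilon>"
    using \<epsilon> by (rule order_tendstoD)
  then obtain T0 where T0: "\<And>t. t \<ge> T0 \<Longrightarrow> (r2 / r1) * A * (B t / A) powr \<theta> / ln t < \<epsilon>"
    unfolding eventually_at_top_linorder by blast
  define T where "T = max 10 T0"
  have "norm (riemann_zeta s) \<le> \<bar>Im s\<bar> powr \<epsilon> \<and> norm (1 / riemann_zeta s) \<le> \<bar>Im s\<bar> powr \<epsilon>"
    if s: "1 / 2 + 2 * \<delta> \<le> Re s" "Re s \<le> 2" "\<bar>Im s\<bar> \<ge> T" for s
  proof -
    define t where "t = \<bar>Im s\<bar>"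
    have t: "t \<ge> 10" "t \<ge> T0" using s by (auto simp: T_def t_def)
    define c where "c = Complex 2 (Im s)"
    have ball: "Re z > 2 - q" "norm (z - 1) \<ge> 1" "norm z \<le> t + 4" if "z \<in> ball c q" "q \<le> 2" for z q
    proof -
      have d: "norm (z - c) < q" using that by (simp add: dist_norm norm_minus_commute)
      show "Re z > 2 - q" using d abs_Re_le_cmod[of "z - c"] by (simp add: c_def)
      have "\<bar>Im z - Im s\<bar> < 2" using d abs_Im_le_cmod[of "z - c"] that by (simp add: c_def)
      hence "\<bar>Im (z - 1)\<bar> \<ge> 1" using t by (simp add: t_def)
      thus "norm (z - 1) \<ge> 1" using abs_Im_le_cmod[of "z - 1"] by linarith
      have "norm c \<le> 2 + t" using cmod_le[of c] by (simp add: c_def t_def)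
      thus "norm z \<le> t + 4" using norm_triangle_sub[of z c] d that by linarith
    qed
    have nz: "riemann_zeta z \<noteq> 0" "z \<noteq> 1" if "z \<in> ball c R4" for z
    proof -
      from ball[OF that] r have z: "Re z > 1 / 2" "norm (z - 1) \<ge> 1" using \<delta> by (auto simp: R4_def)
      thus z1: "z \<noteq> 1" by auto
      show "riemann_zeta z \<noteq> 0"
        using zeta_entire_nonzero[OF rh z(1)] z1 by (simp add: riemann_zeta_conv_zeta_entire)
    qed
    have hol: "riemann_zeta holomorphic_on ball c R4"
      by (rule riemann_zeta_holomorphic) (use nz(2) in blast)
    obtain g0 where g0: "g0 holomorphic_on ball c R4" "\<And>z. z \<in> ball c R4 \<Longrightarrow> riemann_zeta z = exp (g0 z)"
      using contractible_imp_holomorphic_log[OF hol] nz(1) convex_imp_contractible[OF convex_ball] by metis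
    have cc: "c \<in> ball c R4" using r by simp
    \<comment> \<open>Normalised to the principal logarithm at the centre, so that \<open>norm (g c)\<close> has a bound not depending on \<open>t\<close>.\<close>
    define g where "g = (\<lambda>z. g0 z - g0 c + Ln (riemann_zeta c))"
    have g: "g holomorphic_on ball c R4" unfolding g_def by (intro holomorphic_intros g0)
    have expg: "exp (g z) = riemann_zeta z" if "z \<in> ball c R4" for z
      using g0(2)[OF that] g0(2)[OF cc] nz(1)[OF cc] by (simp add: g_def exp_add exp_diff)
    have Reg: "Re (g z) = ln (norm (riemann_zeta z))" if "z \<in> ball c R4" for z
      using expg[OF that] by (metis ln_exp norm_exp_eq_Re)
    have gc: "norm (g c) \<le> G"
      unfolding g_def G_def using nz(1)[OF cc] B1 \<delta>
      by (simp add: norm_Ln_le c_def)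
    have inner: "norm (g z) \<le> A" if z: "z \<in> cball c r1" for z
    proof -
      have "norm (g z) \<le> 2 * (M1 + norm (g c)) * r1 / (1 - \<delta> / 2 - r1) + norm (g c)"
      proof (rule borel_caratheodory[OF _ M1 _ _ _ z])
        show "g holomorphic_on ball c (1 - \<delta> / 2)"
          by (rule holomorphic_on_subset[OF g]) (use \<delta> in \<open>auto simp: R4_def\<close>)
        fix y assume y: "y \<in> ball c (1 - \<delta> / 2)"
        hence y': "y \<in> ball c R4" using \<delta> by (auto simp: R4_def)
        have "norm (riemann_zeta y) \<le> B1" using ball(1)[OF y] \<delta> by (intro B1) auto
        moreover have "norm (riemann_zeta y) > 0" using nz(1)[OF y'] by simp
        ultimately have "ln (norm (riemann_zeta y)) \<le> ln B1" using B1(1) by (subst ln_le_cancel_iff) auto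
        thus "Re (g y) < M1" unfolding Reg[OF y'] by (simp add: M1_def)
      qed (use r dr in auto)
      also have "\<dots> \<le> A" unfolding A_def using gc r dr
        by (intro add_mono divide_right_mono mult_right_mono mult_left_mono) auto
      finally show ?thesis .
    qed
    have outer: "norm (g z) \<le> B t" if z: "z \<in> cball c r3" for z
    proof -
      define M2 where "M2 = 2 * ln t + (ln (4 * C) + 1)"
      have lt: "ln t > 0" "ln (4 * C) > 0" using t C by auto
      have M2: "M2 > 0" unfolding M2_def using lt by auto
      have "norm (g z) \<le> 2 * (M2 + norm (g c)) * r3 / (R4 - r3) + norm (g c)"
      proof (rule borel_caratheodory[OF g M2 _ _ _ z])
        fix y assume y: "y \<in> ball c R4"
        have "norm (riemann_zeta y) \<le> C * (1 + norm y) ^ 2" using ball[OF y] r by (intro C) auto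
        also have "\<dots> \<le> C * (2 * t) ^ 2"
          using ball(3)[OF y] r t C by (intro mult_left_mono power_mono) auto
        also have "\<dots> = (4 * C) * t ^ 2" by (simp add: power2_eq_square)
        finally have "ln (norm (riemann_zeta y)) \<le> ln ((4 * C) * t ^ 2)"
          using nz(1)[OF y] by (subst ln_le_cancel_iff) (use t C in auto)
        also have "\<dots> = ln (4 * C) + 2 * ln t" using t C by (subst ln_mult) (auto simp: ln_realpow)
        finally show "Re (g y) < M2" unfolding Reg[OF y] by (simp add: M2_def)
      qed (use r in auto)
      also have "\<dots> \<le> 2 * (M2 + G) * r3 / (R4 - r3) + G" using gc r
        by (intro add_mono divide_right_mono mult_right_mono mult_left_mono) auto
      also have "\<dots> \<le> B t" using A by (simp add: B_def M2_def k1_def algebra_simps add_divide_distrib)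
      finally show ?thesis .
    qed
    have AB: "A \<le> B t" unfolding B_def using t C G k1
      by (intro add_increasing add_nonneg_nonneg mult_nonneg_nonneg) auto
    have "norm (g s) \<le> (r2 / r1) * A * (B t / A) powr \<theta>"
      unfolding \<theta>_def
    proof (rule three_circles[OF g _ _ _ _ _ A AB inner outer])
      show "s \<in> cball c r2"
      proof -
        have "c - s = of_real (2 - Re s)" by (simp add: c_def complex_eq_iff)
        hence "norm (c - s) = 2 - Re s" using s by (simp only: norm_of_real)
        thus ?thesis using s by (simp add: dist_norm r2_def)
      qed
    qed (use r in auto)
    also have "\<dots> \<le> \<epsilon> * ln t"
    proof -
      have "ln t > 0" using t by simp
      with T0[OF t(2)] show ?thesis by (rule le_of_divide_less)
    qed
    finally have gs: "\<bar>Re (g s)\<bar> \<le> \<epsilon> * ln t" using abs_Re_le_cmod[of "g s"] by linarith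
    have sb: "s \<in> ball c R4"
    proof -
      have "c - s = of_real (2 - Re s)" by (simp add: c_def complex_eq_iff)
      hence "norm (c - s) = 2 - Re s" using s by (simp only: norm_of_real)
      thus ?thesis using s \<delta> by (simp add: dist_norm R4_def)
    qed
    have n: "norm (riemann_zeta s) = exp (Re (g s))" using expg[OF sb] by (metis norm_exp_eq_Re)
    have tp: "t powr \<epsilon> = exp (\<epsilon> * ln t)" using t by (simp add: powr_def)
    have "norm (riemann_zeta s) \<le> t powr \<epsilon>" unfolding n tp using gs by simp
    moreover have "norm (1 / riemann_zeta s) \<le> t powr \<epsilon>"
      unfolding norm_divide norm_one n tp using gs by (simp add: divide_inverse flip: exp_minus)
    ultimately show ?thesis by (simp add: t_def)
  qed
  moreover have "T \<ge> 10" by (simp add: T_def)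
  ultimately show ?thesis by blast
qed

lemma rh_zeta_bound:
  assumes rh: riemann_hypothesis and c: "c > 1 / 2" and \<epsilon>: "\<epsilon> > 0"
  shows "\<exists>T\<ge>10. \<forall>s. c \<le> Re s \<and> \<bar>Im s\<bar> \<ge> T \<longrightarrow>
           norm (riemann_zeta s) \<le> \<bar>Im s\<bar> powr \<epsilon> \<and> norm (1 / riemann_zeta s) \<le> \<bar>Im s\<bar> powr \<epsilon>"
proof -
  define \<delta> where "\<delta> = min ((c - 1 / 2) / 2) (1 / 8)"
  have \<delta>: "0 < \<delta>" "\<delta> \<le> 1 / 8" "1 / 2 + 2 * \<delta> \<le> c" using c by (auto simp: \<delta>_def min_def field_simps)
  obtain T1 where T1: "T1 \<ge> 10" "\<And>s. 1 / 2 + 2 * \<delta> \<le> Re s \<Longrightarrow> Re s \<le> 2 \<Longrightarrow> \<bar>Im s\<bar> \<ge> T1 \<Longrightarrow>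
           norm (riemann_zeta s) \<le> \<bar>Im s\<bar> powr \<epsilon> \<and> norm (1 / riemann_zeta s) \<le> \<bar>Im s\<bar> powr \<epsilon>"
    using rh_zeta_log_bound[OF rh \<delta>(1,2) \<epsilon>] by auto
  obtain B where B: "B \<ge> 1" "\<And>s. Re s \<ge> 2 \<Longrightarrow> norm (riemann_zeta s) \<le> B \<and> norm (1 / riemann_zeta s) \<le> B"
    using riemann_zeta_Re_gt_1_bounds[of 2] by auto
  have "filterlim (\<lambda>t::real. t powr \<epsilon>) at_top at_top" using \<epsilon> by real_asymp
  then obtain T2 where T2: "\<And>t. t \<ge> T2 \<Longrightarrow> B \<le> t powr \<epsilon>"
    unfolding filterlim_at_top eventually_at_top_linorder by blast
  show ?thesis
  proof (intro exI[of _ "max T1 T2"] conjI allI impI; (elim conjE)?)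
    show "max T1 T2 \<ge> 10" using T1 by simp
    fix s :: complex assume s: "c \<le> Re s" "\<bar>Im s\<bar> \<ge> max T1 T2"
    have "norm (riemann_zeta s) \<le> \<bar>Im s\<bar> powr \<epsilon> \<and> norm (1 / riemann_zeta s) \<le> \<bar>Im s\<bar> powr \<epsilon>"
    proof (cases "Re s \<le> 2")
      case True thus ?thesis using s \<delta> by (intro T1) auto
    next
      case False
      hence "norm (riemann_zeta s) \<le> B \<and> norm (1 / riemann_zeta s) \<le> B" by (intro B) auto
      moreover have "B \<le> \<bar>Im s\<bar> powr \<epsilon>" using s by (intro T2) auto
      ultimately show ?thesis by linarith
    qed
    thus "norm (riemann_zeta s) \<le> \<bar>Im s\<bar> powr \<epsilon>" "norm (1 / riemann_zeta s) \<le> \<bar>Im s\<bar> powr \<epsilon>" by auto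
  qed
qed

text \<open>Numerical input for \<open>rh_zeta_convexity_bound\<close>, where the radii are \<open>L - 1/2 - \<delta>\<close>, \<open>L - \<sigma>\<close> and \<open>L + N - 2\<close>. When
  the centre moves to infinity, circles become lines: for \<open>L \<rightarrow> \<infinity>\<close> the quotient of logarithms tends to
  \<open>(1/2 + \<delta> - \<sigma>) / (N - 3/2 + \<delta>)\<close>, and \<open>N\<close> times this tends to \<open>1/2 + \<delta> - \<sigma>\<close> for \<open>N \<rightarrow> \<infinity>\<close>.\<close>

lemma convexity_exponents:
  fixes \<sigma> \<theta> :: real
  assumes "\<sigma> < 1 / 2" "\<theta> > 1 / 2 - \<sigma>"
  shows "\<exists>N L \<delta> \<epsilon>. N \<ge> 2 \<and> \<delta> > 0 \<and> \<epsilon> > 0 \<and> L - 1 / 2 - \<delta> > 0 \<and> L \<ge> 2 \<and> 1 / 2 + \<delta> > \<sigma> \<and> \<sigma> > 2 - real N \<and>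
     real N * (ln ((L - \<sigma>) / (L - 1 / 2 - \<delta>)) / ln ((L + real N - 2) / (L - 1 / 2 - \<delta>))) + \<epsilon> < \<theta>"
proof -
  define \<kappa> \<delta> where "\<kappa> = 1 / 2 - \<sigma>" and "\<delta> = (\<theta> - \<kappa>) / 4"
  have k: "\<kappa> > 0" and d: "\<delta> > 0" using assms by (auto simp: \<kappa>_def \<delta>_def)
  have "((\<lambda>N::nat. real N * ((\<kappa> + \<delta>) / (real N - 3 / 2 + \<delta>))) \<longlongrightarrow> \<kappa> + \<delta>) sequentially"
    using k d by real_asymp
  hence "\<forall>\<^sub>F N in sequentially. real N * ((\<kappa> + \<delta>) / (real N - 3 / 2 + \<delta>)) < \<kappa> + 2 * \<delta>"
    using d by (intro order_tendstoD) auto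
  moreover have "\<forall>\<^sub>F N in sequentially. real N > 2 - \<sigma>" by real_asymp
  ultimately have "\<forall>\<^sub>F N in sequentially. real N * ((\<kappa> + \<delta>) / (real N - 3 / 2 + \<delta>)) < \<kappa> + 2 * \<delta> \<and> real N > 2 - \<sigma> \<and> N \<ge> 2"
    using eventually_ge_at_top[of 2] by eventually_elim auto
  then obtain N where N: "real N * ((\<kappa> + \<delta>) / (real N - 3 / 2 + \<delta>)) < \<kappa> + 2 * \<delta>" "real N > 2 - \<sigma>" "N \<ge> 2"
    using eventually_happens' sequentially_bot by blast
  define n where "n = real N"
  have n: "n \<ge> 2" using N by (simp add: n_def)
  let ?q = "\<lambda>L. ln ((L - \<sigma>) / (L - 1 / 2 - \<delta>)) / ln ((L + n - 2) / (L - 1 / 2 - \<delta>))"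
  have "((\<lambda>L. ?q L) \<longlongrightarrow> (\<kappa> + \<delta>) / (n - 3 / 2 + \<delta>)) at_top"
  proof -
    have 1: "\<kappa> + \<delta> = 1 / 2 + \<delta> - \<sigma>" by (simp add: \<kappa>_def)
    have 2: "1 / 2 + \<delta> - \<sigma> > 0" "n - 3 / 2 + \<delta> > 0" using k d n by (auto simp: \<kappa>_def)
    let ?l = "\<lambda>x L. L * ln ((L - x) / (L - 1 / 2 - \<delta>))"
    \<comment> \<open>Numerator and denominator are multiplied by \<open>L\<close> so that both converge to nonzero limits.\<close>
    have l: "(?l x \<longlongrightarrow> 1 / 2 + \<delta> - x) at_top" for x
      by real_asymp
    have "((\<lambda>L. ?l \<sigma> L / ?l (2 - n) L) \<longlongrightarrow>
        (1 / 2 + \<delta> - \<sigma>) / (1 / 2 + \<delta> - (2 - n))) at_top"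
      by (intro tendsto_divide l) (use 2 in auto)
    moreover have "1 / 2 + \<delta> - (2 - n) = n - 3 / 2 + \<delta>" by simp
    ultimately have "((\<lambda>L. ?l \<sigma> L / ?l (2 - n) L) \<longlongrightarrow>
        (\<kappa> + \<delta>) / (n - 3 / 2 + \<delta>)) at_top" unfolding 1 by simp
    thus ?thesis
    proof (rule Lim_transform_eventually)
      show "\<forall>\<^sub>F L in at_top. ?l \<sigma> L / ?l (2 - n) L
          = ?q L"
        using eventually_gt_at_top[of 0] by eventually_elim (simp add: algebra_simps)
    qed
  qed
  hence "((\<lambda>L. n * ?q L) \<longlongrightarrow> n * ((\<kappa> + \<delta>) / (n - 3 / 2 + \<delta>))) at_top"
    by (rule tendsto_mult_left)
  moreover have "n * ((\<kappa> + \<delta>) / (n - 3 / 2 + \<delta>)) < \<kappa> + 2 * \<delta>" using N by (simp add: n_def)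
  ultimately have "\<forall>\<^sub>F L in at_top. n * ?q L < \<kappa> + 2 * \<delta>"
    by (rule order_tendstoD)
  hence "\<forall>\<^sub>F L in at_top. n * ?q L < \<kappa> + 2 * \<delta>
      \<and> L > 1 / 2 + \<delta> \<and> L \<ge> 2"
    using eventually_gt_at_top[of "1 / 2 + \<delta>"] eventually_ge_at_top[of 2] by eventually_elim auto
  then obtain L where L: "n * ?q L < \<kappa> + 2 * \<delta>"
      "L > 1 / 2 + \<delta>" "L \<ge> 2"
    using eventually_happens' trivial_limit_at_top_linorder by blast
  have "real N * (ln ((L - \<sigma>) / (L - 1 / 2 - \<delta>)) / ln ((L + real N - 2) / (L - 1 / 2 - \<delta>))) + \<delta> < \<theta>"
  proof -
    have "\<kappa> + 3 * \<delta> < \<theta>" using d assms by (simp add: \<delta>_def \<kappa>_def field_simps)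
    with L(1) show ?thesis by (simp add: n_def)
  qed
  thus ?thesis using N L d k by (intro exI[of _ N] exI[of _ L] exI[of _ \<delta>]) (auto simp: \<kappa>_def)
qed

text \<open>Three circles centred at \<open>L + i t\<close>: the inner disc lies in \<open>Re s \<ge> 1/2 + \<delta>\<close>, where \<open>\<zeta>\<close> is
  \<open>O(t powr \<epsilon>)\<close>, and the outer one in \<open>Re s \<ge> 2 - N\<close>, where it is \<open>O(t ^ N)\<close>. For \<open>N\<close> and \<open>L\<close> large the
  interpolated exponent approaches \<open>1/2 - \<sigma>\<close>, the value that the functional equation would give.\<close>

lemma rh_zeta_convexity_bound:
  assumes rh: riemann_hypothesis and \<sigma>: "\<sigma> < 1 / 2" and \<theta>: "\<theta> > 1 / 2 - \<sigma>"
  shows "\<exists>T\<ge>10. \<forall>s. \<sigma> \<le> Re s \<and> \<bar>Im s\<bar> \<ge> T \<longrightarrow> norm (riemann_zeta s) \<le> \<bar>Im s\<bar> powr \<theta>"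
proof -
  obtain N L \<delta> \<epsilon> where p: "N \<ge> 2" "\<delta> > 0" "\<epsilon> > 0" "L - 1 / 2 - \<delta> > 0" "L \<ge> 2" "1 / 2 + \<delta> > \<sigma>" "\<sigma> > 2 - real N"
    "real N * (ln ((L - \<sigma>) / (L - 1 / 2 - \<delta>)) / ln ((L + real N - 2) / (L - 1 / 2 - \<delta>))) + \<epsilon> < \<theta>"
    using convexity_exponents[OF \<sigma> \<theta>] by blast
  define r1 r2 r3 where "r1 = L - 1 / 2 - \<delta>" and "r2 = L - \<sigma>" and "r3 = L + real N - 2"
  note rd = r1_def r2_def r3_def
  have r: "0 < r1" "r1 < r2" "r2 < r3" using p by (auto simp: rd)
  define a where "a = ln (r2 / r1) / ln (r3 / r1)"
  have a: "a \<ge> 0" unfolding a_def using r by (intro divide_nonneg_nonneg) auto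
  have expo: "real N * a + \<epsilon> < \<theta>" using p(8) unfolding a_def rd by simp
  have N0: "real N * a \<ge> 0" using a by simp
  obtain T1 where T1: "T1 \<ge> 10" "\<And>s. 1 / 2 + \<delta> \<le> Re s \<Longrightarrow> \<bar>Im s\<bar> \<ge> T1 \<Longrightarrow> norm (riemann_zeta s) \<le> \<bar>Im s\<bar> powr \<epsilon>"
    using rh_zeta_bound[OF rh, of "1 / 2 + \<delta>" \<epsilon>] p by auto
  obtain C where C: "C \<ge> 1" "\<And>s. Re s \<ge> 2 - real N \<Longrightarrow> norm (s - 1) \<ge> 1 \<Longrightarrow> norm (riemann_zeta s) \<le> C * (1 + norm s) ^ N"
    using riemann_zeta_polynomial_bound[OF p(1)] by auto
  define A where "A = (\<lambda>t::real. (2 * t) powr \<epsilon>)"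
  \<comment> \<open>The factor \<open>A t\<close> in \<open>B t\<close> only serves to make \<open>A t \<le> B t\<close> evident; it cancels in the quotient.\<close>
  define B where "B = (\<lambda>t::real. C * (3 * t) ^ N * A t)"
  have "((\<lambda>t. r2 / r1 * (2 * t) powr \<epsilon> * (C * (3 * t) powr N) powr a / t powr \<theta>) \<longlongrightarrow> 0) at_top"
    using r C(1) p(3) a N0 expo by real_asymp
  hence "\<forall>\<^sub>F t in at_top. r2 / r1 * (2 * t) powr \<epsilon> * (C * (3 * t) powr N) powr a / t powr \<theta> < 1"
    by (rule order_tendstoD) simp
  then obtain T2 where T2: "\<And>t. t \<ge> T2 \<Longrightarrow> r2 / r1 * (2 * t) powr \<epsilon> * (C * (3 * t) powr N) powr a / t powr \<theta> < 1"
    unfolding eventually_at_top_linorder by blast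
  define T where "T = max (2 * T1) (max T2 (2 * (L + r3) + 4))"
  have T: "T \<ge> 2 * T1" "T \<ge> T2" "T \<ge> 2 * (L + r3) + 4" by (auto simp: T_def)
  have "norm (riemann_zeta s) \<le> \<bar>Im s\<bar> powr \<theta>" if s: "\<sigma> \<le> Re s" "\<bar>Im s\<bar> \<ge> T" for s
  proof (cases "Re s \<le> L")
    case False
    have "norm (riemann_zeta s) \<le> \<bar>Im s\<bar> powr \<epsilon>" using T s T1 False p by (intro T1) auto
    also have "\<dots> \<le> \<bar>Im s\<bar> powr \<theta>" using T s T1 expo N0 by (intro powr_mono) auto
    finally show ?thesis .
  next
    case True
    define t where "t = \<bar>Im s\<bar>"
    have t: "t \<ge> 2 * T1" "t \<ge> T2" "t \<ge> 2 * (L + r3) + 4" "t \<ge> 10" using s T T1 by (auto simp: t_def)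
    define c where "c = Complex L (Im s)"
    have ball: "Re z \<ge> L - q" "\<bar>Im z\<bar> \<ge> t - q" "norm (z - 1) \<ge> 1" "1 + norm z \<le> 3 * t" "\<bar>Im z\<bar> \<le> 2 * t"
      if "z \<in> cball c q" "q \<le> r3 + 1" for z q
    proof -
      have d: "norm (z - c) \<le> q" using that by (simp add: dist_norm norm_minus_commute)
      show "Re z \<ge> L - q" using d abs_Re_le_cmod[of "z - c"] by (simp add: c_def)
      have i: "\<bar>Im z - Im s\<bar> \<le> q" using d abs_Im_le_cmod[of "z - c"] that by (simp add: c_def)
      show i1: "\<bar>Im z\<bar> \<ge> t - q" using i by (simp add: t_def)
      show "\<bar>Im z\<bar> \<le> 2 * t" using i t that p r by (simp add: t_def)
      have "\<bar>Im (z - 1)\<bar> \<ge> 1" using i1 t that p r by simp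
      thus "norm (z - 1) \<ge> 1" using abs_Im_le_cmod[of "z - 1"] by linarith
      have "norm c \<le> L + t" using cmod_le[of c] p by (simp add: c_def t_def)
      moreover have "norm z \<le> norm c + norm (z - c)" by (rule norm_triangle_sub)
      ultimately have "norm z \<le> L + t + (r3 + 1)" using d that(2) by linarith
      moreover have "0 < L + r3" using p(5) r by linarith
      ultimately show "1 + norm z \<le> 3 * t" using t(3) by (simp add: algebra_simps)
    qed
    have hol: "riemann_zeta holomorphic_on ball c (r3 + 1)"
    proof (rule riemann_zeta_holomorphic)
      show "1 \<notin> ball c (r3 + 1)"
      proof
        assume "1 \<in> ball c (r3 + 1)"
        hence "(1::complex) \<in> cball c (r3 + 1)" by simp
        from ball(3)[OF this] show False by simp
      qed
    qed
    have A1: "A t \<ge> 1" unfolding A_def using t p by (intro ge_one_powr_ge_zero) auto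
    have AB: "A t \<le> B t"
    proof -
      have "1 * 1 * A t \<le> C * (3 * t) ^ N * A t" using C t A1 by (intro mult_mono one_le_power) auto
      thus ?thesis by (simp add: B_def)
    qed
    have "norm (riemann_zeta s) \<le> (r2 / r1) * A t * (B t / A t) powr (ln (r2 / r1) / ln (r3 / r1))"
    proof (rule three_circles[OF hol])
      fix z assume z: "z \<in> cball c r1"
      have "norm (riemann_zeta z) \<le> \<bar>Im z\<bar> powr \<epsilon>"
      proof (rule T1(2))
        have "r1 \<le> r3 + 1" using r by simp
        note b = ball[OF z this]
        show "1 / 2 + \<delta> \<le> Re z" using b(1) by (simp add: r1_def)
        have "r1 \<le> L" using p(2) by (simp add: r1_def)
        moreover have "0 < r3" using r by linarith
        ultimately show "T1 \<le> \<bar>Im z\<bar>" using b(2) t(1,3) unfolding distrib_left by linarith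
      qed
      also have "\<dots> \<le> A t" unfolding A_def using ball[OF z] r p by (intro powr_mono2) auto
      finally show "norm (riemann_zeta z) \<le> A t" .
    next
      fix z assume z: "z \<in> cball c r3"
      have "norm (riemann_zeta z) \<le> C * (1 + norm z) ^ N"
        using ball[OF z] by (intro C) (auto simp: r3_def)
      also have "\<dots> \<le> C * (3 * t) ^ N" using ball[OF z] C by (intro mult_left_mono power_mono) auto
      also have "\<dots> \<le> B t"
      proof -
        have "C * (3 * t) ^ N * 1 \<le> C * (3 * t) ^ N * A t" using C t A1 by (intro mult_left_mono) auto
        thus ?thesis by (simp add: B_def)
      qed
      finally show "norm (riemann_zeta z) \<le> B t" .
    next
      have "c - s = of_real (L - Re s)" by (simp add: c_def complex_eq_iff)
      hence "norm (c - s) = L - Re s" using True by (simp only: norm_of_real)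
      thus "s \<in> cball c r2" using s by (simp add: dist_norm r2_def)
    qed (use r AB A1 in auto)
    also have "B t / A t = C * (3 * t) powr N" using A1 t by (simp add: B_def powr_realpow)
    also have "ln (r2 / r1) / ln (r3 / r1) = a" by (simp add: a_def)
    finally have "norm (riemann_zeta s) \<le> r2 / r1 * (2 * t) powr \<epsilon> * (C * (3 * t) powr N) powr a" by (simp add: A_def)
    also have "\<dots> \<le> t powr \<theta>"
    proof -
      have "t powr \<theta> > 0" using t by simp
      from le_of_divide_less[OF T2[OF t(2)] this] show ?thesis by simp
    qed
    finally show ?thesis by (simp add: t_def)
  qed
  moreover have "T \<ge> 10" using T T1 by simp
  ultimately show ?thesis by blast
qed

section \<open>The correction factor of the Dirichlet series\<close>

definition sing_coeff :: "nat \<Rightarrow> real" where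
  "sing_coeff p = (if prime p \<and> p > 2 then 1 - 1 / (real p - 1)\<^sup>2 else 1)"

text \<open>Euler factor at \<open>p\<close> of \<open>F(s) \<zeta>(2 s + 2) / (\<zeta>(s) \<zeta>(s + 1))\<close> with \<open>F\<close> the Dirichlet series of the singular
  series. The constant \<open>2 twin_prime_const\<close> is distributed over the factors: \<open>sing_coeff p\<close> goes to \<open>p\<close>, the factor
  \<open>2\<close> and the restriction to even numbers to the prime \<open>2\<close>.\<close>

definition sing_factor :: "nat \<Rightarrow> complex \<Rightarrow> complex" where
  "sing_factor p s = (if p = 2 then 2 powr (1 - s) / (1 + 2 powr (- s - 1))
     else if prime p then of_real (sing_coeff p) * (1 + of_nat p powr (- s) / of_real (real p - 2)) / (1 + of_nat p powr (- s - 1))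
     else 1)"

definition sing_product :: "complex \<Rightarrow> complex" where
  "sing_product s = lim (\<lambda>N. \<Prod>p<N. sing_factor p s)"

lemma powr_quarter_le: "p \<ge> 2 \<Longrightarrow> real p powr (-1/4) \<le> 17 / 20"
proof -
  assume p: "p \<ge> 2"
  have "(real p powr (-1/4)) ^ 4 = real p powr (-1)"
    using p by (simp add: powr_powr flip: powr_numeral)
  also have "\<dots> = 1 / real p" using p by (simp add: powr_minus_divide)
  also have "\<dots> \<le> (17 / 20) ^ 4" using p by (simp add: field_simps)
  finally show ?thesis by (rule power_le_imp_le_base[of _ 3, simplified]) simp
qed

lemma sing_denominator:
  assumes "p \<ge> 2" "Re s \<ge> -3/4"
  shows "norm (1 + of_nat p powr (- s - 1) :: complex) \<ge> 3 / 20"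
proof -
  have "norm (of_nat p powr (- s - 1) :: complex) = real p powr (- Re s - 1)"
    using assms by (subst norm_nat_powr) auto
  also have "\<dots> \<le> real p powr (-1/4)"
  proof (rule powr_mono)
    show "- Re s - 1 \<le> -1/4" using assms(2) by (simp add: field_simps)
  qed (use assms in auto)
  also have "\<dots> \<le> 17 / 20" using assms by (intro powr_quarter_le)
  finally show ?thesis using norm_diff_ineq[of 1 "of_nat p powr (- s - 1) :: complex"] by simp
qed

lemma sing_coeff_bounds: "0 \<le> sing_coeff p" "sing_coeff p \<le> 1" "prime p \<Longrightarrow> p > 2 \<Longrightarrow> 1 - sing_coeff p \<le> 4 * real p powr (-5/4)"
proof -
  show "0 \<le> sing_coeff p"
  proof (cases "prime p \<and> p > 2")
    case True
    hence "1 \<le> (real p - 1)\<^sup>2" by (intro one_le_power) auto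
    thus ?thesis using True by (simp add: sing_coeff_def)
  qed (auto simp: sing_coeff_def)
  show "sing_coeff p \<le> 1" by (simp add: sing_coeff_def)
  assume p: "prime p" "p > 2"
  have "1 - sing_coeff p = 1 / (real p - 1)\<^sup>2" using p by (simp add: sing_coeff_def)
  also have "\<dots> \<le> 1 / (real p / 2)\<^sup>2"
    using p by (intro divide_left_mono power_mono mult_pos_pos zero_less_power) auto
  also have "\<dots> = 4 * real p powr (-2)" using p by (simp add: powr_minus powr_numeral field_simps)
  also have "\<dots> \<le> 4 * real p powr (-5/4)" using p by (intro mult_left_mono powr_mono) auto
  finally show "1 - sing_coeff p \<le> 4 * real p powr (-5/4)" .
qed

text \<open>Since \<open>1 / (p - 2) - 1 / p = 2 / (p (p - 2))\<close>, dividing \<open>1 + p powr (- s) / (p - 2)\<close> by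
  \<open>1 + p powr (- s - 1)\<close> leaves a deviation from \<open>1\<close> of order \<open>p powr (- Re s - 2)\<close>. On \<open>Re s \<ge> -3/4\<close> this is
  summable over \<open>p\<close>; the constant \<open>100\<close> is generous.\<close>

lemma sing_factor_bound:
  assumes s: "Re s \<ge> -3/4"
  shows "norm (sing_factor p s - 1) \<le> 100 * real p powr (-5/4)"
proof -
  consider "p = 2" | "prime p" "p > 2" | "p \<noteq> 2" "\<not> prime p" using prime_ge_2_nat[of p] by linarith
  thus ?thesis
  proof cases
    case 1
    have d: "norm (1 + 2 powr (- s - 1) :: complex) \<ge> 3 / 20" using sing_denominator[of 2 s] s by simp
    have "norm (2 powr (1 - s) :: complex) = 2 powr (1 - Re s)"
      using norm_nat_powr[of 2 "1 - s"] by simp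
    also have "\<dots> \<le> 2 powr 2" using s by (intro powr_mono) auto
    finally have n: "norm (2 powr (1 - s) :: complex) \<le> 4" by simp
    have "sing_factor p s = 2 powr (1 - s) / (1 + 2 powr (- s - 1))" using 1 by (simp add: sing_factor_def)
    hence "norm (sing_factor p s) \<le> 4 / (3 / 20)"
      by (simp only: norm_divide) (intro frac_le n d, auto)
    hence "norm (sing_factor p s - 1) \<le> 4 / (3 / 20) + 1"
      using norm_triangle_ineq4[of "sing_factor p s" 1] by simp
    also have "\<dots> \<le> 100 * (1 / 3)" by simp
    also have "(1 / 3 :: real) \<le> 2 powr (-5/4)"
    proof -
      have "(2::real) powr (5/4) \<le> 3"
      proof (rule power_le_imp_le_base[of _ 3])
        have "((2::real) powr (5/4)) ^ Suc 3 = 2 powr 5" by (simp add: powr_powr flip: powr_numeral)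
        also have "(2::real) powr 5 = 32" by simp
        finally show "((2::real) powr (5/4)) ^ Suc 3 \<le> 3 ^ Suc 3" by simp
      qed simp
      hence "1 / 3 \<le> 1 / (2::real) powr (5/4)" by (intro divide_left_mono) auto
      thus ?thesis by (simp add: powr_minus_divide)
    qed
    finally show ?thesis using 1 by simp
  next
    case 2
    define D where "D = 1 + of_nat p powr (- s - 1 :: complex)"
    define u where "u = of_nat p powr (-s) * of_real (2 / (real p * (real p - 2))) / D"
    have D: "norm D \<ge> 3 / 20" unfolding D_def using 2 s by (intro sing_denominator) auto
    hence D0: "D \<noteq> 0" by auto
    have pw: "of_nat p powr (- s - 1) = of_nat p powr (-s) / (of_nat p :: complex)"
      using 2 by (simp add: powr_diff)
    have "1 + of_nat p powr (-s) / of_real (real p - 2) = D * (1 + u)"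
    proof -
      have nz: "complex_of_real (real p - 2) \<noteq> 0" "(of_nat p :: complex) \<noteq> 0" using 2 by (simp_all only: of_real_eq_0_iff of_nat_eq_0_iff)
      have e: "complex_of_real (2 / (real p * (real p - 2))) = 1 / of_real (real p - 2) - 1 / of_nat p"
        using 2 nz by (simp add: field_simps)
      have "D * (1 + u) = D + of_nat p powr (-s) * of_real (2 / (real p * (real p - 2)))"
        unfolding u_def using D0 by (simp only: distrib_left mult_1_right times_divide_eq_right nonzero_mult_div_cancel_left not_False_eq_True)
      also have "\<dots> = 1 + of_nat p powr (-s) / of_real (real p - 2)"
        unfolding e D_def pw by (simp add: algebra_simps)
      finally show ?thesis by simp
    qed
    hence "sing_factor p s = of_real (sing_coeff p) * (1 + u)"
      using 2 D0 by (simp add: sing_factor_def D_def[symmetric])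
    hence "sing_factor p s - 1 = of_real (sing_coeff p) * u - of_real (1 - sing_coeff p)"
      by (simp add: algebra_simps)
    hence "norm (sing_factor p s - 1) \<le> norm (of_real (sing_coeff p) * u) + norm (complex_of_real (1 - sing_coeff p))"
      by (metis norm_triangle_ineq4)
    also have "norm (of_real (sing_coeff p) * u) \<le> 1 * norm u"
      unfolding norm_mult norm_of_real using sing_coeff_bounds[of p] by (intro mult_right_mono) auto
    also have "norm (complex_of_real (1 - sing_coeff p)) \<le> 4 * real p powr (-5/4)"
      unfolding norm_of_real using sing_coeff_bounds[of p] 2 by simp
    also have "norm u \<le> 40 * real p powr (-5/4)"
    proof -
      have "norm u = real p powr (- Re s) * (2 / (real p * (real p - 2))) / norm D"
        unfolding u_def norm_divide norm_mult norm_of_real using 2 by (simp add: norm_nat_powr)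
      also have "\<dots> \<le> real p powr (3/4) * (2 / (real p * (real p / 3))) / (3 / 20)"
        using 2 s D by (intro frac_le mult_mono powr_mono mult_pos_pos mult_nonneg_nonneg) auto
      also have "\<dots> = 40 * (real p powr (3/4) * real p powr (-2))"
        using 2 by (simp add: powr_minus powr_numeral field_simps power2_eq_square)
      also have "real p powr (3/4) * real p powr (-2) = real p powr (-5/4)"
        by (simp flip: powr_add)
      finally show ?thesis .
    qed
    finally show ?thesis using powr_ge_zero[of "real p" "-5/4"] by linarith
  next
    case 3 thus ?thesis by (simp add: sing_factor_def)
  qed
qed

lemma summable_sing_bound: "summable (\<lambda>p. 100 * real p powr (-5/4))"
  by (intro summable_mult) (simp add: summable_real_powr_iff)

lemma sing_factor_holomorphic: "sing_factor p holomorphic_on {s. Re s > -3/4}"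
proof (cases "prime p")
  case True
  hence "1 + of_nat p powr (- s - 1) \<noteq> (0::complex)" if "Re s > -3/4" for s
    using sing_denominator[of p s] that prime_ge_2_nat[of p] by auto
  thus ?thesis using True unfolding sing_factor_def
    by (cases "p = 2") (auto intro!: holomorphic_intros)
next
  case False
  hence "p \<noteq> 2" by auto
  thus ?thesis using False unfolding sing_factor_def by simp
qed

lemma sing_product_uniform_limit:
  assumes K: "compact K" "K \<subseteq> {s. Re s > -3/4}"
  shows "uniform_limit K (\<lambda>N s. \<Prod>p<N. sing_factor p s) sing_product sequentially"
proof -
  have "uniformly_convergent_on K (\<lambda>N s. \<Prod>p<N. sing_factor p s)"
  proof (rule uniformly_convergent_on_prod'[OF _ K(1)])
    show "continuous_on K (sing_factor n)" for n
      using K(2) holomorphic_on_imp_continuous_on[OF sing_factor_holomorphic] continuous_on_subset by blast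
    show "uniformly_convergent_on K (\<lambda>N x. \<Sum>n<N. norm (sing_factor n x - 1))"
      by (rule Weierstrass_m_test'[OF _ summable_sing_bound])
         (use K(2) sing_factor_bound in \<open>force intro: less_imp_le\<close>)
  qed
  thus ?thesis unfolding sing_product_def uniformly_convergent_uniform_limit_iff .
qed

lemma sing_product_tendsto:
  assumes "Re s > -3/4" shows "(\<lambda>N. \<Prod>p<N. sing_factor p s) \<longlonglongrightarrow> sing_product s"
  by (rule tendsto_uniform_limitI[OF sing_product_uniform_limit[of "{s}"]]) (use assms in auto)

lemma sing_product_holomorphic: "sing_product holomorphic_on {s. Re s > -3/4}"
proof (rule holomorphic_uniform_sequence)
  show "open {s. Re s > -3/4}" by (rule open_halfspace_Re_gt)
  show "(\<lambda>s. \<Prod>p<N. sing_factor p s) holomorphic_on {s. Re s > -3/4}" for N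
    by (intro holomorphic_on_prod sing_factor_holomorphic)
  fix x assume "x \<in> {s. Re s > -3/4}"
  then obtain d where "d > 0" "cball x d \<subseteq> {s. Re s > -3/4}"
    using open_halfspace_Re_gt[of "-3/4"] open_contains_cball by blast
  thus "\<exists>d>0. cball x d \<subseteq> {s. Re s > -3/4} \<and>
      uniform_limit (cball x d) (\<lambda>N s. \<Prod>p<N. sing_factor p s) sing_product sequentially"
    using sing_product_uniform_limit by auto
qed

lemma sing_product_bounded: "\<exists>C. \<forall>s. Re s > -3/4 \<longrightarrow> norm (sing_product s) \<le> C"
proof (intro exI allI impI)
  fix s :: complex assume s: "Re s > -3/4"
  have "norm (\<Prod>p<N. sing_factor p s) \<le> exp (\<Sum>p. 100 * real p powr (-5/4))" for N
  proof -
    have "norm (\<Prod>p<N. sing_factor p s) = (\<Prod>p<N. norm (sing_factor p s))" by (rule prod_norm[symmetric])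
    also have "\<dots> \<le> (\<Prod>p<N. exp (100 * real p powr (-5/4)))"
    proof (intro prod_mono conjI)
      fix p
      have "norm (sing_factor p s) \<le> 1 + norm (sing_factor p s - 1)"
        using norm_triangle_sub[of "sing_factor p s" 1] by simp
      also have "\<dots> \<le> 1 + 100 * real p powr (-5/4)" using sing_factor_bound[of s p] s by simp
      also have "\<dots> \<le> exp (100 * real p powr (-5/4))" by (rule exp_ge_add_one_self)
      finally show "norm (sing_factor p s) \<le> exp (100 * real p powr (-5/4))" .
    qed auto
    also have "\<dots> = exp (\<Sum>p<N. 100 * real p powr (-5/4))" by (simp add: exp_sum)
    also have "\<dots> \<le> exp (\<Sum>p. 100 * real p powr (-5/4))"
      by (simp only: exp_le_cancel_iff) (intro sum_le_suminf summable_sing_bound, auto)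
    finally show ?thesis .
  qed
  thus "norm (sing_product s) \<le> exp (\<Sum>p. 100 * real p powr (-5/4))"
    by (intro LIMSEQ_le_const2[OF tendsto_norm[OF sing_product_tendsto[OF s]]]) auto
qed

lemma prod_sing_factor_primes_upto: "(\<Prod>p<Suc n. sing_factor p s) = (\<Prod>p\<in>primes_upto n. sing_factor p s)"
  by (rule prod.mono_neutral_right) (auto simp: primes_upto_def sing_factor_def)

lemma sing_product_tendsto':
  assumes "Re s > -3/4" shows "(\<lambda>n. \<Prod>p\<in>primes_upto n. sing_factor p s) \<longlonglongrightarrow> sing_product s"
  using LIMSEQ_Suc[OF sing_product_tendsto[OF assms]] by (simp only: prod_sing_factor_primes_upto)

text \<open>Euler factor of \<open>F(s) / (\<zeta>(s) \<zeta>(s + 1))\<close>, whose product converges only for \<open>Re s > -1/2\<close>. It is these factors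
  that are \<open>1\<close> to second order at \<open>s = 0\<close>.\<close>

definition sing_factor' :: "nat \<Rightarrow> complex \<Rightarrow> complex" where
  "sing_factor' p s = (if p = 2 then 2 powr (1 - s) * (1 - 2 powr (- s - 1))
     else of_real (sing_coeff p) * (1 + of_nat p powr (- s) / of_real (real p - 2)) * (1 - of_nat p powr (- s - 1)))"

lemma sing_factor_mult_euler:
  assumes "prime p" "Re s > -3/4"
  shows "sing_factor p s * (1 - of_nat p powr (- (2 * s + 2))) = sing_factor' p s"
proof -
  have p: "p \<ge> 2" using assms prime_ge_2_nat by auto
  have nz: "1 + of_nat p powr (- s - 1) \<noteq> (0 :: complex)"
    using sing_denominator[OF p, of s] assms by auto
  have "of_nat p powr (- (2 * s + 2)) = (of_nat p powr (- s - 1))\<^sup>2"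
    unfolding power2_eq_square by (simp flip: powr_add)
  hence e: "1 - of_nat p powr (- (2 * s + 2)) = (1 + of_nat p powr (- s - 1)) * (1 - of_nat p powr (- s - 1))"
    by (simp add: power2_eq_square algebra_simps)
  show ?thesis
  proof (cases "p = 2")
    case True
    hence "1 + 2 powr (- s - 1) \<noteq> (0 :: complex)" using nz by simp
    thus ?thesis unfolding e using True by (simp add: sing_factor_def sing_factor'_def)
  next
    case False
    thus ?thesis unfolding e using nz assms(1) by (simp add: sing_factor_def sing_factor'_def)
  qed
qed

lemma sing_coeff_eq: "prime p \<Longrightarrow> p > 2 \<Longrightarrow> sing_coeff p = real p * (real p - 2) / (real p - 1)\<^sup>2"
  by (simp add: sing_coeff_def diff_divide_eq_iff) (simp add: power2_eq_square algebra_simps)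

text \<open>For odd \<open>p\<close> the logarithmic derivative at \<open>0\<close> is \<open>ln p\<close> times
  \<open>- (1 / (p - 2)) / (1 + 1 / (p - 2)) + (1 / p) / (1 - 1 / p)\<close>, and both summands equal \<open>1 / (p - 1)\<close> in absolute value. The
  normalisation by \<open>sing_coeff p\<close> makes the value \<open>1\<close>.\<close>

lemma sing_factor'_0:
  assumes "prime p"
  shows "sing_factor' p 0 = 1" and "(sing_factor' p has_field_derivative 0) (at 0)"
proof -
  show "sing_factor' p 0 = 1"
  proof (cases "p = 2")
    case True
    have "(2::complex) powr (-1) = 1 / 2" by (simp add: powr_minus)
    thus ?thesis using True by (simp add: sing_factor'_def algebra_simps)
  next
    case False
    hence p: "p > 2" using assms prime_ge_2_nat[of p] by simp
    have "of_nat p powr (-1) = (1 / of_nat p :: complex)" using p by (simp add: powr_minus_divide)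
    hence "sing_factor' p 0 = of_real (sing_coeff p * (1 + 1 / (real p - 2)) * (1 - 1 / real p))"
      using False p by (simp add: sing_factor'_def)
    also have "sing_coeff p * (1 + 1 / (real p - 2)) * (1 - 1 / real p) = 1"
    proof -
      have "1 + 1 / (real p - 2) = (real p - 1) / (real p - 2)" "1 - 1 / real p = (real p - 1) / real p"
        using p by (simp_all add: field_simps)
      thus ?thesis unfolding sing_coeff_eq[OF assms p] using p by (simp add: power2_eq_square)
    qed
    finally show ?thesis by simp
  qed
  show "(sing_factor' p has_field_derivative 0) (at 0)"
  proof (cases "p = 2")
    case True
    have h: "(2::complex) powr (-1) = 1 / 2" by (simp add: powr_minus)
    have "((\<lambda>s. 2 powr (1 - s) * (1 - 2 powr (- s - 1))) has_field_derivative
        (- Ln 2 * 2 powr (1 - 0)) * (1 - 2 powr (- 0 - 1)) + (0 - (- Ln 2 * 2 powr (- 0 - 1))) * 2 powr (1 - 0)) (at (0::complex))"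
      by (intro DERIV_mult DERIV_diff DERIV_const DERIV_powr_one_minus DERIV_powr_uminus) auto
    moreover have "(- Ln 2 * 2 powr (1 - 0)) * (1 - 2 powr (- 0 - 1)) + (0 - (- Ln 2 * 2 powr (- 0 - 1))) * 2 powr (1 - 0) = (0::complex)"
      by (simp add: h)
    moreover have "sing_factor' p = (\<lambda>s. 2 powr (1 - s) * (1 - 2 powr (- s - 1)))"
      using True by (simp add: sing_factor'_def fun_eq_iff)
    ultimately show ?thesis by (simp only:)
  next
    case False
    hence p: "p > 2" using assms prime_ge_2_nat[of p] by simp
    let ?q = "of_nat p :: complex" and ?c = "of_real (sing_coeff p) :: complex" and ?r = "complex_of_real (real p - 2)"
    have nz: "?q \<noteq> 0" "?r \<noteq> 0" using p by (simp_all only: of_real_eq_0_iff of_nat_eq_0_iff)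
    have q1: "?q powr (-1) = 1 / ?q" using p by (simp add: powr_minus_divide)
    let ?D = "(?c * (0 + - Ln ?q * ?q powr (- 0 - 0) / ?r)) * (1 - ?q powr (- 0 - 1))
        + (0 - (- Ln ?q * ?q powr (- 0 - 1))) * (?c * (1 + ?q powr (- 0 - 0) / ?r))"
    have "((\<lambda>s. ?c * (1 + ?q powr (- s - 0) / ?r) * (1 - ?q powr (- s - 1))) has_field_derivative ?D) (at 0)"
      by (intro DERIV_mult DERIV_diff DERIV_add DERIV_cmult DERIV_cdivide DERIV_const DERIV_powr_uminus nz)
    moreover have "?D = 0"
    proof -
      have "?D = ?c * Ln ?q * (- (1 / ?r) * (1 - 1 / ?q) + (1 / ?q) * (1 + 1 / ?r))"
        using nz by (simp add: q1 algebra_simps)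
      also have "- (1 / ?r) * (1 - 1 / ?q) + (1 / ?q) * (1 + 1 / ?r) = 0"
        using nz by (simp add: field_simps)
      finally show ?thesis by simp
    qed
    moreover have "sing_factor' p = (\<lambda>s. ?c * (1 + ?q powr (- s - 0) / ?r) * (1 - ?q powr (- s - 1)))"
      using False by (simp add: sing_factor'_def fun_eq_iff)
    ultimately show ?thesis by simp
  qed
qed

lemma sing_factor'_1:
  assumes "prime p"
  shows "sing_factor' p 1 = 1 - of_nat p powr (-2)"
proof (cases "p = 2")
  case True
  thus ?thesis by (simp add: sing_factor'_def)
next
  case False
  hence p: "p > 2" using assms prime_ge_2_nat[of p] by simp
  have "of_nat p powr (-1) = (1 / of_nat p :: complex)" using p by (simp add: powr_minus_divide)
  hence "sing_factor' p 1 = of_real (sing_coeff p * (1 + 1 / (real p * (real p - 2)))) * (1 - of_nat p powr (-2))"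
    using False p by (simp add: sing_factor'_def)
  also have "sing_coeff p * (1 + 1 / (real p * (real p - 2))) = 1"
  proof -
    define a where "a = real p * (real p - 2)"
    have a: "a > 0" "(real p - 1)\<^sup>2 = a + 1" using p by (auto simp: a_def power2_eq_square algebra_simps)
    have "sing_coeff p = a / (a + 1)" unfolding sing_coeff_eq[OF assms p] a_def[symmetric] a(2) ..
    thus ?thesis using a(1) unfolding a_def[symmetric] by (simp add: field_simps)
  qed
  finally show ?thesis by simp
qed

lemma prod_sing_factor_mult_euler_prod:
  assumes "Re s > -3/4"
  shows "(\<Prod>p\<in>primes_upto n. sing_factor p s) * euler_prod n (2 * s + 2) = (\<Prod>p\<in>primes_upto n. sing_factor' p s)"
  unfolding euler_prod_def prod.distrib[symmetric]
  by (intro prod.cong refl sing_factor_mult_euler assms) (auto simp: primes_upto_def)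

text \<open>At \<open>s = 1\<close> the factors \<open>sing_factor' p\<close> are exactly those of \<open>1 / \<zeta>(2)\<close>. This says that \<open>F\<close> has residue
  \<open>1\<close> at \<open>1\<close>, so the singular series has mean value \<open>1\<close>.\<close>

lemma sing_product_1: "sing_product 1 * riemann_zeta 2 = riemann_zeta 4"
proof -
  have "(\<lambda>n. (\<Prod>p\<in>primes_upto n. sing_factor p 1) * euler_prod n (2 * 1 + 2)) \<longlonglongrightarrow> sing_product 1 * (1 / riemann_zeta (2 * 1 + 2))"
    by (intro tendsto_mult sing_product_tendsto' euler_prod_tendsto) auto
  moreover have "(\<Prod>p\<in>primes_upto n. sing_factor p 1) * euler_prod n (2 * 1 + 2) = euler_prod n 2" for n
  proof -
    have "(\<Prod>p\<in>primes_upto n. sing_factor p 1) * euler_prod n (2 * 1 + 2) = (\<Prod>p\<in>primes_upto n. sing_factor' p 1)"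
      by (rule prod_sing_factor_mult_euler_prod) simp
    also have "\<dots> = euler_prod n 2"
      unfolding euler_prod_def by (intro prod.cong refl) (auto simp: primes_upto_def sing_factor'_1)
    finally show ?thesis .
  qed
  ultimately have "(\<lambda>n. euler_prod n 2) \<longlonglongrightarrow> sing_product 1 * (1 / riemann_zeta 4)" by simp
  moreover have "(\<lambda>n. euler_prod n 2) \<longlonglongrightarrow> 1 / riemann_zeta 2" by (rule euler_prod_tendsto) auto
  ultimately have "sing_product 1 * (1 / riemann_zeta 4) = 1 / riemann_zeta 2" by (rule LIMSEQ_unique)
  moreover have "riemann_zeta 4 \<noteq> 0" "riemann_zeta 2 \<noteq> 0" by (rule euler_prod_tendsto(1), simp)+
  ultimately show ?thesis by (simp add: field_simps)
qed

lemma prod_stationary: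
  assumes "finite A" "\<And>i. i \<in> A \<Longrightarrow> f i x = (1::complex)" "\<And>i. i \<in> A \<Longrightarrow> (f i has_field_derivative 0) (at x)"
  shows "(\<Prod>i\<in>A. f i x) = 1" "((\<lambda>z. \<Prod>i\<in>A. f i z) has_field_derivative 0) (at x)"
proof -
  show "(\<Prod>i\<in>A. f i x) = 1" using assms by simp
  show "((\<lambda>z. \<Prod>i\<in>A. f i z) has_field_derivative 0) (at x)" using assms
  proof (induction A rule: finite_induct)
    case (insert a A)
    have "((\<lambda>z. f a z * (\<Prod>i\<in>A. f i z)) has_field_derivative 0 * (\<Prod>i\<in>A. f i x) + 0 * f a x) (at x)"
      by (intro DERIV_mult insert) (use insert.prems in auto)
    thus ?case using insert.hyps by simp
  qed simp
qed

text \<open>The functions \<open>Q n\<close> converge uniformly near \<open>0\<close> to \<open>sing_product\<close>, because \<open>\<zeta>\<close> times its truncated inverse Euler product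
  converges to \<open>1\<close>. On the other hand \<open>Q n\<close> equals \<open>\<zeta>(2 s + 2)\<close> times a product of factors that are \<open>1\<close> to
  second order at \<open>0\<close>, so its value and derivative at \<open>0\<close> are those of \<open>\<zeta>(2 s + 2)\<close>.\<close>

lemma sing_product_0:
  "sing_product 0 = riemann_zeta 2" "deriv sing_product 0 = 2 * deriv riemann_zeta 2"
proof -
  let ?B = "ball (0::complex) (1/4)"
  define Q where "Q = (\<lambda>n s. (\<Prod>p\<in>primes_upto n. sing_factor p s) * (riemann_zeta (2 * s + 2) * euler_prod n (2 * s + 2)))"
  have re: "\<bar>Re s\<bar> \<le> 1/4" if "s \<in> cball 0 (1/4)" for s using abs_Re_le_cmod[of s] that by simp
  have K: "cball (0::complex) (1/4) \<subseteq> {s. Re s > -3/4}" using re by force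
  have "uniform_limit (cball 0 (1/4)) (\<lambda>N s. \<Prod>p<N. sing_factor p s) sing_product sequentially"
    by (rule sing_product_uniform_limit[OF _ K]) auto
  hence "uniform_limit (cball 0 (1/4)) (\<lambda>n s. \<Prod>p<Suc n. sing_factor p s) sing_product sequentially"
    by (rule filterlim_compose[OF _ filterlim_Suc])
  hence u1: "uniform_limit ?B (\<lambda>n s. \<Prod>p\<in>primes_upto n. sing_factor p s) sing_product sequentially"
    unfolding prod_sing_factor_primes_upto by (rule uniform_limit_on_subset) auto
  have u2: "uniform_limit ?B (\<lambda>n s. riemann_zeta (2 * s + 2) * euler_prod n (2 * s + 2)) (\<lambda>s. 1) sequentially"
  proof (rule uniform_limit_compose'[OF euler_prod_uniform_limit[of "3/2"]])
    show "(\<lambda>s. 2 * s + 2) \<in> ?B \<rightarrow> {s. Re s \<ge> 3/2}"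
    proof
      fix s assume "s \<in> ?B"
      hence "\<bar>Re s\<bar> \<le> 1/4" by (intro re) auto
      thus "2 * s + 2 \<in> {s. Re s \<ge> 3/2}" by (simp add: abs_le_iff)
    qed
  qed auto
  have bdd: "bounded (sing_product ` ?B)"
  proof -
    obtain C where C: "\<And>s. Re s > -3/4 \<Longrightarrow> norm (sing_product s) \<le> C" using sing_product_bounded by blast
    have "norm (sing_product s) \<le> C" if "s \<in> ?B" for s
    proof (rule C)
      have "s \<in> cball 0 (1/4)" using that by auto
      with K show "Re s > -3/4" by blast
    qed
    thus ?thesis unfolding bounded_iff by blast
  qed
  have u: "uniform_limit ?B Q (\<lambda>s. sing_product s * 1) sequentially"
    unfolding Q_def by (intro uniform_lim_mult u1 u2 bdd) (auto simp: bounded_iff)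
  have Qeq: "Q n s = riemann_zeta (2 * s + 2) * (\<Prod>p\<in>primes_upto n. sing_factor' p s)" if "s \<in> ?B" for n s
  proof -
    have "s \<in> cball 0 (1/4)" using that by auto
    with K have "Re s > -3/4" by blast
    from prod_sing_factor_mult_euler_prod[OF this, of n] show ?thesis
      unfolding Q_def by (simp add: mult_ac)
  qed
  note stat = prod_stationary[of "primes_upto n" sing_factor' 0 for n, OF finite_primes_upto sing_factor'_0]
  have dz: "((\<lambda>s. riemann_zeta (2 * s + 2)) has_field_derivative deriv riemann_zeta 2 * 2) (at 0)"
  proof (rule DERIV_chain2[of riemann_zeta])
    show "(riemann_zeta has_field_derivative deriv riemann_zeta 2) (at (2 * 0 + 2))"
      using holomorphic_derivI[OF riemann_zeta_holomorphic[of "- {1}"], of 2] by auto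
    show "((\<lambda>s. 2 * s + 2) has_field_derivative 2) (at (0::complex))" by (auto intro!: derivative_eq_intros)
  qed
  have Qd: "(Q n has_field_derivative 2 * deriv riemann_zeta 2) (at 0)" for n
  proof -
    have "((\<lambda>s. riemann_zeta (2 * s + 2) * (\<Prod>p\<in>primes_upto n. sing_factor' p s)) has_field_derivative
        (deriv riemann_zeta 2 * 2) * (\<Prod>p\<in>primes_upto n. sing_factor' p 0) + 0 * riemann_zeta (2 * 0 + 2)) (at 0)"
      by (intro DERIV_mult dz stat) (auto simp: primes_upto_def)
    moreover have "(\<Prod>p\<in>primes_upto n. sing_factor' p 0) = 1" by (rule stat) (auto simp: primes_upto_def)
    ultimately have "((\<lambda>s. riemann_zeta (2 * s + 2) * (\<Prod>p\<in>primes_upto n. sing_factor' p s)) has_field_derivative 2 * deriv riemann_zeta 2) (at 0)"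
      by (simp add: mult.commute)
    thus ?thesis by (rule has_field_derivative_transform_within_open[of _ _ _ ?B]) (use Qeq in auto)
  qed
  have Qhol: "Q n holomorphic_on ?B" for n
  proof -
    have "(\<lambda>s. 2 * s + 2) ` ?B \<subseteq> - {1}"
    proof (intro subsetI)
      fix w assume "w \<in> (\<lambda>s. 2 * s + 2) ` ?B"
      then obtain s where s: "s \<in> ?B" "w = 2 * s + 2" by blast
      hence "Re w \<noteq> 1" using re[of s] by (auto simp: abs_le_iff)
      thus "w \<in> - {1}" by auto
    qed
    hence "riemann_zeta \<circ> (\<lambda>s. 2 * s + 2) holomorphic_on ?B"
      by (intro holomorphic_on_compose holomorphic_intros riemann_zeta_holomorphic) blast
    hence "(\<lambda>s. riemann_zeta (2 * s + 2)) holomorphic_on ?B" by (simp add: o_def)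
    moreover have "(\<lambda>s. \<Prod>p\<in>primes_upto n. sing_factor p s) holomorphic_on ?B"
      by (intro holomorphic_on_prod holomorphic_on_subset[OF sing_factor_holomorphic]) (use K in force)
    moreover have "(\<lambda>s. euler_prod n (2 * s + 2)) holomorphic_on ?B"
      unfolding euler_prod_def by (intro holomorphic_intros)
    ultimately show ?thesis unfolding Q_def by (intro holomorphic_on_mult)
  qed
  have "(\<lambda>n. deriv (Q n) 0) \<longlonglongrightarrow> deriv (\<lambda>s. sing_product s * 1) 0"
    by (rule deriv_complex_uniform_limit[OF u]) (use Qhol in auto)
  hence "(\<lambda>n::nat. 2 * deriv riemann_zeta 2) \<longlonglongrightarrow> deriv sing_product 0"
    by (simp only: DERIV_imp_deriv[OF Qd] mult_1_right)
  from LIMSEQ_unique[OF this tendsto_const]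
  show "deriv sing_product 0 = 2 * deriv riemann_zeta 2" .
  have "(\<lambda>n. Q n 0) \<longlonglongrightarrow> sing_product 0 * 1" by (rule tendsto_uniform_limitI[OF u]) auto
  moreover have "Q n 0 = riemann_zeta 2" for n
  proof -
    have "(\<Prod>p\<in>primes_upto n. sing_factor' p 0) = 1" by (rule stat) (auto simp: primes_upto_def)
    thus ?thesis using Qeq[of 0 n] by simp
  qed
  ultimately have "(\<lambda>n::nat. riemann_zeta 2) \<longlonglongrightarrow> sing_product 0" by (simp only: mult_1_right)
  from LIMSEQ_unique[OF this tendsto_const]
  show "sing_product 0 = riemann_zeta 2" .
qed

section \<open>The Dirichlet series of the singular series\<close>

lemma sing_coeff_prod_tendsto: "(\<lambda>n. \<Prod>p\<in>primes_upto n. sing_coeff p) \<longlonglongrightarrow> twin_prime_const"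
proof -
  have "convergent_prod sing_coeff"
    using twin_prime_const_convergent unfolding sing_coeff_def .
  hence "(\<lambda>n. \<Prod>p\<le>n. sing_coeff p) \<longlonglongrightarrow> prodinf sing_coeff" by (rule convergent_prod_LIMSEQ)
  moreover have "(\<Prod>p\<le>n. sing_coeff p) = (\<Prod>p\<in>primes_upto n. sing_coeff p)" for n
    by (rule prod.mono_neutral_right) (auto simp: primes_upto_def sing_coeff_def)
  moreover have "prodinf sing_coeff = twin_prime_const" unfolding twin_prime_const_def sing_coeff_def ..
  ultimately show ?thesis by simp
qed

lemma twin_prime_const_nonzero: "twin_prime_const \<noteq> 0"
proof -
  have "convergent_prod sing_coeff"
    using twin_prime_const_convergent unfolding sing_coeff_def .
  moreover have "sing_coeff p \<noteq> 0" for p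
  proof (cases "prime p \<and> p > 2")
    case True
    thus ?thesis using sing_coeff_eq[of p] by simp
  qed (auto simp: sing_coeff_def)
  ultimately have "prodinf sing_coeff \<noteq> 0" by (rule prodinf_nonzero)
  thus ?thesis unfolding twin_prime_const_def sing_coeff_def .
qed

text \<open>For \<open>k > 0\<close> this is the product over the odd primes dividing \<open>k\<close>: the summand \<open>1 / (p - 2)\<close> is \<open>1 / 0 = 0\<close>
  at \<open>p = 2\<close>, so that prime contributes the factor \<open>1\<close>.\<close>

definition odd_singular_series :: "nat \<Rightarrow> real" where
  "odd_singular_series k = (\<Prod>p | prime p \<and> p dvd k. 1 + 1 / (real p - 2))"

definition truncated_singular_series :: "nat \<Rightarrow> nat \<Rightarrow> real" where
  "truncated_singular_series n k = (\<Prod>p\<in>{p\<in>primes_upto n. p dvd k}. 1 + 1 / (real p - 2))"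

lemma singular_series_eq:
  assumes "k > 0"
  shows "singular_series k = (if even k then 2 * twin_prime_const * odd_singular_series k else 0)"
proof -
  have fin: "finite {p. prime p \<and> p dvd k}" by (rule finite_subset[of _ "{..k}"]) (use assms in \<open>auto dest: dvd_imp_le\<close>)
  have "odd_singular_series k = (\<Prod>p | prime p \<and> p dvd k \<and> p > 2. 1 + 1 / (real p - 2))"
    unfolding odd_singular_series_def
  proof (rule prod.mono_neutral_right[OF fin])
    show "\<forall>p\<in>{p. prime p \<and> p dvd k} - {p. prime p \<and> p dvd k \<and> p > 2}. 1 + 1 / (real p - 2) = 1"
    proof
      fix p assume "p \<in> {p. prime p \<and> p dvd k} - {p. prime p \<and> p dvd k \<and> p > 2}"
      hence "prime p" "\<not> p > 2" by auto
      hence "p = 2" using prime_ge_2_nat[of p] by simp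
      thus "1 + 1 / (real p - 2) = 1" by simp
    qed
  qed auto
  also have "\<dots> = (\<Prod>p | prime p \<and> p dvd k \<and> p > 2. (real p - 1) / (real p - 2))"
    by (intro prod.cong refl) (auto simp: field_simps)
  finally show ?thesis by (simp add: singular_series_def)
qed

lemma truncated_singular_series_eq: "k > 0 \<Longrightarrow> k \<le> n \<Longrightarrow> truncated_singular_series n k = odd_singular_series k"
  unfolding truncated_singular_series_def odd_singular_series_def
  by (intro prod.cong) (auto simp: primes_upto_def dest: dvd_imp_le)

lemma euler_term_ge_1: "prime p \<Longrightarrow> 1 + 1 / (real p - 2) \<ge> 1"
  using prime_ge_2_nat[of p] by simp

lemma truncated_singular_series_nonneg: "truncated_singular_series n k \<ge> 0"
  unfolding truncated_singular_series_def
proof (intro prod_nonneg)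
  fix p assume "p \<in> {p\<in>primes_upto n. p dvd k}"
  hence "prime p" by (simp add: primes_upto_def)
  from euler_term_ge_1[OF this] show "0 \<le> 1 + 1 / (real p - 2)" by linarith
qed

lemma truncated_singular_series_le:
  assumes "k > 0" shows "truncated_singular_series n k \<le> odd_singular_series k"
proof -
  have fin: "finite {p. prime p \<and> p dvd k}" by (rule finite_subset[of _ "{..k}"]) (use assms in \<open>auto dest: dvd_imp_le\<close>)
  show ?thesis unfolding truncated_singular_series_def odd_singular_series_def
  proof (rule prod_mono2[OF fin])
    show "{p\<in>primes_upto n. p dvd k} \<subseteq> {p. prime p \<and> p dvd k}" by (auto simp: primes_upto_def)
    show "1 \<le> 1 + 1 / (real p - 2)" if "p \<in> {p. prime p \<and> p dvd k} - {p\<in>primes_upto n. p dvd k}" for p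
      using that by (intro euler_term_ge_1) auto
    show "0 \<le> 1 + 1 / (real p - 2)" if "p \<in> {p\<in>primes_upto n. p dvd k}" for p
      using that euler_term_ge_1[of p] by (auto simp: primes_upto_def)
  qed
qed

definition odd_product :: "nat \<Rightarrow> complex \<Rightarrow> complex" where
  "odd_product n s = (\<Prod>p\<in>primes_upto n. 1 + of_real (1 / (real p - 2)) * of_nat p powr (-s))"

lemma has_sum_truncated:
  assumes "Re s > 1"
  shows "((\<lambda>k. of_real (truncated_singular_series n k) * of_nat k powr (-s)) has_sum riemann_zeta s * odd_product n s) {1..}"
proof -
  have "((\<lambda>k. (\<Prod>p\<in>{p\<in>primes_upto n. p dvd k}. 1 + complex_of_real (1 / (real p - 2))) * of_nat k powr (-s))
      has_sum riemann_zeta s * odd_product n s) {1..}"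
    unfolding odd_product_def by (rule has_sum_finite_euler_product[OF assms]) (auto simp: primes_upto_def)
  moreover have "(\<Prod>p\<in>{p\<in>primes_upto n. p dvd k}. 1 + complex_of_real (1 / (real p - 2))) = of_real (truncated_singular_series n k)" for k
    unfolding truncated_singular_series_def of_real_prod by simp
  ultimately show ?thesis by simp
qed

text \<open>The quotient \<open>F(s) / \<zeta>(s)\<close>, by \<open>has_sum_singular_series\<close>.\<close>

definition sing_limit :: "complex \<Rightarrow> complex" where
  "sing_limit s = sing_product s * riemann_zeta (s + 1) / riemann_zeta (2 * s + 2)"

text \<open>Up to the factors \<open>2 powr (1 - s)\<close> and \<open>sing_coeff p\<close>, the quotient of \<open>sing_factor p\<close> and the Euler factor of
  \<open>\<zeta>(2 s + 2) / \<zeta>(s + 1)\<close> is the Euler factor of the singular series.\<close>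

lemma odd_product_tendsto:
  assumes s: "Re s > 0"
  shows "(\<lambda>n. odd_product n s) \<longlonglongrightarrow> sing_limit s / (2 powr (1 - s) * of_real twin_prime_const)"
proof -
  let ?n = "\<lambda>n. (\<Prod>p\<in>primes_upto n. sing_factor p s) * euler_prod n (2 * s + 2)"
    and ?N = "sing_product s * (1 / riemann_zeta (2 * s + 2))"
  have eq: "2 powr (1 - s) * of_real (\<Prod>p\<in>primes_upto n. sing_coeff p) * odd_product n s * euler_prod n (s + 1)
      = ?n n" if n: "n \<ge> 2" for n
  proof -
    have 2: "2 \<in> primes_upto n" using n by (simp add: primes_upto_def)
    have "?n n = (\<Prod>p\<in>primes_upto n. sing_factor' p s)"
      by (rule prod_sing_factor_mult_euler_prod) (use s in simp)
    also have "\<dots> = (\<Prod>p\<in>primes_upto n. (if p = 2 then 2 powr (1 - s) else 1) *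
       (of_real (sing_coeff p) * (1 + of_real (1 / (real p - 2)) * of_nat p powr (-s)) * (1 - of_nat p powr (- (s + 1)))))"
      by (intro prod.cong refl) (auto simp: sing_factor'_def sing_coeff_def divide_inverse mult_ac)
    also have "\<dots> = (\<Prod>p\<in>primes_upto n. (if p = 2 then 2 powr (1 - s) else 1)) * of_real (\<Prod>p\<in>primes_upto n. sing_coeff p) * odd_product n s * euler_prod n (s + 1)"
      unfolding odd_product_def euler_prod_def of_real_prod prod.distrib by (simp add: mult_ac)
    also have "(\<Prod>p\<in>primes_upto n. (if p = 2 then 2 powr (1 - s) else 1)) = 2 powr (1 - s)"
      using 2 by (simp add: prod.delta)
    finally show ?thesis ..
  qed
  define D where "D = 2 powr (1 - s) * of_real twin_prime_const * (1 / riemann_zeta (s + 1))"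
  have nz: "riemann_zeta (s + 1) \<noteq> 0" using s by (intro euler_prod_tendsto(1)) auto
  have D0: "D \<noteq> 0" using nz twin_prime_const_nonzero by (simp add: D_def)
  let ?d = "\<lambda>n. 2 powr (1 - s) * of_real (\<Prod>p\<in>primes_upto n. sing_coeff p) * euler_prod n (s + 1)"
  have dlim: "?d \<longlonglongrightarrow> D" unfolding D_def
    using s by (intro tendsto_intros sing_coeff_prod_tendsto euler_prod_tendsto) auto
  have nlim: "(\<lambda>n. ?n n) \<longlonglongrightarrow> ?N"
    using s by (intro tendsto_mult sing_product_tendsto' euler_prod_tendsto) auto
  have "(\<lambda>n. ?n n / ?d n) \<longlonglongrightarrow> ?N / D"
    by (rule tendsto_divide[OF nlim dlim D0])
  moreover have "\<forall>\<^sub>F n in sequentially. ?n n / ?d n = odd_product n s"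
    using eventually_ge_at_top[of 2] tendsto_imp_eventually_ne[OF dlim D0]
  proof eventually_elim
    case (elim n)
    show ?case unfolding eq[OF elim(1), symmetric] using elim(2) by (simp add: field_simps)
  qed
  ultimately have "(\<lambda>n. odd_product n s) \<longlonglongrightarrow> ?N / D"
    by (rule Lim_transform_eventually)
  also have "?N / D = sing_limit s / (2 powr (1 - s) * of_real twin_prime_const)"
    by (simp add: D_def sing_limit_def mult_ac)
  finally show ?thesis .
qed

text \<open>Each finite partial sum is also a partial sum of a truncated series, the terms are nonnegative, and the values of
  the truncated series converge, hence are bounded.\<close>

lemma summable_odd_singular_series:
  assumes c: "c > 1"
  shows "(\<lambda>k. odd_singular_series k * real k powr (-c)) summable_on {1..}"
proof (rule nonneg_bdd_above_summable_on)
  fix k :: nat assume "k \<in> {1..}"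
  thus "0 \<le> odd_singular_series k * real k powr (-c)"
    using truncated_singular_series_nonneg[of k k] by (simp add: truncated_singular_series_eq)
next
  have "Bseq (\<lambda>n. odd_product n (of_real c))"
    using odd_product_tendsto[of "of_real c"] c by (intro convergent_imp_Bseq) (auto simp: convergent_def)
  then obtain B where B: "\<And>n. norm (odd_product n (of_real c)) \<le> B" unfolding Bseq_def by auto
  show "bdd_above (sum (\<lambda>k. odd_singular_series k * real k powr (-c)) ` {F. F \<subseteq> {1..} \<and> finite F})"
  proof (rule bdd_aboveI2)
    fix F assume F: "F \<in> {F. F \<subseteq> {1::nat..} \<and> finite F}"
    define n where "n = Max (insert 0 F)"
    have n: "k \<le> n" if "k \<in> F" for k using F that by (auto simp: n_def)
    have "((\<lambda>k. of_real (truncated_singular_series n k) * of_nat k powr (- of_real c)) has_sum riemann_zeta (of_real c) * odd_product n (of_real c)) {1..}"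
      by (rule has_sum_truncated) (use c in simp)
    hence "((\<lambda>k. Re (of_real (truncated_singular_series n k) * of_nat k powr (- of_real c))) has_sum Re (riemann_zeta (of_real c) * odd_product n (of_real c))) {1..}"
      by (rule has_sum_Re)
    moreover have r: "Re (of_real (truncated_singular_series n k) * of_nat k powr (- of_real c)) = truncated_singular_series n k * real k powr (-c)" for k :: nat
      by (simp add: powr_of_real[of "real k" "-c", simplified])
    ultimately have hs: "((\<lambda>k. truncated_singular_series n k * real k powr (-c)) has_sum Re (riemann_zeta (of_real c) * odd_product n (of_real c))) {1..}"
      by (simp only: r)
    have "(\<Sum>k\<in>F. odd_singular_series k * real k powr (-c)) = (\<Sum>k\<in>F. truncated_singular_series n k * real k powr (-c))"
      using n F by (intro sum.cong refl) (auto simp: truncated_singular_series_eq subset_eq Suc_le_eq)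
    also have "\<dots> \<le> Re (riemann_zeta (of_real c) * odd_product n (of_real c))"
      by (rule has_sum_mono'[OF has_sum_finite hs]) (use F in \<open>auto intro!: mult_nonneg_nonneg truncated_singular_series_nonneg\<close>)
    also have "\<dots> \<le> norm (riemann_zeta (of_real c)) * norm (odd_product n (of_real c))"
      using complex_Re_le_cmod by (simp only: norm_mult[symmetric])
    also have "\<dots> \<le> norm (riemann_zeta (of_real c)) * B" by (intro mult_left_mono B) auto
    finally show "(\<Sum>k\<in>F. odd_singular_series k * real k powr (-c)) \<le> norm (riemann_zeta (of_real c)) * B" .
  qed
qed

lemma has_sum_odd_singular_series:
  assumes s: "Re s > 1"
  shows "((\<lambda>k. of_real (odd_singular_series k) * of_nat k powr (-s)) has_sum
           riemann_zeta s * (sing_limit s / (2 powr (1 - s) * of_real twin_prime_const))) {1..}"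
proof -
  let ?f = "\<lambda>k. of_real (odd_singular_series k) * of_nat k powr (-s) :: complex"
  let ?g = "\<lambda>n k. of_real (truncated_singular_series n k) * of_nat k powr (-s) :: complex"
  let ?c = "\<lambda>k. odd_singular_series k * real k powr (-Re s)"
  note sm = summable_odd_singular_series[OF s]
  have pos: "odd_singular_series k \<ge> 0" if "k \<ge> 1" for k
    using truncated_singular_series_nonneg[of k k] that by (simp add: truncated_singular_series_eq)
  have f: "norm (?f k) \<le> ?c k" if "k \<ge> 1" for k
    using pos[OF that] that by (simp add: norm_mult norm_nat_powr)
  have g: "norm (?g n k) \<le> ?c k" if "k \<ge> 1" for n k
    using truncated_singular_series_le[of k n] truncated_singular_series_nonneg[of n k] that
    by (auto simp: norm_mult norm_nat_powr intro!: mult_right_mono)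
  have le: "norm (infsum (?g n) {1..} - infsum ?f {1..}) \<le> 2 * infsum ?c {n<..}" for n
    by (rule infsum_tail_bound[OF sm _ g f]) (auto simp: truncated_singular_series_eq)
  have lim: "(\<lambda>n. 2 * infsum ?c {n<..}) \<longlonglongrightarrow> 0"
    using tendsto_mult[OF tendsto_const infsum_tail_tendsto_0[OF sm], of 2] by (simp only: mult_zero_right)
  have "(\<lambda>n. infsum (?g n) {1..} - infsum ?f {1..}) \<longlonglongrightarrow> 0"
    by (rule Lim_null_comparison[OF always_eventually[OF allI[OF le]] lim])
  moreover have "infsum (?g n) {1..} = riemann_zeta s * odd_product n s" for n
    by (rule infsumI[OF has_sum_truncated[OF s]])
  ultimately have "(\<lambda>n. riemann_zeta s * odd_product n s - infsum ?f {1..}) \<longlonglongrightarrow> 0" by (simp only:)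
  hence "(\<lambda>n. riemann_zeta s * odd_product n s) \<longlonglongrightarrow> infsum ?f {1..}" by (rule LIM_zero_cancel)
  moreover have "(\<lambda>n. riemann_zeta s * odd_product n s) \<longlonglongrightarrow> riemann_zeta s * (sing_limit s / (2 powr (1 - s) * of_real twin_prime_const))"
    using s by (intro tendsto_mult tendsto_const odd_product_tendsto) auto
  ultimately have I: "infsum ?f {1..} = riemann_zeta s * (sing_limit s / (2 powr (1 - s) * of_real twin_prime_const))"
    by (rule LIMSEQ_unique)
  have "?f summable_on {1..}"
    by (rule abs_summable_summable, rule Infinite_Sum.abs_summable_on_comparison_test'[OF sm f], simp)
  from has_sum_infsum[OF this] show ?thesis unfolding I .
qed

text \<open>Only even indices contribute, and replacing \<open>j\<close> by \<open>2 j\<close> does not change the set of odd prime divisors.\<close>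

lemma has_sum_singular_series:
  assumes s: "Re s > 1"
  shows "((\<lambda>k. of_real (singular_series k) * of_nat k powr (-s)) has_sum riemann_zeta s * sing_limit s) {1..}"
proof -
  let ?h = "\<lambda>k. of_real (singular_series k) * of_nat k powr (-s) :: complex"
  let ?C = "of_real twin_prime_const :: complex"
  have eq: "?h (2 * j) = (2 powr (1 - s) * ?C) * (of_real (odd_singular_series j) * of_nat j powr (-s))" if j: "j \<in> {1..}" for j
  proof -
    have "odd_singular_series (2 * j) = odd_singular_series j"
      unfolding odd_singular_series_def
    proof (rule prod.mono_neutral_right)
      show "finite {p. prime p \<and> p dvd 2 * j}"
        by (rule finite_subset[of _ "{..2 * j}"]) (use j in \<open>auto dest: dvd_imp_le\<close>)
      show "\<forall>p\<in>{p. prime p \<and> p dvd 2 * j} - {p. prime p \<and> p dvd j}. 1 + 1 / (real p - 2) = 1"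
      proof
        fix p assume "p \<in> {p. prime p \<and> p dvd 2 * j} - {p. prime p \<and> p dvd j}"
        hence p: "prime p" "p dvd 2 * j" "\<not> p dvd j" by auto
        hence "p dvd 2" using prime_dvd_mult_iff[of p 2 j] by blast
        hence "p = 2" using p(1) primes_dvd_imp_eq[of p 2] two_is_prime_nat by blast
        thus "1 + 1 / (real p - 2) = 1" by simp
      qed
    qed auto
    moreover have "of_nat (2 * j) powr (-s) = 2 powr (-s) * (of_nat j powr (-s) :: complex)"
      using of_nat_powr_mult[of 2 j "-s"] j by simp
    moreover have "2 powr (1 - s) = 2 * (2 powr (-s) :: complex)"
      by (simp add: powr_diff powr_minus_divide)
    ultimately show ?thesis using j by (simp only: singular_series_eq) (simp add: singular_series_eq mult_ac)
  qed
  have "((\<lambda>j. (2 powr (1 - s) * ?C) * (of_real (odd_singular_series j) * of_nat j powr (-s))) has_sum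
      (2 powr (1 - s) * ?C) * (riemann_zeta s * (sing_limit s / (2 powr (1 - s) * ?C)))) {1..}"
    by (rule has_sum_cmult_right[OF has_sum_odd_singular_series[OF s]])
  also have "(2 powr (1 - s) * ?C) * (riemann_zeta s * (sing_limit s / (2 powr (1 - s) * ?C))) = riemann_zeta s * sing_limit s"
    using twin_prime_const_nonzero by simp
  finally have "((\<lambda>j. ?h (2 * j)) has_sum riemann_zeta s * sing_limit s) {1..}"
    by (rule has_sum_cong[THEN iffD1, rotated]) (simp only: eq)
  moreover have "bij_betw (\<lambda>j. 2 * j) {1..} {k\<in>{1::nat..}. even k}"
    by (rule bij_betwI[where g = "\<lambda>k. k div 2"]) (auto elim!: evenE)
  ultimately have "(?h has_sum riemann_zeta s * sing_limit s) {k\<in>{1..}. even k}"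
    using has_sum_reindex_bij_betw[of "\<lambda>j. 2 * j" "{1..}" "{k\<in>{1..}. even k}" ?h] by simp
  thus ?thesis
    by (rule has_sum_cong_neutral[THEN iffD1, rotated -1]) (auto simp: singular_series_def)
qed

section \<open>Perron's formula for a quadratic weight\<close>

definition perron_kernel :: "complex \<Rightarrow> complex" where
  "perron_kernel s = 2 / (s * (s + 1) * (s + 2))"

lemma perron_kernel_bound:
  assumes "\<bar>Im s\<bar> \<ge> 1"
  shows "norm (perron_kernel s) \<le> 16 * (1 + \<bar>Im s\<bar>) powr (-3)"
proof -
  have le: "norm (s + of_real x) \<ge> (1 + \<bar>Im s\<bar>) / 2" for x :: real
    using abs_Im_le_cmod[of "s + of_real x"] assms by simp
  have "((1 + \<bar>Im s\<bar>) / 2) * ((1 + \<bar>Im s\<bar>) / 2) * ((1 + \<bar>Im s\<bar>) / 2) \<le> norm s * norm (s + 1) * norm (s + 2)"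
    using le[of 0] le[of 1] le[of 2] by (intro mult_mono) auto
  hence "((1 + \<bar>Im s\<bar>) / 2) ^ 3 \<le> norm (s * (s + 1) * (s + 2))"
    by (simp add: norm_mult power3_eq_cube)
  hence "norm (perron_kernel s) \<le> 2 / ((1 + \<bar>Im s\<bar>) / 2) ^ 3"
    unfolding perron_kernel_def norm_divide by (intro frac_le) (auto intro!: zero_less_power add_pos_nonneg)
  also have "\<dots> = 16 * (1 + \<bar>Im s\<bar>) powr (-3)"
    by (simp add: powr_minus powr_numeral power_divide field_simps)
  finally show ?thesis .
qed

text \<open>Here one of the three factors is bounded by \<open>\<bar>b\<bar>\<close>, which makes the integral over the line \<open>Re s = b\<close> tend to
  \<open>0\<close> as \<open>\<bar>b\<bar>\<close> grows, even for \<open>y = 1\<close>.\<close>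

lemma perron_kernel_bound':
  assumes "\<bar>b\<bar> \<ge> 4"
  shows "norm (perron_kernel (Complex b t)) \<le> 8 / \<bar>b\<bar> * (1 + \<bar>t\<bar>) powr (-2)"
proof -
  define s where "s = Complex b t"
  have le: "norm (s + of_real x) \<ge> (1 + \<bar>t\<bar>) / 2" if "0 \<le> x" "x \<le> 2" for x :: real
    using abs_Im_le_cmod[of "s + of_real x"] abs_Re_le_cmod[of "s + of_real x"] assms that
    by (simp add: s_def)
  have "\<bar>b\<bar> * ((1 + \<bar>t\<bar>) / 2) * ((1 + \<bar>t\<bar>) / 2) \<le> norm s * norm (s + 1) * norm (s + 2)"
    using abs_Re_le_cmod[of s] le[of 1] le[of 2] by (intro mult_mono) (auto simp: s_def)
  hence "\<bar>b\<bar> * ((1 + \<bar>t\<bar>) / 2) ^ 2 \<le> norm (s * (s + 1) * (s + 2))"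
    by (simp add: norm_mult power2_eq_square mult_ac)
  hence "norm (perron_kernel s) \<le> 2 / (\<bar>b\<bar> * ((1 + \<bar>t\<bar>) / 2) ^ 2)"
    unfolding perron_kernel_def norm_divide using assms
    by (intro frac_le) (auto intro!: mult_pos_pos zero_less_power add_pos_nonneg)
  also have "\<dots> = 8 / \<bar>b\<bar> * (1 + \<bar>t\<bar>) powr (-2)"
    by (simp add: powr_minus powr_numeral power_divide field_simps)
  finally show ?thesis by (simp add: s_def)
qed

lemma norm_real_powr: "y > 0 \<Longrightarrow> norm (complex_of_real y powr s) = y powr Re s"
  by (subst norm_powr_real_powr) auto

lemma perron_integrand_holomorphic:
  "y > 0 \<Longrightarrow> (\<lambda>s. complex_of_real y powr s * perron_kernel s) holomorphic_on - {0, -1, -2}"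
  unfolding perron_kernel_def
  by (intro holomorphic_intros) (auto simp: add_eq_0_iff2)

lemma perron_integrand_decay:
  assumes y: "y > 0" and s: "a \<le> Re s" "Re s \<le> b" "\<bar>Im s\<bar> \<ge> 1"
  shows "norm (complex_of_real y powr s * perron_kernel s) \<le> 16 * (y powr a + y powr b) * (1 + \<bar>Im s\<bar>) powr (-3)"
proof -
  have "y powr Re s \<le> y powr a + y powr b"
  proof (cases "y \<ge> 1")
    case True
    hence "y powr Re s \<le> y powr b" using s by (intro powr_mono) auto
    thus ?thesis by (simp add: add_increasing)
  next
    case False
    hence "y powr Re s \<le> y powr a" using s y by (intro powr_mono') auto
    thus ?thesis by (simp add: add_increasing2)
  qed
  hence "norm (complex_of_real y powr s * perron_kernel s) \<le> (y powr a + y powr b) * (16 * (1 + \<bar>Im s\<bar>) powr (-3))"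
    unfolding norm_mult norm_real_powr[OF y] by (intro mult_mono perron_kernel_bound s) auto
  thus ?thesis by (simp add: algebra_simps)
qed

definition perron_integral :: "real \<Rightarrow> real \<Rightarrow> complex" where
  "perron_integral c y = (LINT t|lborel. complex_of_real y powr Complex c t * perron_kernel (Complex c t))"

lemma perron_integral_bound:
  assumes y: "y > 0" and c: "\<bar>c\<bar> \<ge> 4" and yc: "y powr c \<le> 1"
  shows "norm (perron_integral c y) \<le> (8 / \<bar>c\<bar>) * (LINT t|lborel. (1 + \<bar>t::real\<bar>) powr (-2))"
proof -
  have le: "norm (complex_of_real y powr Complex c t * perron_kernel (Complex c t)) \<le> 8 / \<bar>c\<bar> * (1 + \<bar>t\<bar>) powr (-2)" for t
  proof -
    have "norm (complex_of_real y powr Complex c t * perron_kernel (Complex c t)) \<le> 1 * (8 / \<bar>c\<bar> * (1 + \<bar>t\<bar>) powr (-2))"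
      unfolding norm_mult norm_real_powr[OF y] using yc perron_kernel_bound'[OF c] by (intro mult_mono) auto
    thus ?thesis by simp
  qed
  have "norm (perron_integral c y) \<le> (LINT t|lborel. 8 / \<bar>c\<bar> * (1 + \<bar>t::real\<bar>) powr (-2))"
    unfolding perron_integral_def
  proof (rule order_trans[OF integral_norm_bound integral_mono])
    show "integrable lborel (\<lambda>t. 8 / \<bar>c\<bar> * (1 + \<bar>t\<bar>) powr (-2))"
      using integrable_powr_decay[of 2] by simp
    show "norm (complex_of_real y powr Complex c t * perron_kernel (Complex c t)) \<le> 8 / \<bar>c\<bar> * (1 + \<bar>t\<bar>) powr (-2)" for t
      by (rule le)
  next
    have "continuous_on {s. Re s = c} (\<lambda>s. complex_of_real y powr s * perron_kernel s)"
      by (rule continuous_on_subset[OF holomorphic_on_imp_continuous_on[OF perron_integrand_holomorphic[OF y]]]) (use c in auto)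
    hence "continuous_on UNIV (\<lambda>t. complex_of_real y powr Complex c t * perron_kernel (Complex c t))"
      by (rule continuous_on_compose2) (auto simp: Complex_eq intro!: continuous_intros)
    from integrable_of_powr_decay[OF this, of 2 "8 / \<bar>c\<bar>"] le
    have "integrable lborel (\<lambda>t. complex_of_real y powr Complex c t * perron_kernel (Complex c t))" by simp
    thus "integrable lborel (\<lambda>t. norm (complex_of_real y powr Complex c t * perron_kernel (Complex c t)))"
      by (rule integrable_norm)
  qed
  also have "\<dots> = 8 / \<bar>c\<bar> * (LINT t|lborel. (1 + \<bar>t::real\<bar>) powr (-2))" by simp
  finally show ?thesis .
qed

lemma perron_residue_sum:
  assumes y: "y > 0"
  shows "(\<Sum>p\<in>{0, -1, -2}. residue (\<lambda>s. complex_of_real y powr s * perron_kernel s) p) = of_real ((1 - 1 / y)\<^sup>2)"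
proof -
  let ?f = "\<lambda>s. complex_of_real y powr s * perron_kernel s"
  have r0: "residue ?f 0 = 1"
  proof -
    have "residue ?f 0 = residue (\<lambda>s. (complex_of_real y powr s * 2 / ((s + 1) * (s + 2))) / (s - 0)) 0"
      by (intro arg_cong2[where f = residue] ext) (simp_all add: perron_kernel_def mult_ac)
    also have "\<dots> = complex_of_real y powr 0 * 2 / ((0 + 1) * (0 + 2))"
      by (rule residue_simple[of "- {-1, -2}"]) (auto intro!: holomorphic_intros simp: add_eq_0_iff2)
    finally show ?thesis using y by simp
  qed
  have r1: "residue ?f (-1) = - 2 / of_real y"
  proof -
    have "residue ?f (-1) = residue (\<lambda>s. (complex_of_real y powr s * 2 / (s * (s + 2))) / (s - (-1))) (-1)"
      by (intro arg_cong2[where f = residue] ext) (simp_all add: perron_kernel_def mult_ac)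
    also have "\<dots> = complex_of_real y powr (-1) * 2 / ((-1) * ((-1) + 2))"
      by (rule residue_simple[of "- {0, -2}"]) (auto intro!: holomorphic_intros simp: add_eq_0_iff2)
    finally show ?thesis using y by (simp add: powr_minus field_simps)
  qed
  have r2: "residue ?f (-2) = 1 / (of_real y)\<^sup>2"
  proof -
    have "residue ?f (-2) = residue (\<lambda>s. (complex_of_real y powr s * 2 / (s * (s + 1))) / (s - (-2))) (-2)"
      by (intro arg_cong2[where f = residue] ext) (simp_all add: perron_kernel_def mult_ac)
    also have "\<dots> = complex_of_real y powr (-2) * 2 / ((-2) * ((-2) + 1))"
      by (rule residue_simple[of "- {0, -1}"]) (auto intro!: holomorphic_intros simp: add_eq_0_iff2)
    finally show ?thesis using y powr_of_real[of y "-2"] by (simp add: powr_minus powr_numeral field_simps)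
  qed
  have "(\<Sum>p\<in>{0, -1, -2}. R p) = R 0 + (R (-1) + R (-2))" for R :: "complex \<Rightarrow> complex" by simp
  thus ?thesis using y by (simp only: r0 r1 r2) (simp add: power2_eq_square field_simps)
qed

text \<open>For \<open>y \<le> 1\<close> the line is moved to the right, where there are no poles, and for \<open>y > 1\<close> to the left across the
  poles \<open>0\<close>, \<open>-1\<close> and \<open>-2\<close>. In both cases \<open>y powr c\<close> stays at most \<open>1\<close>, and the integral over the distant line vanishes
  in the limit.\<close>

lemma perron_formula:
  assumes y: "y > 0"
  shows "perron_integral 2 y = of_real (2 * pi * (max 0 (1 - 1 / y))\<^sup>2)"
proof -
  let ?f = "\<lambda>s. complex_of_real y powr s * perron_kernel s"
  define W where "W = (LINT t|lborel. (1 + \<bar>t::real\<bar>) powr (-2))"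
  have W: "W \<ge> 0" unfolding W_def by (intro Bochner_Integration.integral_nonneg) auto
  \<comment> \<open>Both cases exhibit a quantity that is independent of the line and bounded by \<open>8 W / c\<close> on every distant line.\<close>
  have small: "X = 0" if X: "\<And>c. c \<ge> 4 \<Longrightarrow> norm X \<le> 8 / c * W" for X :: complex
  proof -
    have "((\<lambda>c. 8 / c * W) \<longlongrightarrow> 0) at_top" by real_asymp
    moreover have "\<forall>\<^sub>F c in at_top. norm X \<le> 8 / c * W"
      using eventually_ge_at_top[of 4] by eventually_elim (rule X)
    ultimately have "norm X \<le> 0" by (intro tendsto_lowerbound[of _ 0 at_top]) auto
    thus ?thesis by simp
  qed
  show ?thesis
  proof (cases "y \<le> 1")
    case True
    have "perron_integral 2 y = 0"
    proof (rule small)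
      fix c :: real assume c: "c \<ge> 4"
      have "perron_integral c y = perron_integral 2 y + 2 * pi * (\<Sum>p\<in>{}. residue ?f p)"
        unfolding perron_integral_def
        by (rule vertical_line_shift(3)[of 1 2 c "c + 1" "{}" _ 3 1 "16 * (y powr 2 + y powr c)"])
           (use c y perron_integrand_decay[OF y, of 2 _ c] in \<open>auto intro!: holomorphic_on_subset[OF perron_integrand_holomorphic[OF y]]\<close>)
      hence "perron_integral 2 y = perron_integral c y" by simp
      also have "norm \<dots> \<le> 8 / \<bar>c\<bar> * W"
        unfolding W_def by (rule perron_integral_bound) (use c y True in \<open>auto intro: powr_le1\<close>)
      finally show "norm (perron_integral 2 y) \<le> 8 / c * W" using c by simp
    qed
    moreover have "max 0 (1 - 1 / y) = 0" using True y by (simp add: max_def field_simps)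
    ultimately show ?thesis by simp
  next
    case False
    have "perron_integral 2 y - 2 * pi * of_real ((1 - 1 / y)\<^sup>2) = 0"
    proof (rule small)
      fix c :: real assume c: "c \<ge> 4"
      have "perron_integral 2 y = perron_integral (-c) y + 2 * pi * (\<Sum>p\<in>{0, -1, -2}. residue ?f p)"
        unfolding perron_integral_def
        by (rule vertical_line_shift(3)[of "-c-1" "-c" 2 3 "{0, -1, -2}" _ 3 1 "16 * (y powr (-c) + y powr 2)"])
           (use c y perron_integrand_decay[OF y, of "-c" _ 2] in \<open>auto intro!: holomorphic_on_subset[OF perron_integrand_holomorphic[OF y]]\<close>)
      hence "perron_integral 2 y - 2 * pi * of_real ((1 - 1 / y)\<^sup>2) = perron_integral (-c) y"
        unfolding perron_residue_sum[OF y] by simp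
      also have "norm \<dots> \<le> 8 / \<bar>-c\<bar> * W"
        unfolding W_def by (rule perron_integral_bound)
          (use c y False in \<open>auto simp: powr_minus field_simps intro!: ge_one_powr_ge_zero\<close>)
      finally show "norm (perron_integral 2 y - 2 * pi * of_real ((1 - 1 / y)\<^sup>2)) \<le> 8 / c * W" using c by simp
    qed
    moreover have "max 0 (1 - 1 / y) = 1 - 1 / y" using False by (simp add: max_def field_simps)
    ultimately show ?thesis by simp
  qed
qed

section \<open>The second moment\<close>

text \<open>The factors \<open>s - 1\<close> and \<open>s ^ 2\<close> are split off \<open>\<zeta>(s) sing_limit s perron_kernel s\<close>, and \<open>\<zeta>\<close> is replaced by
  the entire function \<open>zeta_entire\<close>; the factor \<open>2 s + 1\<close> accounts for the pole of \<open>\<zeta>(2 s + 2)\<close> at \<open>s = -1/2\<close>. The result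
  is holomorphic in \<open>Re s > -3/4\<close> if the Riemann Hypothesis holds.\<close>

definition integrand_numerator :: "complex \<Rightarrow> complex" where
  "integrand_numerator s = zeta_entire s * zeta_entire (s + 1) * (2 * s + 1) / zeta_entire (2 * s + 2)
      * sing_product s * (2 / ((s + 1) * (s + 2)))"

definition integrand :: "complex \<Rightarrow> complex" where
  "integrand s = integrand_numerator s / ((s - 1) * s ^ 2)"

lemma integrand_eq:
  assumes "s \<noteq> 0" "s \<noteq> 1" "2 * s + 1 \<noteq> 0"
  shows "integrand s = riemann_zeta s * sing_limit s * perron_kernel s"
proof -
  have "s + 1 \<noteq> 1" "2 * s + 2 \<noteq> 1" using assms by (auto simp: add_eq_0_iff2 algebra_simps)
  hence "riemann_zeta (s + 1) = zeta_entire (s + 1) / s"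
    "riemann_zeta (2 * s + 2) = zeta_entire (2 * s + 2) / (2 * s + 1)"
    "riemann_zeta s = zeta_entire s / (s - 1)"
    using assms riemann_zeta_conv_zeta_entire[of "s + 1"] riemann_zeta_conv_zeta_entire[of "2 * s + 2"]
      riemann_zeta_conv_zeta_entire[of s] by (simp_all add: algebra_simps)
  thus ?thesis
    unfolding integrand_def integrand_numerator_def sing_limit_def perron_kernel_def
    by (simp add: power2_eq_square mult_ac)
qed

lemma zeta_entire_compose_holomorphic [holomorphic_intros]:
  "f holomorphic_on A \<Longrightarrow> (\<lambda>s. zeta_entire (f s)) holomorphic_on A"
  using holomorphic_on_compose[of f A zeta_entire] zeta_entire_holomorphic by (simp add: o_def)

lemma integrand_numerator_holomorphic:
  assumes rh: riemann_hypothesis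
  shows "integrand_numerator holomorphic_on {s. Re s > -3/4}"
  unfolding integrand_numerator_def
proof (intro holomorphic_intros sing_product_holomorphic)
  fix s :: complex assume s: "s \<in> {s. Re s > -3/4}"
  show "zeta_entire (2 * s + 2) \<noteq> 0" by (rule zeta_entire_nonzero[OF rh]) (use s in simp)
  have "Re (s + 1) \<noteq> 0" "Re (s + 2) \<noteq> 0" using s by auto
  thus "(s + 1) * (s + 2) \<noteq> 0" by (auto simp del: plus_complex.sel)
qed

lemma integrand_holomorphic:
  assumes rh: riemann_hypothesis
  shows "integrand holomorphic_on ({s. Re s > -3/4} - {0, 1})"
  unfolding integrand_def
  by (intro holomorphic_intros holomorphic_on_subset[OF integrand_numerator_holomorphic[OF rh]]) auto

text \<open>The exponents \<open>21/16\<close>, \<open>5/16\<close> and \<open>1/16\<close> for \<open>\<zeta>(s)\<close>, \<open>\<zeta>(s + 1)\<close> and \<open>1 / \<zeta>(2 s + 2)\<close> exceed the limits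
  \<open>5/4\<close>, \<open>1/4\<close> and \<open>0\<close> by \<open>1/16\<close> each. Together with the exponent \<open>-3\<close> of the kernel they add up to \<open>-21/16 < -1\<close>.\<close>

lemma integrand_decay:
  assumes rh: riemann_hypothesis and a: "a > -3/4"
  shows "\<exists>T C. \<forall>s. Re s \<ge> a \<and> \<bar>Im s\<bar> \<ge> T \<longrightarrow> norm (integrand s) \<le> C * (1 + \<bar>Im s\<bar>) powr (-21/16)"
proof -
  obtain T1 where T1: "T1 \<ge> 10" "\<And>s. -3/4 \<le> Re s \<Longrightarrow> \<bar>Im s\<bar> \<ge> T1 \<Longrightarrow> norm (riemann_zeta s) \<le> \<bar>Im s\<bar> powr (21/16)"
    using rh_zeta_convexity_bound[OF rh, of "-3/4" "21/16"] by auto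
  obtain T2 where T2: "T2 \<ge> 10" "\<And>s. 1/4 \<le> Re s \<Longrightarrow> \<bar>Im s\<bar> \<ge> T2 \<Longrightarrow> norm (riemann_zeta s) \<le> \<bar>Im s\<bar> powr (5/16)"
    using rh_zeta_convexity_bound[OF rh, of "1/4" "5/16"] by auto
  obtain T3 where T3: "T3 \<ge> 10" "\<And>s. 2 * a + 2 \<le> Re s \<Longrightarrow> \<bar>Im s\<bar> \<ge> T3 \<Longrightarrow> norm (1 / riemann_zeta s) \<le> \<bar>Im s\<bar> powr (1/16)"
    using rh_zeta_bound[OF rh, of "2 * a + 2" "1/16"] a by auto
  obtain C where C: "\<And>s. Re s > -3/4 \<Longrightarrow> norm (sing_product s) \<le> C" using sing_product_bounded by blast
  have C0: "C \<ge> 0" using order_trans[OF norm_ge_zero C[of 0]] by simp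
  define T where "T = max T1 (max T2 T3)"
  define D where "D = C * 2 powr (1/16) * 16"
  have "norm (integrand s) \<le> D * (1 + \<bar>Im s\<bar>) powr (-21/16)" if s: "Re s \<ge> a" "\<bar>Im s\<bar> \<ge> T" for s
  proof -
    define t where "t = \<bar>Im s\<bar>"
    have t: "t \<ge> T1" "t \<ge> T2" "t \<ge> T3" "t \<ge> 10" using s T1 by (auto simp: t_def T_def)
    have ne: "s \<noteq> 0" "s \<noteq> 1" using t by (auto simp: t_def)
    have "Im (2 * s + 1) \<noteq> 0" using t by (auto simp: t_def)
    hence ne': "2 * s + 1 \<noteq> 0" by (metis zero_complex.sel(2))
    have "norm (integrand s) = norm (riemann_zeta s) * (norm (sing_product s) * norm (riemann_zeta (s + 1)) * norm (1 / riemann_zeta (2 * s + 2))) * norm (perron_kernel s)"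
      unfolding integrand_eq[OF ne ne'] sing_limit_def by (simp add: norm_mult norm_divide)
    also have "\<dots> \<le> t powr (21/16) * (C * t powr (5/16) * (2 * t) powr (1/16)) * (16 * (1 + t) powr (-3))"
    proof (intro mult_mono mult_nonneg_nonneg)
      show "norm (riemann_zeta s) \<le> t powr (21/16)" unfolding t_def by (rule T1) (use s a t in \<open>auto simp: t_def\<close>)
      show "norm (sing_product s) \<le> C" by (rule C) (use s a in auto)
      show "norm (riemann_zeta (s + 1)) \<le> t powr (5/16)"
        using T2(2)[of "s + 1"] s a t by (simp add: t_def)
      show "norm (1 / riemann_zeta (2 * s + 2)) \<le> (2 * t) powr (1/16)"
        using T3(2)[of "2 * s + 2"] s a t by (simp add: t_def abs_mult)
      show "norm (perron_kernel s) \<le> 16 * (1 + t) powr (-3)"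
        unfolding t_def by (rule perron_kernel_bound) (use t in \<open>auto simp: t_def\<close>)
    qed (use C0 in auto)
    also have "\<dots> = D * (t powr (21/16) * t powr (5/16) * t powr (1/16)) * (1 + t) powr (-3)"
      using t by (simp add: D_def powr_mult)
    also have "t powr (21/16) * t powr (5/16) * t powr (1/16) = t powr (27/16)"
      by (simp flip: powr_add)
    also have "D * t powr (27/16) * (1 + t) powr (-3) \<le> D * (1 + t) powr (27/16) * (1 + t) powr (-3)"
      using C0 t by (intro mult_right_mono mult_left_mono powr_mono2) (auto simp: D_def)
    also have "\<dots> = D * ((1 + t) powr (27/16) * (1 + t) powr (-3))" by simp
    also have "(1 + t) powr (27/16) * (1 + t) powr (-3) = (1 + t) powr (-21/16)"
      by (simp flip: powr_add)
    finally show ?thesis by (simp add: t_def)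
  qed
  thus ?thesis by blast
qed

lemma singular_series_summable: "summable (\<lambda>n. \<bar>singular_series (Suc n)\<bar> * real (Suc n) powr (-2))"
proof -
  have "(\<lambda>k. of_real (singular_series k) * of_nat k powr (-2) :: complex) summable_on {1..}"
    using has_sum_singular_series[of 2] by (auto simp: summable_on_def)
  hence "(\<lambda>k. norm (of_real (singular_series k) * of_nat k powr (-2) :: complex)) summable_on {1..}"
    by (rule summable_on_iff_abs_summable_on_complex[THEN iffD1])
  hence "(\<lambda>k. \<bar>singular_series k\<bar> * real k powr (-2)) summable_on {1..}"
    by (rule summable_on_cong[THEN iffD1, rotated]) (auto simp: norm_mult norm_nat_powr)
  moreover have "bij_betw Suc UNIV {1..}"
    by (rule bij_betwI[where g = "\<lambda>n. n - 1"]) auto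
  ultimately have "(\<lambda>n. \<bar>singular_series (Suc n)\<bar> * real (Suc n) powr (-2)) summable_on UNIV"
    using summable_on_reindex_bij_betw[of Suc UNIV "{1..}" "\<lambda>k. \<bar>singular_series k\<bar> * real k powr (-2)"] by simp
  thus ?thesis by (rule summable_on_imp_summable)
qed

lemma singular_series_sums:
  assumes "Re s > 1"
  shows "(\<lambda>n. of_real (singular_series (Suc n)) * of_nat (Suc n) powr (-s)) sums (riemann_zeta s * sing_limit s)"
proof -
  have "bij_betw Suc UNIV {1..}"
    by (rule bij_betwI[where g = "\<lambda>n. n - 1"]) auto
  from has_sum_reindex_bij_betw[OF this, of "\<lambda>k. of_real (singular_series k) * of_nat k powr (-s)"] has_sum_singular_series[OF assms]
  have "((\<lambda>n. of_real (singular_series (Suc n)) * of_nat (Suc n) powr (-s)) has_sum (riemann_zeta s * sing_limit s)) UNIV"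
    by simp
  thus ?thesis by (rule has_sum_imp_sums)
qed

text \<open>Perron's formula applied to each term with \<open>y = x / k\<close>. Sum and integral may be exchanged because the Dirichlet series
  converges absolutely on \<open>Re s = 2\<close> and the kernel is integrable.\<close>

lemma S_sum_2_eq_integral:
  assumes x: "x > 0"
  shows "complex_of_real (2 * pi * (S_sum 2 x / x ^ 2)) = (LINT t|lborel. of_real x powr Complex 2 t * integrand (Complex 2 t))"
proof -
  let ?I = "LINT t|lborel. of_real x powr Complex 2 t * integrand (Complex 2 t)"
  let ?a = "\<lambda>n. \<bar>singular_series (Suc n)\<bar> * real (Suc n) powr (-2)"
    and ?w = "\<lambda>n. singular_series (Suc n) * (max 0 (1 - real (Suc n) / x))\<^sup>2"
  let ?K = "\<lambda>t. perron_kernel (Complex 2 t)"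
  define c where "c = (\<lambda>n. complex_of_real (singular_series (Suc n)))"
  define y where "y = (\<lambda>n. x / real (Suc n))"
  have y: "y n > 0" for n using x by (simp add: y_def)
  define f where "f = (\<lambda>n t. c n * (complex_of_real (y n) powr Complex 2 t * ?K t))"
  have contK: "continuous_on UNIV ?K"
  proof -
    have "Complex 2 t * (Complex 2 t + 1) * (Complex 2 t + 2) \<noteq> 0" for t
      by (simp only: mult_eq_0_iff de_Morgan_disj) (simp add: complex_eq_iff)
    thus ?thesis unfolding perron_kernel_def by (auto simp: Complex_eq intro!: continuous_intros)
  qed
  have intK: "integrable lborel (\<lambda>t. norm (?K t))"
  proof (intro integrable_norm integrable_vertical_line[where q = 3 and ?T0.0 = 1 and C = 16])
    show "continuous_on {s. Re s = 2} perron_kernel"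
    proof -
      have "s * (s + 1) * (s + 2) \<noteq> 0" if "Re s = 2" for s :: complex
        using that by (simp only: mult_eq_0_iff de_Morgan_disj) (auto simp: complex_eq_iff)
      thus ?thesis unfolding perron_kernel_def by (intro continuous_intros) auto
    qed
    show "norm (?K t) \<le> 16 * (1 + \<bar>t\<bar>) powr (-3)" if "\<bar>t\<bar> \<ge> 1" for t
      using perron_kernel_bound[of "Complex 2 t"] that by simp
  qed auto
  have nf: "norm (f n t) = x ^ 2 * ?a n * norm (?K t)" for n t
  proof -
    have "y n powr 2 = x ^ 2 * real (Suc n) powr (-2)"
      using x by (simp add: y_def powr_minus powr_numeral divide_inverse power_mult_distrib power_inverse del: of_nat_Suc)
    thus ?thesis unfolding f_def c_def norm_mult norm_real_powr[OF y] norm_of_real by (simp add: mult_ac)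
  qed
  have intf: "integrable lborel (f n)" for n
  proof -
    have "integrable lborel (\<lambda>t. x ^ 2 * ?a n * norm (?K t))"
      using intK by (rule integrable_mult_right)
    thus ?thesis
    proof (rule Bochner_Integration.integrable_bound)
      have "continuous_on UNIV (f n)"
        unfolding f_def using y[of n] by (intro continuous_intros contK) (auto simp: Complex_eq intro!: continuous_intros)
      thus "f n \<in> borel_measurable lborel" using borel_measurable_continuous_onI by simp
      show "AE t in lborel. norm (f n t) \<le> norm (x ^ 2 * ?a n * norm (?K t))"
        unfolding nf by (intro AE_I2) simp
    qed
  qed
  have "(\<lambda>n. LINT t|lborel. f n t) sums (LINT t|lborel. (\<Sum>n. f n t))"
  proof (rule sums_integral[OF intf])
    show "AE t in lborel. summable (\<lambda>n. norm (f n t))"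
      unfolding nf by (intro AE_I2 summable_mult2 summable_mult singular_series_summable)
    have "(LINT t|lborel. norm (f n t)) = x ^ 2 * ?a n * (LINT t|lborel. norm (?K t))" for n
      unfolding nf by simp
    thus "summable (\<lambda>n. LINT t|lborel. norm (f n t))"
      by (simp only:) (intro summable_mult2 summable_mult singular_series_summable)
  qed
  moreover have "(\<Sum>n. f n t) = of_real x powr Complex 2 t * integrand (Complex 2 t)" for t
  proof -
    let ?s = "Complex 2 t"
    have "f n t = (of_real x powr ?s * ?K t) * (c n * of_nat (Suc n) powr (- ?s))" for n
    proof -
      have "complex_of_real x = complex_of_real (y n * real (Suc n))" using x by (simp add: y_def del: of_nat_Suc)
      hence "complex_of_real x powr ?s = complex_of_real (y n) powr ?s * of_nat (Suc n) powr ?s"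
        using powr_times_real[of "complex_of_real (y n)" "of_nat (Suc n)" ?s] y[of n] by (simp del: of_nat_Suc)
      hence "complex_of_real (y n) powr ?s = of_real x powr ?s * of_nat (Suc n) powr (- ?s)"
        by (simp add: powr_minus field_simps del: of_nat_Suc)
      thus ?thesis unfolding f_def by (simp only: mult_ac)
    qed
    moreover have "(\<lambda>n. (of_real x powr ?s * ?K t) * (c n * of_nat (Suc n) powr (- ?s))) sums ((of_real x powr ?s * ?K t) * (riemann_zeta ?s * sing_limit ?s))"
      unfolding c_def by (intro sums_mult singular_series_sums) simp
    ultimately have "(\<Sum>n. f n t) = (of_real x powr ?s * ?K t) * (riemann_zeta ?s * sing_limit ?s)"
      by (simp only: sums_unique[symmetric])
    moreover have "integrand ?s = riemann_zeta ?s * sing_limit ?s * ?K t"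
      by (rule integrand_eq) (auto simp: complex_eq_iff)
    ultimately show ?thesis by (simp only: mult_ac)
  qed
  moreover have "(LINT t|lborel. f n t) = of_real (2 * pi * (?w n))" for n
  proof -
    have "(LINT t|lborel. f n t) = c n * perron_integral 2 (y n)"
      unfolding f_def perron_integral_def by simp
    thus ?thesis unfolding perron_formula[OF y] by (simp add: c_def y_def del: of_nat_Suc)
  qed
  ultimately have s1: "(\<lambda>n. complex_of_real (2 * pi * (?w n)))
      sums ?I"
    by (simp only:)
  have s2: "(\<lambda>n. complex_of_real (2 * pi * (?w n)))
      sums of_real (2 * pi * (S_sum 2 x / x ^ 2))"
  proof -
    define N where "N = nat \<lfloor>x\<rfloor>"
    have N: "real (Suc n) \<le> x \<longleftrightarrow> n < N" for n unfolding N_def using x by linarith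
    have z: "max 0 (1 - real (Suc n) / x) = 0" if "n \<notin> {..<N}" for n
    proof -
      have "x < real (Suc n)" using N[of n] that by simp
      thus ?thesis using x by (simp add: max_def)
    qed
    have "S_sum 2 x = (\<Sum>n<N. (x - real (Suc n)) ^ 2 * singular_series (Suc n))"
      unfolding S_sum_def
    proof (rule sum.reindex_bij_witness[of _ Suc "\<lambda>k. k - 1"])
      fix k assume "k \<in> {k. 1 \<le> k \<and> real k \<le> x}"
      thus "k - 1 \<in> {..<N}" using N[of "k - 1"] by simp
    next
      fix n assume "n \<in> {..<N}"
      thus "Suc n \<in> {k. 1 \<le> k \<and> real k \<le> x}" using N[of n] by simp
    qed auto
    also have "\<dots> = x ^ 2 * (\<Sum>n<N. ?w n)"
      unfolding sum_distrib_left
    proof (rule sum.cong[OF refl])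
      fix n assume "n \<in> {..<N}"
      hence "max 0 (1 - real (Suc n) / x) = (x - real (Suc n)) / x" using N[of n] x by (simp add: field_simps max_def)
      thus "(x - real (Suc n)) ^ 2 * singular_series (Suc n) = x ^ 2 * (?w n)"
        using x by (simp add: power_divide)
    qed
    finally have "S_sum 2 x / x ^ 2 = (\<Sum>n<N. ?w n)"
      using x by (simp del: of_nat_Suc)
    hence "2 * pi * (S_sum 2 x / x ^ 2) = (\<Sum>n<N. 2 * pi * (?w n))"
      by (simp only: sum_distrib_left)
    moreover have "(\<lambda>n. 2 * pi * (?w n)) sums
        (\<Sum>n<N. 2 * pi * (?w n))"
      by (rule sums_finite) (use z in auto)
    ultimately show ?thesis by (simp only: sums_of_real_iff)
  qed
  show ?thesis by (rule sums_unique2[OF s2 s1])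
qed

lemma DERIV_zeta_entire: "(zeta_entire has_field_derivative deriv zeta_entire s) (at s)"
  by (rule holomorphic_derivI[OF zeta_entire_holomorphic[of UNIV]]) auto

lemma residue_integrand_1:
  assumes rh: riemann_hypothesis and x: "x > 0"
  shows "residue (\<lambda>s. of_real x powr s * integrand s) 1 = of_real (x / 3)"
proof -
  have "residue (\<lambda>s. of_real x powr s * integrand s) 1 = residue (\<lambda>s. (of_real x powr s * integrand_numerator s / s ^ 2) / (s - 1)) 1"
    by (intro arg_cong2[where f = residue] ext) (simp_all add: integrand_def mult_ac)
  also have "\<dots> = of_real x powr 1 * integrand_numerator 1 / 1 ^ 2"
  proof (rule residue_simple[of "{s. Re s > -3/4} - {0}"])
    show "open ({s. Re s > -3/4} - {0 :: complex})" by (intro open_Diff open_halfspace_Re_gt) auto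
    show "(\<lambda>s. of_real x powr s * integrand_numerator s / s ^ 2) holomorphic_on {s. Re s > -3/4} - {0}"
      using x by (intro holomorphic_intros holomorphic_on_subset[OF integrand_numerator_holomorphic[OF rh]]) auto
  qed auto
  also have "integrand_numerator 1 = 1 / 3"
  proof -
    have "zeta_entire 2 = riemann_zeta 2" "zeta_entire 4 = 3 * riemann_zeta 4" by (simp_all add: zeta_entire_def)
    moreover have "riemann_zeta 4 \<noteq> 0" "riemann_zeta 2 \<noteq> 0" by (rule euler_prod_tendsto(1), simp)+
    moreover have "riemann_zeta 2 * sing_product 1 = riemann_zeta 4" using sing_product_1 by (simp add: mult.commute)
    ultimately show ?thesis by (simp add: integrand_numerator_def)
  qed
  finally show ?thesis using x by simp
qed

text \<open>The contributions of \<open>\<zeta>'(2) / \<zeta>(2)\<close> from \<open>sing_product\<close> and from \<open>zeta_entire (2 s + 2)\<close> cancel. What remains of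
  the logarithmic derivative is \<open>ln (2\<pi>) - 1\<close> from \<open>zeta_entire s\<close>, \<open>\<gamma>\<close> from \<open>zeta_entire (s + 1)\<close>, \<open>2\<close> from
  \<open>2 s + 1\<close>, \<open>-2\<close> from the factor \<open>2 s + 1\<close> inside \<open>zeta_entire (2 s + 2)\<close>, and \<open>-3/2\<close> from the kernel.\<close>

lemma deriv_integrand_numerator:
  "(integrand_numerator has_field_derivative of_real ((ln (2 * pi) + euler_mascheroni - 5 / 2) / 2)) (at 0)" and
  integrand_numerator_0: "integrand_numerator 0 = 1 / 2"
proof -
  define z where "z = riemann_zeta 2"
  define z' where "z' = deriv riemann_zeta 2"
  have z0: "z \<noteq> 0" unfolding z_def by (rule euler_prod_tendsto(1)) simp
  have Z2: "zeta_entire 2 = z" by (simp add: zeta_entire_def z_def)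
  have dz: "(riemann_zeta has_field_derivative z') (at 2)"
    unfolding z'_def using holomorphic_derivI[OF riemann_zeta_holomorphic[of "- {1}"], of 2] by auto
  have "((\<lambda>s. (s - 1) * riemann_zeta s) has_field_derivative z + z') (at 2)"
    using dz by (auto intro!: derivative_eq_intros simp: z_def)
  hence dZ2: "(zeta_entire has_field_derivative z + z') (at 2)"
    by (rule has_field_derivative_transform_within_open[of _ _ _ "- {1}"]) (auto simp: zeta_entire_def)
  have d1: "(zeta_entire has_field_derivative of_real (ln (2 * pi) / 2 - 1 / 2)) (at 0)"
    using DERIV_zeta_entire[of 0] by (simp add: deriv_zeta_entire_0)
  have d2: "((\<lambda>s. zeta_entire (s + 1)) has_field_derivative of_real euler_mascheroni) (at 0)"
    using DERIV_zeta_entire[of "0 + 1"] by (subst (asm) DERIV_shift) (simp add: deriv_zeta_entire_1)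
  have d3: "((\<lambda>s. zeta_entire (2 * s + 2)) has_field_derivative (z + z') * 2) (at 0)"
    by (rule DERIV_chain2[of zeta_entire]) (use dZ2 in \<open>auto intro!: derivative_eq_intros\<close>)
  have d4: "(sing_product has_field_derivative 2 * z') (at 0)"
    using holomorphic_derivI[OF sing_product_holomorphic open_halfspace_Re_gt, of 0] sing_product_0(2) by (simp add: z'_def)
  have v: "sing_product 0 = z" "zeta_entire 0 = 1 / 2" by (simp_all add: sing_product_0(1) zeta_entire_0 z_def)
  show "integrand_numerator 0 = 1 / 2" using z0 by (simp add: integrand_numerator_def v Z2)
  have dL: "((\<lambda>s::complex. 2 * s + 1) has_field_derivative 2) (at 0)"
    by (auto intro!: derivative_eq_intros)
  have dR: "((\<lambda>s::complex. 2 / ((s + 1) * (s + 2))) has_field_derivative - 3 / 2) (at 0)"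
    by (auto intro!: derivative_eq_intros)
  have nz: "zeta_entire (2 * 0 + 2) \<noteq> 0" using z0 Z2 by simp
  have "((\<lambda>s. zeta_entire s * zeta_entire (s + 1) * (2 * s + 1) / zeta_entire (2 * s + 2) * sing_product s * (2 / ((s + 1) * (s + 2))))
     has_field_derivative of_real ((ln (2 * pi) + euler_mascheroni - 5 / 2) / 2)) (at 0)"
    by (rule DERIV_cong[OF DERIV_mult[OF DERIV_mult[OF DERIV_divide[OF DERIV_mult[OF DERIV_mult[OF d1 d2] dL] d3 nz] d4] dR]])
       (use z0 in \<open>simp add: v Z2 field_simps\<close>)
  thus "(integrand_numerator has_field_derivative of_real ((ln (2 * pi) + euler_mascheroni - 5 / 2) / 2)) (at 0)"
    unfolding integrand_numerator_def .
qed

text \<open>The double pole: the residue is the derivative at \<open>0\<close> of the remaining factor, in which \<open>ln x\<close> comes from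
  \<open>x powr s\<close>. The number \<open>3/2\<close> is the harmonic number of \<open>2\<close>.\<close>

lemma residue_integrand_0:
  assumes rh: riemann_hypothesis and x: "x > 0"
  shows "residue (\<lambda>s. of_real x powr s * integrand s) 0 = of_real (- 1 / 2 * (ln x - 3 / 2 + euler_mascheroni + ln (2 * pi)))"
proof -
  define g where "g = (\<lambda>s. of_real x powr s * integrand_numerator s / (s - 1))"
  have "residue (\<lambda>s. of_real x powr s * integrand s) 0 = residue (\<lambda>s. g s / s ^ Suc 1) 0"
    by (intro arg_cong2[where f = residue] ext) (simp_all add: integrand_def g_def power2_eq_square)
  also have "\<dots> = (deriv ^^ 1) g 0 / fact 1"
  proof (rule residue_holomorphic_over_power'[of "{s. Re s > -3/4} - {1}"])
    show "open ({s. Re s > -3/4} - {1 :: complex})" by (intro open_Diff open_halfspace_Re_gt) auto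
    show "g holomorphic_on {s. Re s > -3/4} - {1}"
      unfolding g_def using x by (intro holomorphic_intros holomorphic_on_subset[OF integrand_numerator_holomorphic[OF rh]]) auto
  qed auto
  also have "\<dots> = deriv g 0" by simp
  also have "(g has_field_derivative of_real (- 1 / 2 * (ln x - 3 / 2 + euler_mascheroni + ln (2 * pi)))) (at 0)"
  proof -
    have dx: "((\<lambda>s. complex_of_real x powr s) has_field_derivative of_real (ln x)) (at 0)"
    proof -
      have "complex_of_real x \<noteq> 0" using x by simp
      from DERIV_const_powr[OF DERIV_ident this, of 0] show ?thesis
        unfolding Ln_of_real[OF x] using \<open>complex_of_real x \<noteq> 0\<close> by (simp only: powr_zero_eq_one mult_1_right if_False)
    qed
    show ?thesis unfolding g_def using x
      by (auto intro!: derivative_eq_intros dx deriv_integrand_numerator simp: integrand_numerator_0 Ln_of_real field_simps)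
  qed
  hence "deriv g 0 = of_real (- 1 / 2 * (ln x - 3 / 2 + euler_mascheroni + ln (2 * pi)))" by (rule DERIV_imp_deriv)
  finally show ?thesis .
qed

lemma E_err_2_bigo:
  assumes rh: riemann_hypothesis and \<epsilon>: "\<epsilon> > 0"
  shows "E_err 2 \<in> O[at_top](\<lambda>x. x powr (real 2 - 3 / 4 + \<epsilon>))"
proof -
  let ?M = "\<lambda>x::real. x / 3 - 1 / 2 * (ln x - 3 / 2 + euler_mascheroni + ln (2 * pi))"
  \<comment> \<open>For large \<open>\<epsilon>\<close> the line must still lie to the left of the pole at \<open>0\<close>.\<close>
  define a where "a = min (-3/4 + \<epsilon>) (-1/2)"
  have a: "-3/4 < a" "a < 0" "a \<le> -3/4 + \<epsilon>" using \<epsilon> by (auto simp: a_def)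
  obtain T C where TC: "\<And>s. Re s \<ge> a \<Longrightarrow> \<bar>Im s\<bar> \<ge> T \<Longrightarrow> norm (integrand s) \<le> C * (1 + \<bar>Im s\<bar>) powr (-21/16)"
    using integrand_decay[OF rh a(1)] by blast
  define B where "B = (LINT t|lborel. norm (integrand (Complex a t)))"
  have int: "integrable lborel (\<lambda>t. integrand (Complex a t))"
  proof (rule integrable_vertical_line[where q = "21/16" and ?T0.0 = T and C = C])
    show "continuous_on {s. Re s = a} integrand"
      by (rule continuous_on_subset[OF holomorphic_on_imp_continuous_on[OF integrand_holomorphic[OF rh]]]) (use a in auto)
    show "norm (integrand (Complex a t)) \<le> C * (1 + \<bar>t\<bar>) powr (-(21/16))" if "\<bar>t\<bar> \<ge> T" for t
      using TC[of "Complex a t"] that by simp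
  qed simp
  have main: "\<bar>E_err 2 x\<bar> \<le> B / (2 * pi) * x powr (2 - 3 / 4 + \<epsilon>)" if x: "x \<ge> 1" for x
  proof -
    have x0: "x > 0" using x by simp
    let ?f = "\<lambda>s. of_real x powr s * integrand s"
    let ?J = "LINT t|lborel. ?f (Complex a t)"
    have "(LINT t|lborel. ?f (Complex 2 t)) = ?J + 2 * pi * (\<Sum>p\<in>{0, 1}. residue ?f p)"
    proof (rule vertical_line_shift(3)[where a' = "-3/4" and b' = 3 and q = "21/16" and ?T0.0 = T and C = "x powr 2 * C"])
      show "?f holomorphic_on {s. -3/4 < Re s \<and> Re s < 3} - {0, 1}"
        using x0 by (intro holomorphic_intros holomorphic_on_subset[OF integrand_holomorphic[OF rh]]) auto
      fix s assume s: "a \<le> Re s" "Re s \<le> 2" "\<bar>Im s\<bar> \<ge> T"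
      have "norm (?f s) = x powr Re s * norm (integrand s)" by (simp add: norm_mult norm_real_powr[OF x0])
      also have "\<dots> \<le> x powr 2 * (C * (1 + \<bar>Im s\<bar>) powr (-21/16))"
        using s x TC[of s] by (intro mult_mono powr_mono) auto
      finally show "norm (?f s) \<le> x powr 2 * C * (1 + \<bar>Im s\<bar>) powr (-(21/16))" by simp
    qed (use a in auto)
    also have "(\<Sum>p\<in>{0, 1}. residue ?f p) = of_real (?M x)"
    proof -
      have "(\<Sum>p\<in>{0, 1}. R p) = R 0 + R 1" for R :: "complex \<Rightarrow> complex" by simp
      thus ?thesis by (simp only: residue_integrand_0[OF rh x0] residue_integrand_1[OF rh x0]) (simp flip: of_real_add)
    qed
    also have "(LINT t|lborel. ?f (Complex 2 t)) = complex_of_real (2 * pi * (S_sum 2 x / x ^ 2))"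
      by (rule S_sum_2_eq_integral[OF x0, symmetric])
    finally have "complex_of_real (2 * pi * (S_sum 2 x / x ^ 2) - 2 * pi * (?M x))
       = ?J" by simp
    moreover have "2 * pi * (S_sum 2 x / x ^ 2) - 2 * pi * (?M x)
        = 2 * pi * (E_err 2 x / x ^ 2)"
    proof -
      have h: "harm 2 = (3 / 2 :: real)" by (simp add: harm_expand)
      have "E_err 2 x = S_sum 2 x - x ^ 2 * (?M x)"
        unfolding E_err_def h by (simp add: power2_eq_square power3_eq_cube algebra_simps)
      thus ?thesis using x0 by (simp add: diff_divide_distrib right_diff_distrib)
    qed
    ultimately have "complex_of_real (2 * pi * (E_err 2 x / x ^ 2)) = ?J" by (simp only:)
    hence "\<bar>2 * pi * (E_err 2 x / x ^ 2)\<bar> = norm ?J"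
      using norm_of_real[where 'a = complex, of "2 * pi * (E_err 2 x / x ^ 2)"] by (simp only:)
    hence "2 * pi * (\<bar>E_err 2 x\<bar> / x ^ 2) = norm ?J"
      by (simp only: abs_mult abs_divide abs_power2 abs_numeral abs_of_pos[OF pi_gt_zero])
    also have "\<dots> \<le> (LINT t|lborel. norm (?f (Complex a t)))" by (rule integral_norm_bound)
    also have "\<dots> = x powr a * B"
      unfolding B_def by (simp add: norm_mult norm_real_powr[OF x0])
    also have "\<dots> \<le> x powr (-3/4 + \<epsilon>) * B"
      using x a unfolding B_def by (intro mult_right_mono powr_mono Bochner_Integration.integral_nonneg) auto
    finally have "\<bar>E_err 2 x\<bar> \<le> B / (2 * pi) * (x ^ 2 * x powr (-3/4 + \<epsilon>))"
      using x0 by (simp add: field_simps)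
    also have "x ^ 2 * x powr (-3/4 + \<epsilon>) = x powr (2 - 3 / 4 + \<epsilon>)"
      using x0 powr_add[of x 2 "-3/4 + \<epsilon>"] by (simp add: powr_numeral)
    finally show ?thesis .
  qed
  show ?thesis
  proof (rule bigoI[of _ "B / (2 * pi)"])
    show "\<forall>\<^sub>F x in at_top. norm (E_err 2 x) \<le> B / (2 * pi) * norm (x powr (real 2 - 3 / 4 + \<epsilon>))"
      using eventually_ge_at_top[of 1] by eventually_elim (use main in simp)
  qed
qed

section \<open>Higher moments by integration\<close>

lemma DERIV_truncated_power:
  "((\<lambda>y::real. max 0 y ^ Suc (Suc n)) has_real_derivative real (Suc (Suc n)) * max 0 y ^ Suc n) (at y)"
proof (cases y "0::real" rule: linorder_cases)
  case less
  have "((\<lambda>y::real. 0) has_real_derivative 0) (at y)" by simp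
  hence "((\<lambda>y::real. max 0 y ^ Suc (Suc n)) has_real_derivative 0) (at y)"
    by (rule has_field_derivative_transform_within_open[of _ _ _ "{..<0}"]) (use less in auto)
  thus ?thesis using less by simp
next
  case greater
  have "((\<lambda>y::real. y ^ Suc (Suc n)) has_real_derivative real (Suc (Suc n)) * y ^ Suc n) (at y)"
    using DERIV_pow[of "Suc (Suc n)" y] by simp
  hence "((\<lambda>y::real. max 0 y ^ Suc (Suc n)) has_real_derivative real (Suc (Suc n)) * y ^ Suc n) (at y)"
    by (rule has_field_derivative_transform_within_open[of _ _ _ "{0<..}"]) (use greater in auto)
  thus ?thesis using greater by simp
next
  case equal
  have "((\<lambda>y::real. max 0 y ^ Suc (Suc n)) has_real_derivative 0) (at 0)"
    unfolding CARAT_DERIV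
  proof (intro exI[of _ "\<lambda>z::real. max 0 z ^ Suc n"] conjI allI)
    show "max 0 z ^ Suc (Suc n) - max 0 0 ^ Suc (Suc n) = max 0 z ^ Suc n * (z - 0)" for z :: real
      by (simp add: max_def)
    show "isCont (\<lambda>z::real. max 0 z ^ Suc n) 0" by (intro continuous_intros)
  qed simp
  thus ?thesis using equal by simp
qed

lemma S_sum_eq_truncated:
  assumes "m > 0" "x < real (Suc N)"
  shows "S_sum m x = (\<Sum>k\<in>{1..N}. max 0 (x - real k) ^ m * singular_series k)"
proof -
  have "(\<Sum>k\<in>{1..N}. max 0 (x - real k) ^ m * singular_series k) = (\<Sum>k | 1 \<le> k \<and> real k \<le> x. max 0 (x - real k) ^ m * singular_series k)"
  proof (rule sum.mono_neutral_right)
    show "{k. 1 \<le> k \<and> real k \<le> x} \<subseteq> {1..N}" using assms by auto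
    show "\<forall>k\<in>{1..N} - {k. 1 \<le> k \<and> real k \<le> x}. max 0 (x - real k) ^ m * singular_series k = 0"
      using assms by (auto simp: max_def)
  qed auto
  also have "\<dots> = S_sum m x" unfolding S_sum_def by (intro sum.cong refl) (auto simp: max_def)
  finally show ?thesis ..
qed

text \<open>Near a given \<open>x\<close> the range of summation can be fixed, at the price of truncating the powers at \<open>0\<close>; truncated powers
  of exponent at least two are differentiable everywhere.\<close>

lemma DERIV_S_sum:
  assumes "m > 0"
  shows "(S_sum (Suc m) has_real_derivative real (Suc m) * S_sum m x) (at x)"
proof -
  obtain n where m: "m = Suc n" using assms by (cases m) auto
  obtain N :: nat where N: "x < real N" using reals_Archimedean2 by blast
  hence N': "x < real (Suc N)" by simp
  have "((\<lambda>y. \<Sum>k\<in>{1..N}. max 0 (y - real k) ^ Suc m * singular_series k) has_real_derivative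
      (\<Sum>k\<in>{1..N}. real (Suc m) * max 0 (x - real k) ^ m * 1 * singular_series k)) (at x)"
  proof (intro DERIV_sum DERIV_cmult_right)
    fix k
    show "((\<lambda>y. max 0 (y - real k) ^ Suc m) has_real_derivative real (Suc m) * max 0 (x - real k) ^ m * 1) (at x)"
      unfolding m by (rule DERIV_chain2[OF DERIV_truncated_power]) (auto intro!: derivative_eq_intros)
  qed
  moreover have "(\<Sum>k\<in>{1..N}. real (Suc m) * max 0 (x - real k) ^ m * 1 * singular_series k) = real (Suc m) * S_sum m x"
    unfolding S_sum_eq_truncated[OF assms N'] by (simp add: sum_distrib_left mult_ac)
  ultimately have "((\<lambda>y. \<Sum>k\<in>{1..N}. max 0 (y - real k) ^ Suc m * singular_series k) has_real_derivative real (Suc m) * S_sum m x) (at x)"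
    by simp
  thus ?thesis
    by (rule has_field_derivative_transform_within_open[of _ _ _ "{..<real (Suc N)}"]) (use N' S_sum_eq_truncated[of "Suc m"] in auto)
qed

text \<open>The main term is compatible with integration because \<open>harm (Suc m)\<close> exceeds \<open>harm m\<close> by \<open>1 / (m + 1)\<close>, which
  absorbs the derivative of \<open>ln x\<close>.\<close>

lemma DERIV_E_err:
  assumes "m > 0" "x > 0"
  shows "(E_err (Suc m) has_real_derivative real (Suc m) * E_err m x) (at x)"
proof -
  define c where "c = euler_mascheroni + ln (2 * pi)"
  have E: "E_err m = (\<lambda>x. S_sum m x - (1 / (real m + 1) * x ^ (m + 1) - 1 / 2 * x ^ m * (ln x - harm m + c)))" for m
    by (intro ext) (simp add: E_err_def c_def algebra_simps)
  have h: "harm (Suc m) = harm m + 1 / (real m + 1)" by (simp add: harm_Suc inverse_eq_divide add.commute)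
  have "((\<lambda>x. 1 / (real (Suc m) + 1) * x ^ (Suc m + 1) - 1 / 2 * x ^ Suc m * (ln x - harm (Suc m) + c)) has_real_derivative
     1 / (real (Suc m) + 1) * (real (Suc m + 1) * x ^ Suc m) - (1 / 2 * (real (Suc m) * x ^ m) * (ln x - harm (Suc m) + c) + 1 / x * (1 / 2 * x ^ Suc m))) (at x)"
  proof (intro DERIV_diff DERIV_cmult DERIV_mult)
    show "((\<lambda>x. x ^ (Suc m + 1)) has_real_derivative real (Suc m + 1) * x ^ Suc m) (at x)"
      using DERIV_pow[of "Suc m + 1" x] by simp
    show "((\<lambda>x. x ^ Suc m) has_real_derivative real (Suc m) * x ^ m) (at x)"
      using DERIV_pow[of "Suc m" x] by simp
    show "((\<lambda>x. ln x - harm (Suc m) + c) has_real_derivative 1 / x) (at x)"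
      using assms(2) by (auto intro!: derivative_eq_intros)
  qed
  moreover have "1 / (real (Suc m) + 1) * (real (Suc m + 1) * x ^ Suc m) - (1 / 2 * (real (Suc m) * x ^ m) * (ln x - harm (Suc m) + c) + 1 / x * (1 / 2 * x ^ Suc m))
     = real (Suc m) * (1 / (real m + 1) * x ^ (m + 1) - 1 / 2 * x ^ m * (ln x - harm m + c))"
  proof -
    define M r P where "M = real m + 1" and "r = 1 / (real m + 1)" and "P = x ^ m"
    have Mr: "M * r = 1" by (simp add: M_def r_def)
    have a: "1 / (real (Suc m) + 1) * (real (Suc m + 1) * x ^ Suc m) = x * P" by (simp add: P_def)
    have b: "1 / x * (1 / 2 * x ^ Suc m) = 1 / 2 * P" using assms(2) by (simp add: P_def)
    have d: "real (Suc m) = M" "x ^ (m + 1) = x * P" by (simp_all add: M_def P_def)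
    define L where "L = ln x - harm m + c"
    have l: "ln x - (harm m + r) + c = L - r" by (simp add: L_def)
    have "x * P - (1 / 2 * (M * P) * (L - r) + 1 / 2 * P) = x * P - 1 / 2 * (M * P) * L + (M * r) * (1 / 2 * P) - 1 / 2 * P"
      by (simp add: right_diff_distrib diff_divide_distrib mult_ac)
    also have "\<dots> = (M * r) * (x * P) - 1 / 2 * (M * P) * L" by (simp add: Mr)
    also have "\<dots> = M * (r * (x * P) - 1 / 2 * P * L)" by (simp add: right_diff_distrib diff_divide_distrib mult_ac)
    finally show ?thesis unfolding a b unfolding h d r_def[symmetric] P_def[symmetric] l L_def[symmetric] .
  qed
  ultimately have "((\<lambda>x. 1 / (real (Suc m) + 1) * x ^ (Suc m + 1) - 1 / 2 * x ^ Suc m * (ln x - harm (Suc m) + c)) has_real_derivative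
     real (Suc m) * (1 / (real m + 1) * x ^ (m + 1) - 1 / 2 * x ^ m * (ln x - harm m + c))) (at x)" by (simp only:)
  from DERIV_diff[OF DERIV_S_sum[OF assms(1)] this] show ?thesis
    unfolding E by (simp only: right_diff_distrib)
qed

text \<open>A multiple of \<open>x powr (\<beta> + 1)\<close> plus or minus \<open>f\<close> is eventually nondecreasing. The positivity of \<open>\<beta>\<close> ensures that
  the constant of integration is absorbed.\<close>

lemma bigo_of_derivative_bigo:
  fixes f f' :: "real \<Rightarrow> real"
  assumes der: "\<And>x. x > 0 \<Longrightarrow> (f has_real_derivative f' x) (at x)"
    and f': "f' \<in> O[at_top](\<lambda>x. x powr \<beta>)" and \<beta>: "\<beta> > 0"
  shows "f \<in> O[at_top](\<lambda>x. x powr (\<beta> + 1))"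
proof -
  obtain C where C: "C > 0" "\<forall>\<^sub>F x in at_top. norm (f' x) \<le> C * norm (x powr \<beta>)"
    using landau_o.bigE[OF f'] by blast
  then obtain X0 where X0: "\<And>x. x \<ge> X0 \<Longrightarrow> \<bar>f' x\<bar> \<le> C * x powr \<beta>"
    unfolding eventually_at_top_linorder by auto
  define X where "X = max 1 X0"
  define D where "D = (\<lambda>x. C / (\<beta> + 1) * x powr (\<beta> + 1))"
  have dD: "(D has_real_derivative C * x powr \<beta>) (at x)" if "x > 0" for x
    unfolding D_def using that \<beta> by (auto intro!: derivative_eq_intros)
  have bound: "\<bar>f x\<bar> \<le> \<bar>f X\<bar> + D x" if x: "x \<ge> X" for x
  proof -
    have "D X - f X \<le> D x - f x"
    proof (rule DERIV_nonneg_imp_nondecreasing[OF x])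
      fix y assume "X \<le> y" "y \<le> x"
      hence y: "y > 0" "y \<ge> X0" by (auto simp: X_def)
      show "\<exists>z. ((\<lambda>x. D x - f x) has_real_derivative z) (at y) \<and> 0 \<le> z"
        using DERIV_diff[OF dD[OF y(1)] der[OF y(1)]] X0[OF y(2)] by (intro exI[of _ "C * y powr \<beta> - f' y"]) auto
    qed
    moreover have "D X + f X \<le> D x + f x"
    proof (rule DERIV_nonneg_imp_nondecreasing[OF x])
      fix y assume "X \<le> y" "y \<le> x"
      hence y: "y > 0" "y \<ge> X0" by (auto simp: X_def)
      show "\<exists>z. ((\<lambda>x. D x + f x) has_real_derivative z) (at y) \<and> 0 \<le> z"
        using DERIV_add[OF dD[OF y(1)] der[OF y(1)]] X0[OF y(2)] by (intro exI[of _ "C * y powr \<beta> + f' y"]) auto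
    qed
    moreover have "D X \<ge> 0" unfolding D_def using C(1) \<beta> by simp
    ultimately show ?thesis by (simp add: abs_if)
  qed
  show ?thesis
  proof (rule bigoI[of _ "\<bar>f X\<bar> + C / (\<beta> + 1)"])
    show "\<forall>\<^sub>F x in at_top. norm (f x) \<le> (\<bar>f X\<bar> + C / (\<beta> + 1)) * norm (x powr (\<beta> + 1))"
      using eventually_ge_at_top[of X]
    proof eventually_elim
      case (elim x)
      have "\<bar>f X\<bar> * 1 \<le> \<bar>f X\<bar> * x powr (\<beta> + 1)"
        using elim \<beta> by (intro mult_left_mono ge_one_powr_ge_zero) (auto simp: X_def)
      with bound[OF elim] show ?case by (simp add: D_def algebra_simps)
    qed
  qed
qed

text \<open>The exponent \<open>m - 3/4 + \<epsilon>\<close> increases by \<open>1\<close> with every integration, so nothing is lost in the induction.\<close>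

lemma E_err_bigo:
  assumes rh: riemann_hypothesis and "m \<ge> 2" and \<epsilon>: "\<epsilon> > 0"
  shows "E_err m \<in> O[at_top](\<lambda>x. x powr (real m - 3 / 4 + \<epsilon>))"
  using \<open>m \<ge> 2\<close>
proof (induction m rule: dec_induct)
  case base
  show ?case by (rule E_err_2_bigo[OF rh \<epsilon>])
next
  case (step m)
  have "(\<lambda>x. real (Suc m) * E_err m x) \<in> O[at_top](\<lambda>x. x powr (real m - 3 / 4 + \<epsilon>))"
    using step.IH by simp
  hence "E_err (Suc m) \<in> O[at_top](\<lambda>x. x powr (real m - 3 / 4 + \<epsilon> + 1))"
    by (rule bigo_of_derivative_bigo[rotated]) (use step.hyps \<epsilon> in \<open>auto simp del: of_nat_Suc intro!: DERIV_E_err\<close>)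
  thus ?case by (simp add: algebra_simps)
qed

theorem theorem2:
  fixes m :: nat and \<epsilon> :: real
  assumes "riemann_hypothesis" and "m \<ge> 2" and "\<epsilon> > 0"
  shows "(\<lambda>x. S_sum m x
            - (1 / (real m + 1) * x ^ (m + 1)
               - 1 / 2 * x ^ m * (ln x - harm m + euler_mascheroni + ln (2 * pi))))
           \<in> O[at_top](\<lambda>x. x powr (real m - 3 / 4 + \<epsilon>)) \<and>
         E_err m \<in> O[at_top](\<lambda>x. x powr (real m - 3 / 4 + \<epsilon>))"
proof -
  have "(\<lambda>x. S_sum m x
            - (1 / (real m + 1) * x ^ (m + 1)
               - 1 / 2 * x ^ m * (ln x - harm m + euler_mascheroni + ln (2 * pi)))) = E_err m"
    by (intro ext) (simp only: E_err_def)
  thus ?thesis using E_err_bigo[OF assms] by simp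
qed

end
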